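(* Let $M$ be a model of the theory of the pairing function without cycles. The morphism of unitary rings from $\mathbb{Z}[X]$ to $K_0(M)$ sending $X$ to $[M]$ factorises as an isomorphism between $\mathbb{Z}[X]/(X-X^2)$ and $K_0(M)$. In particular, as $\mathbb{Z}[X]/(X-X^2)$ is itself isomorphic to $\mathbb{Z}^2$, the Grothendieck ring $K_0(M)$ is isomorphic to $\mathbb{Z}^2$.
   Context: A model of the theory of the pairing function without cycles is a (non-empty) structure $M$ in the language $\{l,r\}$ of two unary function symbols such that $x\mapsto (l(x),r(x))$ is a bijection $M\to M^2$ and no composition of at least one function among $l,r$ has a fixed point in $M$. For a structure $M$, $\operatorname{Def}(M)$ is the set of subsets of the disjoint union of all finite Cartesian powers of $M$ that are definable with parameters; $A\sim B$ means that there is a definable (with parameters) bijection between $A$ and $B$, and $[A]$ is the $\sim$-class of $A$. The quotient $\operatorname{Def}(M)/\!\sim$ is a commutative semiring under $[A]+[B]=[A'\sqcup B']$, where $A'\sim A$, $B'\sim B$ and $A',B'$ are disjoint (addition is disjoint union), and $[A]\times[B]=[A\times B]$. Identify two classes $a,b$ if there is a class $c$ with $a+c=b+c$; the quotient is an additively cancellative semiring. The Grothendieck ring $K_0(M)$ is the minimal ring in which this cancellative semiring embeds (its ring of formal differences); the image of $[M]$ in $K_0(M)$ is still denoted $[M]$. *)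

theory Defs
  imports "HOL-Algebra.UnivPoly" "HOL-Algebra.QuotRing" "HOL-Algebra.Chinese_Remainder"
begin

section \<open>The theory of the pairing function without cycles\<close>

text \<open>A structure in the language of two unary function symbols is given by two functions on a
  type, which is its (automatically non-empty) universe.\<close>

definition pairing_without_cycles :: "('a \<Rightarrow> 'a) \<Rightarrow> ('a \<Rightarrow> 'a) \<Rightarrow> bool" where
  "pairing_without_cycles l r \<longleftrightarrow>
     bij (\<lambda>x. (l x, r x)) \<and>
     (\<forall>fs. fs \<noteq> [] \<and> set fs \<subseteq> {l, r} \<longrightarrow> (\<forall>x. foldr (\<circ>) fs id x \<noteq> x))"

section \<open>Definable sets\<close>

datatype pterm = Var nat | L pterm | R pterm

datatype pform = Eq pterm pterm | Neg pform | Conj pform pform | Ex nat pform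

primrec pterm_val :: "('a \<Rightarrow> 'a) \<Rightarrow> ('a \<Rightarrow> 'a) \<Rightarrow> (nat \<Rightarrow> 'a) \<Rightarrow> pterm \<Rightarrow> 'a" where
  "pterm_val l r e (Var i) = e i"
| "pterm_val l r e (L t) = l (pterm_val l r e t)"
| "pterm_val l r e (R t) = r (pterm_val l r e t)"

primrec sat :: "('a \<Rightarrow> 'a) \<Rightarrow> ('a \<Rightarrow> 'a) \<Rightarrow> (nat \<Rightarrow> 'a) \<Rightarrow> pform \<Rightarrow> bool" where
  "sat l r e (Eq s t) \<longleftrightarrow> pterm_val l r e s = pterm_val l r e t"
| "sat l r e (Neg \<phi>) \<longleftrightarrow> \<not> sat l r e \<phi>"
| "sat l r e (Conj \<phi> \<psi>) \<longleftrightarrow> sat l r e \<phi> \<and> sat l r e \<psi>"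
| "sat l r e (Ex i \<phi>) \<longleftrightarrow> (\<exists>x. sat l r (e(i := x)) \<phi>)"

text \<open>The power \<open>M\<^sup>n\<close> is the set of lists of length \<open>n\<close>. The variables below \<open>n\<close> stand for the
  coordinates, all others for parameters; a formula contains only finitely many variables, so
  only finitely many parameters are used.\<close>

definition definable :: "('a \<Rightarrow> 'a) \<Rightarrow> ('a \<Rightarrow> 'a) \<Rightarrow> nat \<Rightarrow> 'a list set \<Rightarrow> bool" where
  "definable l r n S \<longleftrightarrow>
     (\<exists>\<phi> p. S = {xs. length xs = n \<and> sat l r (\<lambda>i. if i < n then xs ! i else p i) \<phi>})"

text \<open>The type of lists is the disjoint union of all finite powers. A definable subset of it meets
  only finitely many of the powers, each in a definable set. (If infinitely many powers were
  allowed, the Grothendieck ring would vanish.)\<close>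

definition Def :: "('a \<Rightarrow> 'a) \<Rightarrow> ('a \<Rightarrow> 'a) \<Rightarrow> 'a list set set" where
  "Def l r = {A. finite (length ` A) \<and> (\<forall>n. definable l r n {xs \<in> A. length xs = n})}"

text \<open>The graph of a map between such sets lies in the disjoint union of the \<open>M\<^sup>n \<times> M\<^sup>m\<close>. It is
  required to be definable in each of them, where \<open>M\<^sup>n \<times> M\<^sup>m\<close> is identified with
  \<open>M\<^bsup>n+m\<^esup>\<close> by concatenation.\<close>

definition definable_bij ::
  "('a \<Rightarrow> 'a) \<Rightarrow> ('a \<Rightarrow> 'a) \<Rightarrow> ('a list \<Rightarrow> 'a list) \<Rightarrow> 'a list set \<Rightarrow> 'a list set \<Rightarrow> bool" where
  "definable_bij l r f A B \<longleftrightarrow>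
     bij_betw f A B \<and>
     (\<forall>n m. definable l r (n + m) {xs @ f xs |xs. xs \<in> A \<and> length xs = n \<and> length (f xs) = m})"

definition def_equiv :: "('a \<Rightarrow> 'a) \<Rightarrow> ('a \<Rightarrow> 'a) \<Rightarrow> ('a list set \<times> 'a list set) set" where
  "def_equiv l r = {(A, B). A \<in> Def l r \<and> B \<in> Def l r \<and> (\<exists>f. definable_bij l r f A B)}"

definition def_class :: "('a \<Rightarrow> 'a) \<Rightarrow> ('a \<Rightarrow> 'a) \<Rightarrow> 'a list set \<Rightarrow> 'a list set set" where
  "def_class l r A = def_equiv l r `` {A}"

text \<open>Concatenation is injective on \<open>M\<^sup>n \<times> M\<^sup>m\<close> but not on the product of two disjoint unions of
  powers, so \<open>A \<times> B\<close> cannot be replaced by the set of all concatenations. Instead we say when a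
  map is a definable bijection from the product \<open>A \<times> B\<close>, which lies in the disjoint union of the
  \<open>M\<^sup>n \<times> M\<^sup>m\<close>, to \<open>C\<close>.\<close>

definition definable_prod_bij ::
  "('a \<Rightarrow> 'a) \<Rightarrow> ('a \<Rightarrow> 'a) \<Rightarrow> ('a list \<times> 'a list \<Rightarrow> 'a list) \<Rightarrow>
   'a list set \<Rightarrow> 'a list set \<Rightarrow> 'a list set \<Rightarrow> bool" where
  "definable_prod_bij l r f A B C \<longleftrightarrow>
     bij_betw f (A \<times> B) C \<and>
     (\<forall>n m k. definable l r (n + m + k)
        {xs @ ys @ f (xs, ys) |xs ys.
           xs \<in> A \<and> ys \<in> B \<and> length xs = n \<and> length ys = m \<and> length (f (xs, ys)) = k})"

definition Def_semiring :: "('a \<Rightarrow> 'a) \<Rightarrow> ('a \<Rightarrow> 'a) \<Rightarrow> 'a list set set ring" where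
  "Def_semiring l r =
     \<lparr>carrier = Def l r // def_equiv l r,
      mult = (\<lambda>a b. {C \<in> Def l r. \<exists>A\<in>a. \<exists>B\<in>b. \<exists>f. definable_prod_bij l r f A B C}),
      one = def_class l r {[]},
      zero = def_class l r {},
      add = (\<lambda>a b. {C. \<exists>A\<in>a. \<exists>B\<in>b. A \<inter> B = {} \<and> C \<in> def_class l r (A \<union> B)})\<rparr>"

section \<open>The Grothendieck ring\<close>

text \<open>The following two constructions are meant for a commutative semiring, respectively an
  additively cancellative commutative semiring; as for the library's quotient rings, the record
  type does not enforce this.\<close>

definition cancel_rel :: "('b, 'm) ring_scheme \<Rightarrow> ('b \<times> 'b) set" where
  "cancel_rel S = {(a, b). a \<in> carrier S \<and> b \<in> carrier S \<and>
     (\<exists>c\<in>carrier S. a \<oplus>\<^bsub>S\<^esub> c = b \<oplus>\<^bsub>S\<^esub> c)}"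

definition cancel_class :: "('b, 'm) ring_scheme \<Rightarrow> 'b \<Rightarrow> 'b set" where
  "cancel_class S a = cancel_rel S `` {a}"

definition cancel_quotient :: "('b, 'm) ring_scheme \<Rightarrow> 'b set ring" where
  "cancel_quotient S =
     \<lparr>carrier = carrier S // cancel_rel S,
      mult = (\<lambda>A B. \<Union>a\<in>A. \<Union>b\<in>B. cancel_class S (a \<otimes>\<^bsub>S\<^esub> b)),
      one = cancel_class S \<one>\<^bsub>S\<^esub>,
      zero = cancel_class S \<zero>\<^bsub>S\<^esub>,
      add = (\<lambda>A B. \<Union>a\<in>A. \<Union>b\<in>B. cancel_class S (a \<oplus>\<^bsub>S\<^esub> b))\<rparr>"

text \<open>The pair \<open>(a, b)\<close> represents the formal difference \<open>a - b\<close>.\<close>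

definition diff_rel :: "('b, 'm) ring_scheme \<Rightarrow> (('b \<times> 'b) \<times> ('b \<times> 'b)) set" where
  "diff_rel S = {((a, b), (c, d)).
     a \<in> carrier S \<and> b \<in> carrier S \<and> c \<in> carrier S \<and> d \<in> carrier S \<and>
     a \<oplus>\<^bsub>S\<^esub> d = c \<oplus>\<^bsub>S\<^esub> b}"

definition diff_class :: "('b, 'm) ring_scheme \<Rightarrow> 'b \<Rightarrow> 'b \<Rightarrow> ('b \<times> 'b) set" where
  "diff_class S a b = diff_rel S `` {(a, b)}"

definition difference_ring :: "('b, 'm) ring_scheme \<Rightarrow> ('b \<times> 'b) set ring" where
  "difference_ring S =
     \<lparr>carrier = (carrier S \<times> carrier S) // diff_rel S,
      mult = (\<lambda>x y. \<Union>(a, b)\<in>x. \<Union>(c, d)\<in>y.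
        diff_class S (a \<otimes>\<^bsub>S\<^esub> c \<oplus>\<^bsub>S\<^esub> b \<otimes>\<^bsub>S\<^esub> d) (a \<otimes>\<^bsub>S\<^esub> d \<oplus>\<^bsub>S\<^esub> b \<otimes>\<^bsub>S\<^esub> c)),
      one = diff_class S \<one>\<^bsub>S\<^esub> \<zero>\<^bsub>S\<^esub>,
      zero = diff_class S \<zero>\<^bsub>S\<^esub> \<zero>\<^bsub>S\<^esub>,
      add = (\<lambda>x y. \<Union>(a, b)\<in>x. \<Union>(c, d)\<in>y.
        diff_class S (a \<oplus>\<^bsub>S\<^esub> c) (b \<oplus>\<^bsub>S\<^esub> d))\<rparr>"

type_synonym 'a K0 = "('a list set set set \<times> 'a list set set set) set"

definition K0 :: "('a \<Rightarrow> 'a) \<Rightarrow> ('a \<Rightarrow> 'a) \<Rightarrow> 'a K0 ring" where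
  "K0 l r = difference_ring (cancel_quotient (Def_semiring l r))"

definition K0_class :: "('a \<Rightarrow> 'a) \<Rightarrow> ('a \<Rightarrow> 'a) \<Rightarrow> 'a list set \<Rightarrow> 'a K0" where
  "K0_class l r A =
     (let S = Def_semiring l r; Q = cancel_quotient S
      in diff_class Q (cancel_class S (def_class l r A)) \<zero>\<^bsub>Q\<^esub>)"

section \<open>The polynomial ring over the integers\<close>

abbreviation ZX :: "(int, nat \<Rightarrow> int) up_ring" where
  "ZX \<equiv> UP INTEG"

abbreviation X_ZX :: "nat \<Rightarrow> int" where
  "X_ZX \<equiv> monom ZX \<one>\<^bsub>INTEG\<^esub> 1"

abbreviation ideal_ZX :: "(nat \<Rightarrow> int) set" where
  "ideal_ZX \<equiv> PIdl\<^bsub>ZX\<^esub> (X_ZX \<ominus>\<^bsub>ZX\<^esub> X_ZX [^]\<^bsub>ZX\<^esub> (2::nat))"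

end

theory Submission
  imports Defs
begin

text \<open>
Write \<open>M\<close> for the universe and \<open>pr\<close> for the inverse of \<open>x \<mapsto> (l x, r x)\<close>. A \<^emph>\<open>term function\<close> is
built from the identity and constants by \<open>l\<close>, \<open>r\<close> and \<open>pr\<close>; a \<^emph>\<open>closed\<close> set is the solution set of
an equation between term functions; a \<^emph>\<open>constructible\<close> set is a Boolean combination of closed sets.
Since pairing codes tuples by elements, it suffices to work with subsets of \<open>M\<close>.

\<^emph>\<open>Geometry of closed sets.\<close> Equations between terms are solved by unification, and the absence of
cycles is exactly what makes the occurs check sound. Hence a nonempty closed set is the range of a
term function, and this function can be chosen constant or left invertible (\<open>closed_param\<close>): up to
bijection the only nonempty closed sets are a point and \<open>M\<close>. An equation between trees of variables
and constants that holds for two values of one variable holds for all its values (\<open>two_point\<close>). So,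
\<open>M\<close> being infinite, \<open>M\<close> is not a union of finitely many proper closed subsets (\<open>irreducible\<close>). Applied to fibres, this eliminates quantifiers: images of
constructible sets under term functions are constructible (\<open>constructible_image\<close>), and definable
sets are the same as constructible ones (\<open>definable_iff_constructible\<close>).

\<^emph>\<open>Two invariants.\<close> By irreducibility the indicator functions of the nonempty closed sets are linearly
independent (\<open>total_eq_0\<close>), so every weighting of these sets extends additively to all
constructible sets. The weight that is \<open>1\<close> on points and \<open>p\<close> on infinite closed sets is multiplicative
for \<open>p = 0\<close> and \<open>p = 1\<close>, and it is preserved by definable bijections, because a term function that is
injective on the complement of finitely many proper closed sets is left invertible
(\<open>left_inverse_of_generic_inj\<close>, \<open>euler_image\<close>). So there are two homomorphisms to the integers, one with
\<open>[M] \<mapsto> 0\<close> and one with \<open>[M] \<mapsto> 1\<close>.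

\<^emph>\<open>Nothing else survives.\<close> By inclusion and exclusion every class becomes a sum of points and copies
of \<open>M\<close> after adding such a sum (\<open>stably_standard\<close>). Therefore two definable sets with the same
pair of invariants are identified by cancellation (\<open>chi_complete\<close>), and the Grothendieck ring is
\<open>\<int> \<times> \<int>\<close> with \<open>[M] = (0, 1)\<close>. Finally \<open>p \<mapsto> (p(0), p(1))\<close> maps \<open>\<int>[X]\<close> onto \<open>\<int> \<times> \<int>\<close>, and
division by \<open>X\<close> and by \<open>X - 1\<close> shows that its kernel is generated by \<open>X - X\<^sup>2\<close>.
\<close>

section \<open>Difference rings of semirings with a complete invariant\<close>

lemma UN_UN_constant:
  assumes "x \<in> A" "y \<in> B" "\<And>x y. x \<in> A \<Longrightarrow> y \<in> B \<Longrightarrow> F x y = D"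
  shows "(\<Union>x\<in>A. \<Union>y\<in>B. F x y) = D"
  using assms by blast

text \<open>A homomorphism \<open>\<chi>\<close> from a semiring to a ring that separates precisely the elements that additive
cancellation does not identify, and whose values generate the ring. It identifies the ring of
formal differences with the target, and so also transports the ring laws to it.\<close>

locale additive_invariant = R: cring R for R (structure) +
  fixes S :: "('s, 'n) ring_scheme" and \<chi> :: "'s \<Rightarrow> 'a"
  assumes closed: "\<zero>\<^bsub>S\<^esub> \<in> carrier S" "\<one>\<^bsub>S\<^esub> \<in> carrier S"
      "\<And>a b. a \<in> carrier S \<Longrightarrow> b \<in> carrier S \<Longrightarrow> a \<oplus>\<^bsub>S\<^esub> b \<in> carrier S"
      "\<And>a b. a \<in> carrier S \<Longrightarrow> b \<in> carrier S \<Longrightarrow> a \<otimes>\<^bsub>S\<^esub> b \<in> carrier S"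
    and inv_closed [simp]: "\<And>a. a \<in> carrier S \<Longrightarrow> \<chi> a \<in> carrier R"
    and inv_zero: "\<chi> \<zero>\<^bsub>S\<^esub> = \<zero>"
    and inv_one: "\<chi> \<one>\<^bsub>S\<^esub> = \<one>"
    and inv_add: "\<And>a b. a \<in> carrier S \<Longrightarrow> b \<in> carrier S \<Longrightarrow> \<chi> (a \<oplus>\<^bsub>S\<^esub> b) = \<chi> a \<oplus> \<chi> b"
    and inv_mult: "\<And>a b. a \<in> carrier S \<Longrightarrow> b \<in> carrier S \<Longrightarrow> \<chi> (a \<otimes>\<^bsub>S\<^esub> b) = \<chi> a \<otimes> \<chi> b"
    and complete: "\<And>a b. a \<in> carrier S \<Longrightarrow> b \<in> carrier S \<Longrightarrow> \<chi> a = \<chi> b \<Longrightarrow>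
      \<exists>c\<in>carrier S. a \<oplus>\<^bsub>S\<^esub> c = b \<oplus>\<^bsub>S\<^esub> c"
    and generate: "\<And>x. x \<in> carrier R \<Longrightarrow> \<exists>a\<in>carrier S. \<exists>b\<in>carrier S. x \<oplus> \<chi> b = \<chi> a"
begin

abbreviation "Q \<equiv> cancel_quotient S"

abbreviation "cc \<equiv> cancel_class S"

text \<open>The formal difference with value \<open>x\<close>, given by all the pairs of cancellation classes representing
it. It is the inverse of the map induced by \<open>\<chi>\<close>, and needs no choice of a representative.\<close>

definition difference :: "'a \<Rightarrow> ('s set \<times> 's set) set" where
  "difference x = {(cc a, cc b) | a b. a \<in> carrier S \<and> b \<in> carrier S \<and> x \<oplus> \<chi> b = \<chi> a}"

lemma cancel_class_eq: "a \<in> carrier S \<Longrightarrow> cc a = {b \<in> carrier S. \<chi> b = \<chi> a}"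
proof (intro equalityI subsetI)
  fix b assume a: "a \<in> carrier S" and "b \<in> cc a"
  then obtain c where c: "b \<in> carrier S" "c \<in> carrier S" "a \<oplus>\<^bsub>S\<^esub> c = b \<oplus>\<^bsub>S\<^esub> c"
    by (auto simp: cancel_class_def cancel_rel_def)
  then have "\<chi> a \<oplus> \<chi> c = \<chi> b \<oplus> \<chi> c" using a by (metis inv_add)
  with a c show "b \<in> {b \<in> carrier S. \<chi> b = \<chi> a}" by simp
next
  fix b assume "a \<in> carrier S" "b \<in> {b \<in> carrier S. \<chi> b = \<chi> a}"
  then show "b \<in> cc a"
    using complete[of a b] by (auto simp: cancel_class_def cancel_rel_def)
qed

lemma cancel_class_eq_iff:
  "a \<in> carrier S \<Longrightarrow> b \<in> carrier S \<Longrightarrow> cc a = cc b \<longleftrightarrow> \<chi> a = \<chi> b"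
  by (auto simp: cancel_class_eq)

lemma carrier_Q: "carrier Q = cc ` carrier S"
  by (auto simp: cancel_quotient_def quotient_def cancel_class_def)

lemma add_Q:
  assumes "a \<in> carrier S" "b \<in> carrier S"
  shows "cc a \<oplus>\<^bsub>Q\<^esub> cc b = cc (a \<oplus>\<^bsub>S\<^esub> b)"
proof -
  have "cc (c \<oplus>\<^bsub>S\<^esub> d) = cc (a \<oplus>\<^bsub>S\<^esub> b)" if "c \<in> cc a" "d \<in> cc b" for c d
    using that assms by (simp add: cancel_class_eq_iff cancel_class_eq closed inv_add)
  moreover have "a \<in> cc a" "b \<in> cc b" using assms by (simp_all add: cancel_class_eq)
  ultimately have "(\<Union>c\<in>cc a. \<Union>d\<in>cc b. cc (c \<oplus>\<^bsub>S\<^esub> d)) = cc (a \<oplus>\<^bsub>S\<^esub> b)"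
    by (rule UN_UN_constant[rotated 2])
  then show ?thesis by (simp add: cancel_quotient_def)
qed

lemma mult_Q:
  assumes "a \<in> carrier S" "b \<in> carrier S"
  shows "cc a \<otimes>\<^bsub>Q\<^esub> cc b = cc (a \<otimes>\<^bsub>S\<^esub> b)"
proof -
  have "cc (c \<otimes>\<^bsub>S\<^esub> d) = cc (a \<otimes>\<^bsub>S\<^esub> b)" if "c \<in> cc a" "d \<in> cc b" for c d
    using that assms by (simp add: cancel_class_eq_iff cancel_class_eq closed inv_mult)
  moreover have "a \<in> cc a" "b \<in> cc b" using assms by (simp_all add: cancel_class_eq)
  ultimately have "(\<Union>c\<in>cc a. \<Union>d\<in>cc b. cc (c \<otimes>\<^bsub>S\<^esub> d)) = cc (a \<otimes>\<^bsub>S\<^esub> b)"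
    by (rule UN_UN_constant[rotated 2])
  then show ?thesis by (simp add: cancel_quotient_def)
qed

lemma diff_class_eq:
  assumes "a \<in> carrier S" "b \<in> carrier S" "x \<in> carrier R" "x \<oplus> \<chi> b = \<chi> a"
  shows "diff_class Q (cc a) (cc b) = difference x"
proof -
  have "cc a \<oplus>\<^bsub>Q\<^esub> cc d = cc c \<oplus>\<^bsub>Q\<^esub> cc b \<longleftrightarrow> x \<oplus> \<chi> d = \<chi> c"
    if "c \<in> carrier S" "d \<in> carrier S" for c d
  proof -
    have "cc a \<oplus>\<^bsub>Q\<^esub> cc d = cc c \<oplus>\<^bsub>Q\<^esub> cc b \<longleftrightarrow> \<chi> a \<oplus> \<chi> d = \<chi> c \<oplus> \<chi> b"
      using that assms by (simp add: add_Q cancel_class_eq_iff closed inv_add)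
    also have "\<chi> a \<oplus> \<chi> d = (x \<oplus> \<chi> d) \<oplus> \<chi> b"
      using that assms by (simp add: R.a_ac flip: assms(4))
    also have "(x \<oplus> \<chi> d) \<oplus> \<chi> b = \<chi> c \<oplus> \<chi> b \<longleftrightarrow> x \<oplus> \<chi> d = \<chi> c"
      using that assms by simp
    finally show ?thesis .
  qed
  then show ?thesis
    using assms by (auto simp: diff_class_def diff_rel_def difference_def carrier_Q)
qed

lemma ex_diff_class:
  assumes "x \<in> carrier R"
  obtains a b where "a \<in> carrier S" "b \<in> carrier S" "x \<oplus> \<chi> b = \<chi> a"
    "difference x = diff_class Q (cc a) (cc b)" "(cc a, cc b) \<in> difference x"
proof -
  obtain a b where ab: "a \<in> carrier S" "b \<in> carrier S" "x \<oplus> \<chi> b = \<chi> a"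
    using generate[OF assms] by blast
  moreover have "difference x = diff_class Q (cc a) (cc b)"
    using diff_class_eq[OF ab(1,2) assms ab(3)] by (rule sym)
  moreover have "(cc a, cc b) \<in> difference x"
    using ab unfolding difference_def by blast
  ultimately show ?thesis by (rule that)
qed

text \<open>The operations of the difference ring are unions over all representatives; such a union collapses
once all representatives lead to the same difference.\<close>

lemma difference_op:
  assumes x: "x \<in> carrier R" and y: "y \<in> carrier R"
    and *: "\<And>a b c d. \<lbrakk>a \<in> carrier S; b \<in> carrier S; c \<in> carrier S; d \<in> carrier S;
      x \<oplus> \<chi> b = \<chi> a; y \<oplus> \<chi> d = \<chi> c\<rbrakk> \<Longrightarrow> F (cc a) (cc b) (cc c) (cc d) = difference z"
  shows "(\<Union>(a, b)\<in>difference x. \<Union>(c, d)\<in>difference y. F a b c d) = difference z"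
proof -
  obtain a b where ab: "(cc a, cc b) \<in> difference x" using x by (rule ex_diff_class)
  obtain c d where cd: "(cc c, cc d) \<in> difference y" using y by (rule ex_diff_class)
  have "F (fst p) (snd p) (fst q) (snd q) = difference z"
    if pq: "p \<in> difference x" "q \<in> difference y" for p q
  proof -
    from pq(1) obtain a b where ab: "p = (cc a, cc b)" "a \<in> carrier S" "b \<in> carrier S"
      "x \<oplus> \<chi> b = \<chi> a" unfolding difference_def by blast
    from pq(2) obtain c d where cd: "q = (cc c, cc d)" "c \<in> carrier S" "d \<in> carrier S"
      "y \<oplus> \<chi> d = \<chi> c" unfolding difference_def by blast
    show ?thesis unfolding ab(1) cd(1) fst_conv snd_conv
      by (rule *[OF ab(2,3) cd(2,3) ab(4) cd(4)])
  qed
  then show ?thesis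
    unfolding case_prod_unfold by (rule UN_UN_constant[OF ab cd])
qed

theorem difference_iso: "difference \<in> ring_iso R (difference_ring Q)"
proof (rule ring_iso_memI)
  fix x y assume x: "x \<in> carrier R" and y: "y \<in> carrier R"
  have "(\<Union>(a, b)\<in>difference x. \<Union>(c, d)\<in>difference y.
      diff_class Q (a \<oplus>\<^bsub>Q\<^esub> c) (b \<oplus>\<^bsub>Q\<^esub> d)) = difference (x \<oplus> y)"
  proof (rule difference_op[OF x y])
    fix a b c d assume S: "a \<in> carrier S" "b \<in> carrier S" "c \<in> carrier S" "d \<in> carrier S"
      and eq: "x \<oplus> \<chi> b = \<chi> a" "y \<oplus> \<chi> d = \<chi> c"
    have "x \<oplus> y \<oplus> (\<chi> b \<oplus> \<chi> d) = \<chi> a \<oplus> \<chi> c"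
      using S x y by (simp add: eq[symmetric] R.a_ac)
    then show "diff_class Q (cc a \<oplus>\<^bsub>Q\<^esub> cc c) (cc b \<oplus>\<^bsub>Q\<^esub> cc d) = difference (x \<oplus> y)"
      using S x y by (simp add: add_Q) (intro diff_class_eq, simp_all add: closed inv_add)
  qed
  then show "difference (x \<oplus> y) = difference x \<oplus>\<^bsub>difference_ring Q\<^esub> difference y"
    by (simp add: difference_ring_def)
  have "(\<Union>(a, b)\<in>difference x. \<Union>(c, d)\<in>difference y.
      diff_class Q (a \<otimes>\<^bsub>Q\<^esub> c \<oplus>\<^bsub>Q\<^esub> b \<otimes>\<^bsub>Q\<^esub> d) (a \<otimes>\<^bsub>Q\<^esub> d \<oplus>\<^bsub>Q\<^esub> b \<otimes>\<^bsub>Q\<^esub> c)) =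
      difference (x \<otimes> y)"
  proof (rule difference_op[OF x y])
    fix a b c d assume S: "a \<in> carrier S" "b \<in> carrier S" "c \<in> carrier S" "d \<in> carrier S"
      and eq: "x \<oplus> \<chi> b = \<chi> a" "y \<oplus> \<chi> d = \<chi> c"
    have "x \<otimes> y \<oplus> (\<chi> a \<otimes> \<chi> d \<oplus> \<chi> b \<otimes> \<chi> c) = \<chi> a \<otimes> \<chi> c \<oplus> \<chi> b \<otimes> \<chi> d"
      using S x y by (simp add: eq[symmetric] R.l_distr R.r_distr R.a_ac)
    then show "diff_class Q (cc a \<otimes>\<^bsub>Q\<^esub> cc c \<oplus>\<^bsub>Q\<^esub> cc b \<otimes>\<^bsub>Q\<^esub> cc d)
        (cc a \<otimes>\<^bsub>Q\<^esub> cc d \<oplus>\<^bsub>Q\<^esub> cc b \<otimes>\<^bsub>Q\<^esub> cc c) = difference (x \<otimes> y)"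
      using S x y by (simp add: add_Q mult_Q closed) (intro diff_class_eq, simp_all add: closed inv_add inv_mult)
  qed
  then show "difference (x \<otimes> y) = difference x \<otimes>\<^bsub>difference_ring Q\<^esub> difference y"
    by (simp add: difference_ring_def)
next
  fix x assume x: "x \<in> carrier R"
  from x obtain a b where "a \<in> carrier S" "b \<in> carrier S"
    "difference x = diff_class Q (cc a) (cc b)" by (rule ex_diff_class)
  then show "difference x \<in> carrier (difference_ring Q)"
    by (auto simp: difference_ring_def quotient_def diff_class_def carrier_Q)
next
  show "difference \<one> = \<one>\<^bsub>difference_ring Q\<^esub>"
    using diff_class_eq[of "\<one>\<^bsub>S\<^esub>" "\<zero>\<^bsub>S\<^esub>" \<one>]
    by (simp add: difference_ring_def cancel_quotient_def[of S] closed inv_one inv_zero)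
next
  show "bij_betw difference (carrier R) (carrier (difference_ring Q))"
    unfolding bij_betw_def
  proof
    show "inj_on difference (carrier R)"
    proof (rule inj_onI)
      fix x y assume x: "x \<in> carrier R" and y: "y \<in> carrier R" and eq: "difference x = difference y"
      obtain a b where ab: "a \<in> carrier S" "b \<in> carrier S" "x \<oplus> \<chi> b = \<chi> a" "(cc a, cc b) \<in> difference x"
        using x by (rule ex_diff_class)
      then obtain a' b' where "a' \<in> carrier S" "b' \<in> carrier S" "cc a = cc a'" "cc b = cc b'"
        "y \<oplus> \<chi> b' = \<chi> a'"
        unfolding eq by (auto simp: difference_def)
      with ab have "y \<oplus> \<chi> b = x \<oplus> \<chi> b" by (simp add: cancel_class_eq_iff)
      with x y ab(2) show "x = y" by simp
    qed
    show "difference ` carrier R = carrier (difference_ring Q)"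
    proof (intro equalityI subsetI)
      fix D assume "D \<in> difference ` carrier R"
      then obtain x where x: "x \<in> carrier R" and D: "D = difference x" by blast
      from x obtain a b where "a \<in> carrier S" "b \<in> carrier S"
        "difference x = diff_class Q (cc a) (cc b)" by (rule ex_diff_class)
      then show "D \<in> carrier (difference_ring Q)" unfolding D
        by (auto simp: difference_ring_def quotient_def diff_class_def carrier_Q)
    next
      fix D assume "D \<in> carrier (difference_ring Q)"
      then obtain a b where ab: "a \<in> carrier S" "b \<in> carrier S" "D = diff_class Q (cc a) (cc b)"
        by (auto simp: difference_ring_def quotient_def diff_class_def carrier_Q)
      then have "D = difference (\<chi> a \<ominus> \<chi> b)"
        using diff_class_eq[of a b "\<chi> a \<ominus> \<chi> b"] by (simp add: R.minus_eq R.a_assoc R.l_neg)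
      moreover have "\<chi> a \<ominus> \<chi> b \<in> carrier R" using ab(1,2) by simp
      ultimately show "D \<in> difference ` carrier R" by (rule image_eqI)
    qed
  qed
qed

lemma difference_class: "a \<in> carrier S \<Longrightarrow> diff_class Q (cc a) \<zero>\<^bsub>Q\<^esub> = difference (\<chi> a)"
  using diff_class_eq[of a "\<zero>\<^bsub>S\<^esub>" "\<chi> a"] by (simp add: cancel_quotient_def[of S] closed inv_zero)

lemma difference_zero: "difference \<zero> = \<zero>\<^bsub>difference_ring Q\<^esub>"
  using difference_class[of "\<zero>\<^bsub>S\<^esub>"]
  by (simp add: difference_ring_def cancel_quotient_def[of S] closed inv_zero)

lemma difference_ring_cring: "cring (difference_ring Q)"
  using R.ring_iso_imp_img_cring[OF difference_iso] by (simp add: difference_zero)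

end

section \<open>Integer polynomials modulo the ideal of X - X^2\<close>

lemma INTEG_ops [simp]:
  "x \<oplus>\<^bsub>INTEG\<^esub> y = x + y" "\<one>\<^bsub>INTEG\<^esub> = 1" "\<zero>\<^bsub>INTEG\<^esub> = 0" "carrier INTEG = UNIV"
  by (simp_all add: INTEG_def)

abbreviation Z2 :: "(int \<times> int) ring" where
  "Z2 \<equiv> RDirProd INTEG INTEG"

lemma Z2_simps [simp]:
  "carrier Z2 = UNIV" "x \<otimes>\<^bsub>Z2\<^esub> y = (fst x * fst y, snd x * snd y)"
  "x \<oplus>\<^bsub>Z2\<^esub> y = (fst x + fst y, snd x + snd y)" "\<one>\<^bsub>Z2\<^esub> = (1, 1)" "\<zero>\<^bsub>Z2\<^esub> = (0, 0)"
  by (simp_all add: RDirProd_def DirProd_def monoid.defs case_prod_unfold)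

lemma cring_Z2: "cring Z2"
proof (rule cringI)
  show "abelian_group Z2"
    using RDirProd_ring[OF INTEG.R.ring_axioms INTEG.R.ring_axioms] by (rule ring.is_abelian_group)
  show "comm_monoid Z2"
    by (rule comm_monoidI) (simp_all add: mult.assoc mult.commute)
qed (simp add: algebra_simps)

definition eval01 :: "(nat \<Rightarrow> int) \<Rightarrow> int \<times> int" where
  "eval01 p = (eval INTEG INTEG id 0 p, eval INTEG INTEG id 1 p)"

lemma eval_hom: "eval INTEG INTEG id a \<in> ring_hom ZX INTEG"
  by (rule INTEG.eval_ring_hom) simp

lemma eval01_hom: "eval01 \<in> ring_hom ZX Z2"
  using ring_hom_mult[OF eval_hom] ring_hom_add[OF eval_hom] ring_hom_one[OF eval_hom]
  by (intro ring_hom_memI) (simp_all add: eval01_def)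

lemma eval_X: "eval INTEG INTEG id a X_ZX = a"
  by (rule INTEG.eval_monom1) simp

lemma X_closed: "X_ZX \<in> carrier ZX"
  by (rule INTEG.monom_closed) simp

lemma eval01_X: "eval01 X_ZX = (0, 1)"
  by (simp only: eval01_def eval_X)

lemma int_hom_unique:
  fixes A (structure)
  assumes R: "ring A" and f: "f \<in> ring_hom INTEG A" and g: "g \<in> ring_hom INTEG A"
  shows "f n = g n"
proof -
  interpret A: ring A by (rule R)
  have one: "f 1 = \<one>\<^bsub>A\<^esub>" "g 1 = \<one>\<^bsub>A\<^esub>"
    using ring_hom_one[OF f] ring_hom_one[OF g] by simp_all
  have add: "f (i + j) = f i \<oplus>\<^bsub>A\<^esub> f j" "g (i + j) = g i \<oplus>\<^bsub>A\<^esub> g j" for i j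
    using ring_hom_add[OF f, of i j] ring_hom_add[OF g, of i j] by simp_all
  have cl: "f i \<in> carrier A" "g i \<in> carrier A" for i
    using ring_hom_closed[OF f, of i] ring_hom_closed[OF g, of i] by simp_all
  show ?thesis
  proof (induction n rule: int_induct[where k = 1])
    case base
    show ?case by (simp add: one)
  next
    case (step1 i)
    then show ?case by (simp add: add one)
  next
    case (step2 i)
    have "f (i - 1) \<oplus>\<^bsub>A\<^esub> \<one>\<^bsub>A\<^esub> = g (i - 1) \<oplus>\<^bsub>A\<^esub> \<one>\<^bsub>A\<^esub>"
      using step2 add[of "i - 1" 1] one by simp
    then show ?case using cl by simp
  qed
qed

lemma const_hom: "(\<lambda>a. monom ZX a 0) \<in> ring_hom INTEG ZX"
  by (rule INTEG.const_ring_hom)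

text \<open>By initiality of the integers the two maps agree on constants, so the universal property of the
polynomial ring applies.\<close>

lemma ZX_hom_unique:
  fixes A (structure)
  assumes R: "cring A" and f: "f \<in> ring_hom ZX A" and g: "g \<in> ring_hom ZX A"
    and X: "f X_ZX = g X_ZX" and p: "p \<in> carrier ZX"
  shows "f p = g p"
proof -
  let ?h = "f \<circ> (\<lambda>n. monom ZX n 0)"
  have h: "?h \<in> ring_hom INTEG A" "g \<circ> (\<lambda>n. monom ZX n 0) \<in> ring_hom INTEG A"
    using const_hom f g by (auto intro: ring_hom_trans)
  interpret U: UP_pre_univ_prop INTEG A ?h ZX
    by (rule UP_pre_univ_propI[OF INTEG_cring R h(1)])
  show ?thesis
  proof (rule U.UP_hom_unique[of f "f X_ZX" g p])
    show "ring_hom_cring ZX A f" "ring_hom_cring ZX A g"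
      using R f g by (auto intro: ring_hom_cringI INTEG.UP_cring)
    show "f (monom ZX \<one>\<^bsub>INTEG\<^esub> (Suc 0)) = f X_ZX" "g (monom ZX \<one>\<^bsub>INTEG\<^esub> (Suc 0)) = f X_ZX"
      using X by simp_all
    show "f X_ZX \<in> carrier A" using ring_hom_closed[OF f X_closed] .
    show "g (monom ZX n 0) = ?h n" for n
      using int_hom_unique[OF cring.axioms(1)[OF R] h, of n] by simp
  qed (use p in simp_all)
qed

text \<open>The remainder of a polynomial on division by \<open>X - a\<close> is its value at \<open>a\<close>. If the values at \<open>0\<close>
and \<open>1\<close> vanish, division by \<open>X\<close> and then by \<open>X - 1\<close> leaves the factor \<open>X * (X - 1)\<close>.\<close>

lemma kernel_eval01: "a_kernel ZX Z2 eval01 = ideal_ZX"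
proof -
  have X2: "X_ZX [^]\<^bsub>ZX\<^esub> (2::nat) = X_ZX \<otimes>\<^bsub>ZX\<^esub> X_ZX"
    using X_closed by (simp add: numeral_2_eq_2)
  let ?f = "X_ZX \<ominus>\<^bsub>ZX\<^esub> X_ZX [^]\<^bsub>ZX\<^esub> (2::nat)"
  interpret e: ring_hom_cring ZX Z2 eval01
    by (rule ring_hom_cringI[OF INTEG.UP_cring cring_Z2 eval01_hom])
  have f: "?f \<in> carrier ZX" using X_closed by simp
  have "?f \<oplus>\<^bsub>ZX\<^esub> X_ZX \<otimes>\<^bsub>ZX\<^esub> X_ZX = X_ZX"
    using X_closed unfolding X2 by (simp add: INTEG.P.minus_eq INTEG.P.a_assoc INTEG.P.l_neg)
  then have "eval01 ?f \<oplus>\<^bsub>Z2\<^esub> eval01 X_ZX \<otimes>\<^bsub>Z2\<^esub> eval01 X_ZX = eval01 X_ZX"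
    using X_closed f by (metis INTEG.P.m_closed e.hom_add e.hom_mult)
  then have ev_f: "eval01 ?f = (0, 0)"
    unfolding eval01_X by (simp add: prod_eq_iff)
  have "p \<in> ideal_ZX" if p: "p \<in> carrier ZX" "eval01 p = (0, 0)" for p
  proof -
    have nontrivial: "carrier INTEG \<noteq> {\<zero>\<^bsub>INTEG\<^esub>}"
      by (simp add: set_eq_iff) (rule exI[of _ 1], simp)
    have e0: "eval INTEG INTEG id 0 p = 0" and e1: "eval INTEG INTEG id 1 p = 0"
      using p(2) by (simp_all add: eval01_def)
    have monom0: "monom ZX 0 0 = \<zero>\<^bsub>ZX\<^esub>"
      using INTEG.monom_zero[of 0] by simp
    have monom1: "monom ZX 1 0 = \<one>\<^bsub>ZX\<^esub>"
      using INTEG.monom_one by simp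
    obtain q where q: "q \<in> carrier ZX" "p = X_ZX \<otimes>\<^bsub>ZX\<^esub> q"
      using INTEG.remainder_theorem[OF p(1) INTEG_closed[of 0] nontrivial] X_closed
      by (auto simp: e0 monom0 INTEG.P.minus_eq)
    have "eval INTEG INTEG id 1 q = 0"
      using e1 ring_hom_mult[OF eval_hom X_closed q(1), of 1] unfolding q(2) eval_X by simp
    then obtain s where s: "s \<in> carrier ZX" "q = (X_ZX \<ominus>\<^bsub>ZX\<^esub> \<one>\<^bsub>ZX\<^esub>) \<otimes>\<^bsub>ZX\<^esub> s"
      using INTEG.remainder_theorem[OF q(1) INTEG_closed[of 1] nontrivial] X_closed
      by (auto simp: monom0 monom1)
    have "p = (\<ominus>\<^bsub>ZX\<^esub> s) \<otimes>\<^bsub>ZX\<^esub> ?f"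
      unfolding q(2) s(2) X2 using s(1) X_closed
      by (simp add: INTEG.P.minus_eq INTEG.P.l_distr INTEG.P.r_distr INTEG.P.m_ac INTEG.P.l_minus
          INTEG.P.r_minus INTEG.P.a_ac INTEG.P.minus_add)
    then show ?thesis using s(1) unfolding cgenideal_def by blast
  qed
  moreover have "p \<in> carrier ZX \<and> eval01 p = (0, 0)" if p: "p \<in> ideal_ZX" for p
  proof -
    obtain s where s: "p = s \<otimes>\<^bsub>ZX\<^esub> ?f" "s \<in> carrier ZX"
      using p unfolding cgenideal_def by (elim CollectE exE conjE)
    have "eval01 p = eval01 s \<otimes>\<^bsub>Z2\<^esub> (0, 0)"
      unfolding s(1) ev_f[symmetric] by (rule e.hom_mult[OF s(2) f])
    moreover have "p \<in> carrier ZX"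
      unfolding s(1) by (rule INTEG.P.m_closed[OF s(2) f])
    ultimately show ?thesis by simp
  qed
  ultimately have "{p \<in> carrier ZX. eval01 p = \<zero>\<^bsub>Z2\<^esub>} = ideal_ZX"
    by (intro equalityI subsetI) simp_all
  then show ?thesis by (simp only: a_kernel_def')
qed

lemma surj_eval01: "eval01 ` carrier ZX = UNIV"
proof -
  have "(a, b) \<in> eval01 ` carrier ZX" for a b
  proof -
    let ?p = "monom ZX a 0 \<oplus>\<^bsub>ZX\<^esub> monom ZX (b - a) 0 \<otimes>\<^bsub>ZX\<^esub> X_ZX"
    have c: "monom ZX n 0 \<in> carrier ZX" for n by (rule INTEG.monom_closed) simp
    have ec: "eval INTEG INTEG id x (monom ZX n 0) = n" for x n
      using INTEG.eval_const[of x n] by simp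
    have "eval INTEG INTEG id x ?p = a + (b - a) * x" for x
      using c X_closed by (simp add: ring_hom_add[OF eval_hom] ring_hom_mult[OF eval_hom] ec eval_X[simplified])
    then have "eval01 ?p = (a, b)" by (simp add: eval01_def)
    moreover have "?p \<in> carrier ZX" using c X_closed by simp
    ultimately show ?thesis by (intro image_eqI[of _ _ ?p]) simp_all
  qed
  then show ?thesis by auto
qed

section \<open>Terms over a pairing function without cycles\<close>

lemma sum_list_filter_split:
  "(\<Sum>x\<leftarrow>xs. f x) = (\<Sum>x\<leftarrow>filter Q xs. f x) + (\<Sum>x\<leftarrow>filter (\<lambda>x. \<not> Q x) xs. f x :: int)"
  by (induction xs) auto

text \<open>The distributive expansion of a product of two formal linear combinations; \<open>f\<close> is the product that
is meant, the intersection or the product along \<open>pr\<close>.\<close>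

definition products ::
  "('a set \<Rightarrow> 'a set \<Rightarrow> 'a set) \<Rightarrow> (int \<times> 'a set) list \<Rightarrow> (int \<times> 'a set) list \<Rightarrow>
    (int \<times> 'a set) list" where
  "products f ps qs = [(fst x * fst y, f (snd x) (snd y)). x \<leftarrow> ps, y \<leftarrow> qs]"

lemma set_products:
  "set (products f ps qs) = (\<lambda>(x, y). (fst x * fst y, f (snd x) (snd y))) ` (set ps \<times> set qs)"
  by (auto simp: products_def)

lemma sum_list_products:
  fixes F G H :: "int \<times> 'a set \<Rightarrow> int"
  assumes "\<And>x y. x \<in> set ps \<Longrightarrow> y \<in> set qs \<Longrightarrow> F (fst x * fst y, f (snd x) (snd y)) = G x * H y"
  shows "(\<Sum>z\<leftarrow>products f ps qs. F z) = (\<Sum>x\<leftarrow>ps. G x) * (\<Sum>y\<leftarrow>qs. H y)"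
  using assms
proof (induction ps)
  case Nil
  then show ?case by (simp add: products_def)
next
  case (Cons x ps)
  have "(\<Sum>y\<leftarrow>qs. F (fst x * fst y, f (snd x) (snd y))) = (\<Sum>y\<leftarrow>qs. G x * H y)"
    using Cons.prems by (intro arg_cong[of _ _ sum_list] map_cong) auto
  moreover have "products f (x # ps) qs =
      map (\<lambda>y. (fst x * fst y, f (snd x) (snd y))) qs @ products f ps qs"
    by (simp add: products_def)
  ultimately show ?case
    using Cons by (simp add: comp_def sum_list_const_mult distrib_right)
qed

text \<open>Trees with variables and parameters at the leaves. The projections \<open>l\<close> and \<open>r\<close> are deliberately
absent: applied to an inner node or to a parameter they can be computed, and applied to a variable
they are removed by splitting the variable into a pair.\<close>

datatype 'a tm = V nat | K 'a | P "'a tm" "'a tm"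

primrec vars :: "'a tm \<Rightarrow> nat set" where
  "vars (V i) = {i}"
| "vars (K a) = {}"
| "vars (P s t) = vars s \<union> vars t"

primrec subst :: "(nat \<Rightarrow> 'a tm) \<Rightarrow> 'a tm \<Rightarrow> 'a tm" where
  "subst \<sigma> (V i) = \<sigma> i"
| "subst \<sigma> (K a) = K a"
| "subst \<sigma> (P s t) = P (subst \<sigma> s) (subst \<sigma> t)"

lemma finite_vars [simp]: "finite (vars t)"
  by (induction t) auto

lemma vars_subst: "vars (subst \<sigma> t) = (\<Union>i\<in>vars t. vars (\<sigma> i))"
  by (induction t) auto

locale acyclic_pairing =
  fixes l r :: "'a \<Rightarrow> 'a"
  assumes pairing: "pairing_without_cycles l r"
begin

definition pr :: "'a \<Rightarrow> 'a \<Rightarrow> 'a" where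
  "pr x y = (THE z. l z = x \<and> r z = y)"

lemma ex1_pair: "\<exists>!z. l z = x \<and> r z = y"
proof -
  have "bij (\<lambda>x. (l x, r x))"
    using pairing by (simp add: pairing_without_cycles_def)
  then have "\<exists>!z. (l z, r z) = (x, y)"
    unfolding bij_iff by (rule spec)
  then show ?thesis by simp
qed

lemma l_pr [simp]: "l (pr x y) = x" and r_pr [simp]: "r (pr x y) = y"
  using theI'[OF ex1_pair[of x y]] by (auto simp: pr_def)

lemma pr_l_r [simp]: "pr (l z) (r z) = z"
  using ex1_pair[of "l z" "r z"] by (metis l_pr r_pr)

lemma pair_eqI: "l x = l y \<Longrightarrow> r x = r y \<Longrightarrow> x = y"
  by (metis pr_l_r)

lemma pair_eq_iff: "x = y \<longleftrightarrow> l x = l y \<and> r x = r y"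
  by (metis pr_l_r)

lemma pr_inject [simp]: "pr x y = pr x' y' \<longleftrightarrow> x = x' \<and> y = y'"
  by (metis l_pr r_pr)

lemma no_cycle: "fs \<noteq> [] \<Longrightarrow> set fs \<subseteq> {l, r} \<Longrightarrow> foldr (\<circ>) fs id x \<noteq> x"
  using pairing by (simp add: pairing_without_cycles_def)

lemma l_neq [simp]: "l x \<noteq> x"
  using no_cycle[of "[l]" x] by simp

lemma l_funpow_neq: "n > 0 \<Longrightarrow> (l ^^ n) x \<noteq> x"
proof -
  assume "n > 0"
  have "foldr (\<circ>) (replicate n l) id = l ^^ n"
    by (induction n) auto
  with no_cycle[of "replicate n l" x] \<open>n > 0\<close> show ?thesis
    by auto
qed

lemma inj_l_funpow: "inj (\<lambda>n. (l ^^ n) x)"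
proof -
  have "(l ^^ m) x \<noteq> (l ^^ n) x" if "m < n" for m n
  proof -
    have "(l ^^ n) x = (l ^^ (n - m)) ((l ^^ m) x)"
      using that by (simp flip: comp_apply[of "l ^^ (n - m)"] funpow_add)
    with l_funpow_neq[of "n - m" "(l ^^ m) x"] that show ?thesis by auto
  qed
  note less_neq = this
  show ?thesis
  proof (rule injI)
    fix m n assume "(l ^^ m) x = (l ^^ n) x"
    then show "m = n"
      using less_neq[of m n] less_neq[of n m] by (cases m n rule: linorder_cases) simp_all
  qed
qed

text \<open>The iterated left projections of an element are pairwise distinct.\<close>

lemma infinite_universe: "infinite (UNIV :: 'a set)"
proof
  assume "finite (UNIV :: 'a set)"
  then have "finite (range (\<lambda>n. (l ^^ n) undefined))"
    by (rule finite_subset[OF subset_UNIV])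
  then show False
    using finite_imageD[OF _ inj_l_funpow] by simp
qed

inductive_set term_fun :: "('a \<Rightarrow> 'a) set" where
  tf_id [intro!, simp]: "(\<lambda>x. x) \<in> term_fun"
| tf_const [intro!, simp]: "(\<lambda>x. c) \<in> term_fun"
| tf_l [intro]: "f \<in> term_fun \<Longrightarrow> (\<lambda>x. l (f x)) \<in> term_fun"
| tf_r [intro]: "f \<in> term_fun \<Longrightarrow> (\<lambda>x. r (f x)) \<in> term_fun"
| tf_pr [intro]: "f \<in> term_fun \<Longrightarrow> g \<in> term_fun \<Longrightarrow> (\<lambda>x. pr (f x) (g x)) \<in> term_fun"

lemma tf_comp: "f \<in> term_fun \<Longrightarrow> g \<in> term_fun \<Longrightarrow> (\<lambda>x. f (g x)) \<in> term_fun"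
  by (induction rule: term_fun.induct) auto

lemma tf_l' [intro!, simp]: "l \<in> term_fun" and tf_r' [intro!, simp]: "r \<in> term_fun"
  using tf_l[OF tf_id] tf_r[OF tf_id] by simp_all

lemma tf_word: "set fs \<subseteq> {l, r} \<Longrightarrow> foldr (\<circ>) fs id \<in> term_fun"
proof (induction fs)
  case Nil
  then show ?case using tf_id by (simp add: id_def)
next
  case (Cons f fs)
  have "f \<in> term_fun" using Cons.prems by auto
  moreover have "foldr (\<circ>) fs id \<in> term_fun"
    by (rule Cons.IH) (use Cons.prems in auto)
  ultimately have "(\<lambda>x. f (foldr (\<circ>) fs id x)) \<in> term_fun" by (rule tf_comp)
  moreover have "foldr (\<circ>) (f # fs) id = (\<lambda>x. f (foldr (\<circ>) fs id x))"
    by (simp add: fun_eq_iff)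
  ultimately show ?case by (simp only:)
qed

primrec ev :: "(nat \<Rightarrow> 'a) \<Rightarrow> 'a tm \<Rightarrow> 'a" where
  "ev e (V i) = e i"
| "ev e (K a) = a"
| "ev e (P s t) = pr (ev e s) (ev e t)"

lemma ev_cong: "(\<And>i. i \<in> vars t \<Longrightarrow> e i = e' i) \<Longrightarrow> ev e t = ev e' t"
  by (induction t) auto

lemma ev_upd [simp]: "i \<notin> vars t \<Longrightarrow> ev (e(i := c)) t = ev e t"
  by (rule ev_cong) auto

lemma ev_subst: "ev e (subst \<sigma> t) = ev (\<lambda>i. ev e (\<sigma> i)) t"
  by (induction t) auto

lemma tf_ev: "(\<And>i. i \<in> vars t \<Longrightarrow> q i \<in> term_fun) \<Longrightarrow> (\<lambda>x. ev (\<lambda>i. q i x) t) \<in> term_fun"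
  by (induction t) auto

lemma foldr_comp_append: "foldr (\<circ>) (fs @ [g]) id x = foldr (\<circ>) fs id (g x)"
  by (induction fs) auto

text \<open>The path from the root to an occurrence of a variable is a composition of projections that reads
off its value. It is empty only when the tree is the variable itself.\<close>

lemma var_position:
  "i \<in> vars t \<Longrightarrow>
    \<exists>fs. set fs \<subseteq> {l, r} \<and> (t \<noteq> V i \<longrightarrow> fs \<noteq> []) \<and> (\<forall>e. foldr (\<circ>) fs id (ev e t) = e i)"
proof (induction t)
  case (V j)
  then show ?case by (auto intro: exI[of _ "[]"])
next
  case (P t1 t2)
  obtain fs g where *: "set fs \<subseteq> {l, r}" "g \<in> {l, r}"
    "\<And>e. foldr (\<circ>) fs id (g (ev e (P t1 t2))) = e i"
  proof (cases "i \<in> vars t1")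
    case True
    with P.IH(1) obtain fs where "set fs \<subseteq> {l, r}" "\<forall>e. foldr (\<circ>) fs id (ev e t1) = e i" by blast
    then show ?thesis by (intro that[of fs l]) simp_all
  next
    case False
    with P.prems have "i \<in> vars t2" by simp
    with P.IH(2) obtain fs where "set fs \<subseteq> {l, r}" "\<forall>e. foldr (\<circ>) fs id (ev e t2) = e i" by blast
    then show ?thesis by (intro that[of fs r]) simp_all
  qed
  have "\<forall>e. foldr (\<circ>) (fs @ [g]) id (ev e (P t1 t2)) = e i"
    using *(3) by (simp only: foldr_comp_append) simp
  moreover have "set (fs @ [g]) \<subseteq> {l, r}" "fs @ [g] \<noteq> []"
    using *(1,2) by auto
  ultimately show ?case by blast
qed simp

lemma var_term_fun: "i \<in> vars t \<Longrightarrow> \<exists>p\<in>term_fun. \<forall>e. p (ev e t) = e i"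
  using var_position tf_word by metis

text \<open>Otherwise the path to the variable would be a nonempty composition of projections with a fixed
point.\<close>

lemma occurs_check: "i \<in> vars t \<Longrightarrow> t \<noteq> V i \<Longrightarrow> ev e t \<noteq> e i"
  by (metis var_position no_cycle)

text \<open>An equation between trees with a single unknown has at most one solution unless it is an identity.
Comparing both trees from the root, the only critical case is the unknown against a tree: if the
unknown occurs in this tree properly, the occurs check excludes any solution, and if it does not
occur, the equation fixes its value.\<close>

lemma two_point:
  assumes "a \<noteq> b" "ev (e(i := a)) s = ev (e(i := a)) t" "ev (e(i := b)) s = ev (e(i := b)) t"
  shows "ev (e(i := c)) s = ev (e(i := c)) t"
proof -
  note fun_upd_apply [simp del] fun_upd_same [simp] fun_upd_other [simp]
  have var: "ev (e(i := c)) t = c" if "ev (e(i := a)) t = a" "ev (e(i := b)) t = b" for t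
  proof (cases "i \<in> vars t")
    case True
    with occurs_check[of i t "e(i := a)"] that have "t = V i" by fastforce
    then show ?thesis by simp
  next
    case False
    with that \<open>a \<noteq> b\<close> show ?thesis by simp
  qed
  have const: "ev (e(i := c)) t = d" if "ev (e(i := a)) t = d" "ev (e(i := b)) t = d" for t d
    using that
  proof (induction t arbitrary: d)
    case (V j)
    then show ?case using \<open>a \<noteq> b\<close> by (cases "j = i") auto
  next
    case (P t1 t2)
    have "ev (e(i := a)) t1 = l d" "ev (e(i := a)) t2 = r d"
      "ev (e(i := b)) t1 = l d" "ev (e(i := b)) t2 = r d"
      using arg_cong[OF P.prems(1), of l] arg_cong[OF P.prems(1), of r]
        arg_cong[OF P.prems(2), of l] arg_cong[OF P.prems(2), of r] by simp_all
    with P.IH show ?case by simp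
  qed simp
  show ?thesis
    using assms(2,3)
  proof (induction s arbitrary: t)
    case (V j)
    then show ?case
    proof (cases "j = i")
      case True
      with V[symmetric] var[of t] show ?thesis by simp
    next
      case False
      with V[symmetric] const[of t "e j"] show ?thesis by simp
    qed
  next
    case (K d)
    from K[symmetric] show ?case using const[of t d] by simp
  next
    case (P s1 s2)
    note IH = P.IH and prems = P.prems
    show ?case
    proof (cases t)
      case (V j)
      then show ?thesis
      proof (cases "j = i")
        case True
        with V prems var[of "P s1 s2"] show ?thesis by simp
      next
        case False
        with V prems const[of "P s1 s2" "e j"] show ?thesis by simp
      qed
    next
      case (K d)
      then show ?thesis using prems const[of "P s1 s2" d] by simp
    next
      case (P t1 t2)
      then show ?thesis using IH prems by simp
    qed
  qed
qed

text \<open>One step of unification. Descending through both trees, with a parameter \<open>a\<close> read as the pair of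
\<open>l a\<close> and \<open>r a\<close>, either all the equations met on the way are trivial, or one is contradictory, or
one of them expresses a variable by the others.\<close>

lemma solve_for_variable:
  shows "(\<forall>e. ev e s \<noteq> ev e t) \<or> (\<forall>e. ev e s = ev e t) \<or>
    (\<exists>i\<in>vars s \<union> vars t. \<exists>u. vars u \<subseteq> vars s \<union> vars t - {i} \<and>
      (\<forall>e. ev e s = ev e t \<longrightarrow> e i = ev e u))" (is "?G s t")
proof -
  have var: "?G (V i) t" for i t
  proof (cases "i \<in> vars t")
    case True
    show ?thesis
    proof (cases "t = V i")
      case False
      have "\<forall>e. ev e (V i) \<noteq> ev e t"
        using occurs_check[OF True False] by (simp add: eq_commute)
      then show ?thesis by (rule disjI1)
    qed simp
  next
    case False
    then have "vars t \<subseteq> vars (V i) \<union> vars t - {i}" by auto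
    moreover have "\<forall>e. ev e (V i) = ev e t \<longrightarrow> e i = ev e t" by simp
    ultimately show ?thesis by (intro disjI2 bexI[of _ i] exI[of _ t] conjI) simp_all
  qed
  have sym: "?G t s" if "?G s t" for s t
    using that by (simp add: Un_commute eq_commute)
  have pair: "?G s t" if "?G s1 t1" "?G s2 t2"
    "\<And>e. ev e s = ev e t \<longleftrightarrow> ev e s1 = ev e t1 \<and> ev e s2 = ev e t2"
    "vars s1 \<union> vars t1 \<subseteq> vars s \<union> vars t" "vars s2 \<union> vars t2 \<subseteq> vars s \<union> vars t" for s t s1 t1 s2 t2
    using that(1)
  proof (elim disjE)
    assume "\<forall>e. ev e s1 \<noteq> ev e t1"
    with that(3) have "\<forall>e. ev e s \<noteq> ev e t" by simp
    then show ?thesis by (rule disjI1)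
  next
    assume *: "\<forall>e. ev e s1 = ev e t1"
    from that(2) show ?thesis
    proof (elim disjE)
      assume "\<forall>e. ev e s2 \<noteq> ev e t2"
      with that(3) have "\<forall>e. ev e s \<noteq> ev e t" by simp
    then show ?thesis by (rule disjI1)
    next
      assume "\<forall>e. ev e s2 = ev e t2"
      with * that(3) have "\<forall>e. ev e s = ev e t" by simp
      then show ?thesis by blast
    next
      assume "\<exists>i\<in>vars s2 \<union> vars t2. \<exists>u. vars u \<subseteq> vars s2 \<union> vars t2 - {i} \<and>
        (\<forall>e. ev e s2 = ev e t2 \<longrightarrow> e i = ev e u)"
      then obtain i u where iu: "i\<in>vars s2 \<union> vars t2" "vars u \<subseteq> vars s2 \<union> vars t2 - {i}"
        "\<forall>e. ev e s2 = ev e t2 \<longrightarrow> e i = ev e u" by blast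
      have "i \<in> vars s \<union> vars t" "vars u \<subseteq> vars s \<union> vars t - {i}"
        using iu(1,2) that(4,5) by blast+
      moreover have "\<forall>e. ev e s = ev e t \<longrightarrow> e i = ev e u"
        using iu(3) that(3) by simp
      ultimately show ?thesis by (intro disjI2 bexI[of _ i] exI[of _ u] conjI)
    qed
  next
    assume "\<exists>i\<in>vars s1 \<union> vars t1. \<exists>u. vars u \<subseteq> vars s1 \<union> vars t1 - {i} \<and>
        (\<forall>e. ev e s1 = ev e t1 \<longrightarrow> e i = ev e u)"
    then obtain i u where iu: "i\<in>vars s1 \<union> vars t1" "vars u \<subseteq> vars s1 \<union> vars t1 - {i}"
      "\<forall>e. ev e s1 = ev e t1 \<longrightarrow> e i = ev e u" by blast
    have "i \<in> vars s \<union> vars t" "vars u \<subseteq> vars s \<union> vars t - {i}"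
      using iu(1,2) that(4,5) by blast+
    moreover have "\<forall>e. ev e s = ev e t \<longrightarrow> e i = ev e u"
      using iu(3) that(3) by simp
    ultimately show ?thesis by (intro disjI2 bexI[of _ i] exI[of _ u] conjI)
  qed
  have const: "?G (K a) t" for a t
  proof (induction t arbitrary: a)
    case (V i)
    show ?case by (rule sym[OF var])
  next
    case (P t1 t2)
    show ?case
      by (rule pair[OF P.IH(1)[of "l a"] P.IH(2)[of "r a"]]) (auto simp: pair_eq_iff[of a])
  qed simp
  show "?G s t"
  proof (induction s arbitrary: t)
    case (V i)
    show ?case by (rule var)
  next
    case (K a)
    show ?case by (rule const)
  next
    case (P s1 s2)
    note IH = this
    show ?case
    proof (cases t)
      case (V i)
      then show ?thesis using sym[OF var] by blast
    next
      case (K a)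
      then show ?thesis using sym[OF const] by blast
    next
      case (P t1 t2)
      show ?thesis unfolding P
        by (rule pair[OF IH(1)[of t1] IH(2)[of t2]]) auto
    qed
  qed
qed

text \<open>Every solved variable is substituted away, so the induction is on the number of variables.\<close>

lemma unification:
  "(\<forall>e. ev e s \<noteq> ev e t) \<or> (\<exists>\<sigma>. {e. ev e s = ev e t} = range (\<lambda>e i. ev e (\<sigma> i)))"
proof (induction "card (vars s \<union> vars t)" arbitrary: s t rule: less_induct)
  case less
  have "range (\<lambda>e i. ev e (V i)) = UNIV" by (auto simp: image_def)
  then consider "\<forall>e. ev e s \<noteq> ev e t" | "\<forall>e. ev e s = ev e t"
    | i u where "i\<in>vars s \<union> vars t" "vars u \<subseteq> vars s \<union> vars t - {i}"
        "\<And>e. ev e s = ev e t \<Longrightarrow> e i = ev e u"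
    using solve_for_variable[of s t] by blast
  then show ?case
  proof cases
    case 2
    then have "{e. ev e s = ev e t} = range (\<lambda>e i. ev e (V i))" by (auto simp: image_def)
    then show ?thesis by blast
  next
    case 3
    define \<rho> where "\<rho> = V(i := u)"
    have upd: "(\<lambda>j. ev e (\<rho> j)) = e(i := ev e u)" for e
      by (auto simp: \<rho>_def)
    have ev_\<rho>: "ev e (subst \<rho> t) = ev (e(i := ev e u)) t" for e t
      by (simp add: ev_subst upd)
    have v: "vars (subst \<rho> s) \<union> vars (subst \<rho> t) \<subseteq> vars s \<union> vars t - {i}"
      using 3(2) by (auto simp: vars_subst \<rho>_def split: if_splits)
    then have "vars (subst \<rho> s) \<union> vars (subst \<rho> t) \<subset> vars s \<union> vars t"
      using 3(1) by blast
    then have "card (vars (subst \<rho> s) \<union> vars (subst \<rho> t)) < card (vars s \<union> vars t)"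
      by (intro psubset_card_mono) auto
    from less[OF this] show ?thesis
    proof
      assume *: "\<forall>e. ev e (subst \<rho> s) \<noteq> ev e (subst \<rho> t)"
      have "ev e s \<noteq> ev e t" for e
        using * 3(3)[of e] ev_\<rho>[of e s] ev_\<rho>[of e t] by (metis fun_upd_triv)
      then show ?thesis by blast
    next
      assume "\<exists>\<sigma>. {e. ev e (subst \<rho> s) = ev e (subst \<rho> t)} = range (\<lambda>e i. ev e (\<sigma> i))"
      then obtain \<sigma> where \<sigma>: "{e. ev e (subst \<rho> s) = ev e (subst \<rho> t)} = range (\<lambda>e i. ev e (\<sigma> i))"
        by blast
      define \<sigma>' where "\<sigma>' = (\<lambda>j. subst \<sigma> (\<rho> j))"
      have \<sigma>': "(\<lambda>j. ev e (\<sigma>' j)) = (\<lambda>j. ev e (\<sigma> j))(i := ev (\<lambda>j. ev e (\<sigma> j)) u)" for e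
        by (simp add: \<sigma>'_def ev_subst upd)
      have "{e. ev e s = ev e t} = range (\<lambda>e i. ev e (\<sigma>' i))"
      proof (intro equalityI subsetI)
        fix e assume "e \<in> {e. ev e s = ev e t}"
        then have e: "ev e s = ev e t" by simp
        with 3(3) have ei: "e(i := ev e u) = e" by (metis fun_upd_triv)
        with e have "e \<in> {e. ev e (subst \<rho> s) = ev e (subst \<rho> t)}"
          by (simp add: ev_\<rho>)
        then obtain e' where "e = (\<lambda>i. ev e' (\<sigma> i))" unfolding \<sigma> by blast
        with ei \<sigma>'[of e'] show "e \<in> range (\<lambda>e i. ev e (\<sigma>' i))"
          by (intro range_eqI[of _ _ e']) simp
      next
        fix e assume "e \<in> range (\<lambda>e i. ev e (\<sigma>' i))"
        then obtain e' where e': "e = (\<lambda>j. ev e' (\<sigma>' j))" by blast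
        define d where "d = (\<lambda>j. ev e' (\<sigma> j))"
        have "d \<in> {e. ev e (subst \<rho> s) = ev e (subst \<rho> t)}"
          unfolding \<sigma> d_def by blast
        then show "e \<in> {e. ev e s = ev e t}"
          by (simp add: e' \<sigma>' ev_\<rho> d_def)
      qed
      then show ?thesis by blast
    qed
  qed blast
qed

section \<open>Term functions in coordinates\<close>

text \<open>Splitting every variable into two fresh ones: variable \<open>i\<close> becomes the pair of the variables
\<open>2 * i\<close> and \<open>2 * i + 1\<close>. As all variables are treated alike, the step can be iterated.\<close>

definition split_env :: "(nat \<Rightarrow> 'a) \<Rightarrow> nat \<Rightarrow> 'a" where
  "split_env e = (\<lambda>i. pr (e (2 * i)) (e (Suc (2 * i))))"

lemma surj_split_env: "surj split_env"
proof (rule surjI)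
  fix e
  show "split_env (\<lambda>i. if even i then l (e (i div 2)) else r (e (i div 2))) = e"
    by (simp add: split_env_def)
qed

text \<open>After \<open>k\<close> rounds of splitting, \<open>g\<close> is given by a tree, with no projections left.\<close>

definition tree_after :: "nat \<Rightarrow> ((nat \<Rightarrow> 'a) \<Rightarrow> 'a) \<Rightarrow> bool" where
  "tree_after k g \<longleftrightarrow> (\<exists>t. \<forall>e. g ((split_env ^^ k) e) = ev e t)"

lemma ev_split_env:
  "ev (split_env e) t = ev e (subst (\<lambda>i. P (V (2 * i)) (V (Suc (2 * i)))) t)"
  by (simp add: ev_subst split_env_def)

lemma tree_after_Suc: "tree_after k g \<Longrightarrow> tree_after (Suc k) g"
  unfolding tree_after_def funpow_Suc_right comp_apply by (metis ev_split_env)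

lemma tree_after_const: "tree_after k (\<lambda>e. c)"
  unfolding tree_after_def by (rule exI[of _ "K c"]) simp

lemma tree_after_var: "tree_after k (\<lambda>e. e i)"
proof (induction k)
  case 0
  show ?case unfolding tree_after_def by (rule exI[of _ "V i"]) simp
qed (rule tree_after_Suc)

lemma tree_after_pr: "tree_after k g \<Longrightarrow> tree_after k g' \<Longrightarrow> tree_after k (\<lambda>e. pr (g e) (g' e))"
  unfolding tree_after_def by (metis ev.simps(3))

lemma tree_after_proj:
  assumes "tree_after k g"
  shows "tree_after (Suc k) (\<lambda>e. l (g e))" "tree_after (Suc k) (\<lambda>e. r (g e))"
proof -
  obtain t where t: "\<And>e. g ((split_env ^^ k) e) = ev e t"
    using assms unfolding tree_after_def by blast
  have g: "g ((split_env ^^ Suc k) e) = ev (split_env e) t" for e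
    by (simp only: funpow_Suc_right comp_apply t)
  have "\<exists>t1 t2. \<forall>e. ev (split_env e) t = pr (ev e t1) (ev e t2)"
  proof (cases t)
    case (V i)
    show ?thesis
      by (rule exI[of _ "V (2 * i)"], rule exI[of _ "V (Suc (2 * i))"]) (simp add: V split_env_def)
  next
    case (K a)
    show ?thesis by (rule exI[of _ "K (l a)"], rule exI[of _ "K (r a)"]) (simp add: K)
  next
    case (P t1 t2)
    show ?thesis unfolding P ev.simps ev_split_env by (intro exI allI) (rule refl)
  qed
  then obtain t1 t2 where "\<And>e. ev (split_env e) t = pr (ev e t1) (ev e t2)" by blast
  with g have "\<And>e. l (g ((split_env ^^ Suc k) e)) = ev e t1"
    "\<And>e. r (g ((split_env ^^ Suc k) e)) = ev e t2" by simp_all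
  then show "tree_after (Suc k) (\<lambda>e. l (g e))" "tree_after (Suc k) (\<lambda>e. r (g e))"
    unfolding tree_after_def by blast+
qed

text \<open>Each projection that meets a variable costs one more round of splitting. The number of rounds is
bounded independently of the parameter \<open>u\<close>, which quantifier elimination relies on.\<close>

lemma eventually_tree_fibre:
  "f \<in> term_fun \<Longrightarrow> eventually (\<lambda>k. \<forall>u. tree_after k (\<lambda>e. f (pr u (e 0)))) sequentially"
proof (induction rule: term_fun.induct)
  case tf_id
  show ?case by (intro always_eventually allI tree_after_pr tree_after_const tree_after_var)
next
  case (tf_const c)
  show ?case by (intro always_eventually allI tree_after_const)
next
  case (tf_l f)
  have "eventually (\<lambda>k. \<forall>u. tree_after (Suc k) (\<lambda>e. l (f (pr u (e 0))))) sequentially"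
    by (rule eventually_mono[OF tf_l.IH]) (simp add: tree_after_proj)
  then show ?case by (rule eventually_sequentially_Suc[THEN iffD1])
next
  case (tf_r f)
  have "eventually (\<lambda>k. \<forall>u. tree_after (Suc k) (\<lambda>e. r (f (pr u (e 0))))) sequentially"
    by (rule eventually_mono[OF tf_r.IH]) (simp add: tree_after_proj)
  then show ?case by (rule eventually_sequentially_Suc[THEN iffD1])
next
  case (tf_pr f g)
  show ?case
    by (rule eventually_mono[OF eventually_conj[OF tf_pr.IH]]) (simp add: tree_after_pr)
qed

lemma eventually_tree:
  assumes "f \<in> term_fun"
  shows "eventually (\<lambda>k. tree_after k (\<lambda>e. f (e 0))) sequentially"
  using eventually_tree_fibre[OF tf_comp[OF assms tf_r']] by simp

lemma split_env_coordinate: "\<exists>e. (split_env ^^ k) e 0 = y"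
proof -
  obtain e where "(\<lambda>i. y) = (split_env ^^ k) e"
    by (rule surjE[OF surj_fn[OF surj_split_env]])
  from fun_cong[OF this, of 0] show ?thesis by (intro exI[of _ e]) simp
qed

lemma tree_coordinates:
  obtains B where "\<And>e. (split_env ^^ k) e 0 = ev e B" "\<And>y. \<exists>e. ev e B = y"
proof -
  obtain B where B: "\<And>e. (split_env ^^ k) e 0 = ev e B"
    using tree_after_var[of k 0] unfolding tree_after_def by blast
  moreover have "\<exists>e. ev e B = y" for y
    using split_env_coordinate[of k y] B by simp
  ultimately show ?thesis by (rule that)
qed

text \<open>Finitely many elements can be packed into one: the \<open>q i\<close> are the coordinates of the packed element,
and \<open>k\<close> packs the given \<open>p i\<close>.\<close>

lemma coordinates:
  assumes "finite I" "I \<noteq> {}"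
  shows "\<exists>q. (\<forall>i\<in>I. q i \<in> term_fun) \<and>
    (\<forall>p. (\<forall>i\<in>I. p i \<in> term_fun) \<longrightarrow> (\<exists>k\<in>term_fun. \<forall>i\<in>I. \<forall>x. q i (k x) = p i x)) \<and>
    (\<forall>u u'. (\<forall>i\<in>I. q i u = q i u') \<longrightarrow> u = u')"
  using assms
proof (induction rule: finite_ne_induct)
  case (singleton i)
  show ?case by (rule exI[of _ "\<lambda>i x. x"]) auto
next
  case (insert j I)
  then obtain q where q: "\<forall>i\<in>I. q i \<in> term_fun"
    "\<And>p. \<forall>i\<in>I. p i \<in> term_fun \<Longrightarrow> \<exists>k\<in>term_fun. \<forall>i\<in>I. \<forall>x. q i (k x) = p i x"
    "\<And>u u'. \<forall>i\<in>I. q i u = q i u' \<Longrightarrow> u = u'" by blast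
  define q' where "q' i = (if i = j then l else (\<lambda>x. q i (r x)))" for i
  have "\<forall>i\<in>insert j I. q' i \<in> term_fun"
    using q(1) tf_comp[OF _ tf_r'] by (simp add: q'_def)
  moreover have "\<exists>k\<in>term_fun. \<forall>i\<in>insert j I. \<forall>x. q' i (k x) = p i x"
    if p: "\<forall>i\<in>insert j I. p i \<in> term_fun" for p
  proof -
    obtain k where k: "k \<in> term_fun" "\<forall>i\<in>I. \<forall>x. q i (k x) = p i x"
      using q(2)[of p] p by auto
    show ?thesis
      by (rule bexI[of _ "\<lambda>x. pr (p j x) (k x)"]) (use k p in \<open>auto simp: q'_def\<close>)
  qed
  moreover have "u = u'" if "\<forall>i\<in>insert j I. q' i u = q' i u'" for u u'
  proof (rule pair_eqI)
    show "l u = l u'" using that by (simp add: q'_def)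
    show "r u = r u'"
      by (rule q(3)) (use that insert.hyps in \<open>auto simp: q'_def split: if_splits\<close>)
  qed
  ultimately show ?case by blast
qed

text \<open>Only the finitely many variables in the tree matter, and these can be packed into one element.\<close>

lemma range_ev: "\<exists>h\<in>term_fun. range h = range (\<lambda>e. ev e t)"
proof -
  obtain q where q: "\<forall>i\<in>insert 0 (vars t). q i \<in> term_fun"
    "\<And>p. \<forall>i\<in>insert 0 (vars t). p i \<in> term_fun \<Longrightarrow>
      \<exists>k\<in>term_fun. \<forall>i\<in>insert 0 (vars t). \<forall>x. q i (k x) = p i x"
    using coordinates[of "insert 0 (vars t)"] by auto
  let ?h = "\<lambda>x. ev (\<lambda>i. q i x) t"
  have "?h \<in> term_fun" by (rule tf_ev) (use q(1) in auto)
  moreover have "range ?h = range (\<lambda>e. ev e t)"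
  proof (intro equalityI image_subsetI)
    fix x
    show "?h x \<in> range (\<lambda>e. ev e t)" by (rule rangeI)
  next
    fix e :: "nat \<Rightarrow> 'a"
    obtain k where k: "\<forall>i\<in>insert 0 (vars t). \<forall>x. q i (k x) = e i"
      using q(2)[of "\<lambda>i x. e i"] by auto
    have "ev e t = ?h (k undefined)" by (rule ev_cong) (use k in auto)
    then show "ev e t \<in> range ?h" by (rule range_eqI)
  qed
  ultimately show ?thesis by (intro bexI[of _ ?h])
qed

text \<open>In coordinates both sides are trees, and unification parametrises the solutions by trees.\<close>

lemma solutions_empty_or_range:
  assumes "f \<in> term_fun" "g \<in> term_fun"
  shows "{x. f x = g x} = {} \<or> (\<exists>h\<in>term_fun. {x. f x = g x} = range h)"
proof -
  obtain k where "tree_after k (\<lambda>e. f (e 0))" "tree_after k (\<lambda>e. g (e 0))"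
    using eventually_happens'[OF _ eventually_conj[OF assms[THEN eventually_tree]]] by auto
  then obtain s t where s: "\<And>e. f ((split_env ^^ k) e 0) = ev e s"
    and t: "\<And>e. g ((split_env ^^ k) e 0) = ev e t"
    unfolding tree_after_def by blast
  obtain B where B: "\<And>e. (split_env ^^ k) e 0 = ev e B" "\<And>y. \<exists>e. ev e B = y"
    using tree_coordinates[of k] by blast
  have eq: "{x. f x = g x} = (\<lambda>e. ev e B) ` {e. ev e s = ev e t}"
  proof (intro equalityI subsetI)
    fix x assume "x \<in> {x. f x = g x}"
    moreover obtain e where "ev e B = x" using B(2) by blast
    ultimately show "x \<in> (\<lambda>e. ev e B) ` {e. ev e s = ev e t}"
      using s[of e] t[of e] B(1)[of e] by (intro image_eqI[of _ _ e]) auto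
  next
    fix x assume "x \<in> (\<lambda>e. ev e B) ` {e. ev e s = ev e t}"
    then obtain e where "ev e s = ev e t" "x = ev e B" by blast
    then show "x \<in> {x. f x = g x}"
      using s[of e] t[of e] B(1)[of e] by simp
  qed
  from unification[of s t] show ?thesis
  proof
    assume "\<forall>e. ev e s \<noteq> ev e t"
    then have "{x. f x = g x} = {}" unfolding eq by simp
    then show ?thesis by (rule disjI1)
  next
    assume "\<exists>\<sigma>. {e. ev e s = ev e t} = range (\<lambda>e i. ev e (\<sigma> i))"
    then obtain \<sigma> where \<sigma>: "{e. ev e s = ev e t} = range (\<lambda>e i. ev e (\<sigma> i))" ..
    have "{x. f x = g x} = range (\<lambda>e. ev e (subst \<sigma> B))"
      unfolding eq \<sigma> image_image ev_subst ..
    with range_ev[of "subst \<sigma> B"] show ?thesis by metis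
  qed
qed

text \<open>In coordinates \<open>a\<close> is a tree \<open>t\<close>. The map \<open>\<theta>\<close> packs the variables that occur in \<open>t\<close> into the left
component of its argument and all the others into the right one. Then \<open>a\<close> depends only on the left
component, and recovers it, since each variable of \<open>t\<close> can be read off from the value of \<open>t\<close>.\<close>

lemma term_fun_normal_form:
  assumes "a \<in> term_fun"
  shows "(\<exists>c. \<forall>x. a x = c) \<or>
    (\<exists>\<theta>\<in>term_fun. \<exists>h\<in>term_fun. \<exists>k\<in>term_fun.
      surj \<theta> \<and> (\<forall>z. a (\<theta> z) = h (l z)) \<and> (\<forall>u. k (h u) = u))"
proof -
  obtain n where "tree_after n (\<lambda>e. a (e 0))"
    using eventually_happens'[OF _ eventually_tree[OF assms]] by auto
  then obtain t where t: "\<And>e. a ((split_env ^^ n) e 0) = ev e t"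
    unfolding tree_after_def by blast
  obtain B where B: "\<And>e. (split_env ^^ n) e 0 = ev e B" "\<And>y. \<exists>e. ev e B = y"
    using tree_coordinates[of n] by blast
  have a: "a (ev e B) = ev e t" for e using t B by simp
  show ?thesis
  proof (cases "vars t = {}")
    case True
    have "a x = ev undefined t" for x
    proof -
      obtain e where "ev e B = x" using B(2) by blast
      then show ?thesis using a[of e] ev_cong[of t e undefined] True by simp
    qed
    then show ?thesis by blast
  next
    case False
    then obtain q where q: "\<forall>i\<in>vars t. q i \<in> term_fun"
      "\<And>p. \<forall>i\<in>vars t. p i \<in> term_fun \<Longrightarrow> \<exists>k\<in>term_fun. \<forall>i\<in>vars t. \<forall>x. q i (k x) = p i x"
      "\<And>u u'. \<forall>i\<in>vars t. q i u = q i u' \<Longrightarrow> u = u'"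
      using coordinates[of "vars t"] by auto
    obtain q' where q': "\<forall>i\<in>insert 0 (vars B). q' i \<in> term_fun"
      "\<And>p. \<forall>i\<in>insert 0 (vars B). p i \<in> term_fun \<Longrightarrow>
        \<exists>k\<in>term_fun. \<forall>i\<in>insert 0 (vars B). \<forall>x. q' i (k x) = p i x"
      using coordinates[of "insert 0 (vars B)"] by auto
    define \<theta> where "\<theta> z = ev (\<lambda>i. (if i \<in> vars t then (\<lambda>z. q i (l z)) else (\<lambda>z. q' i (r z))) z) B" for z
    define h where "h u = ev (\<lambda>i. q i u) t" for u
    have "\<theta> \<in> term_fun" unfolding \<theta>_def[abs_def]
      by (rule tf_ev) (use q(1) q'(1) tf_comp[OF _ tf_l'] tf_comp[OF _ tf_r'] in auto)
    moreover have "h \<in> term_fun" unfolding h_def[abs_def]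
      by (rule tf_ev) (use q(1) in auto)
    moreover have "surj \<theta>"
    proof -
      have "\<exists>z. y = \<theta> z" for y
      proof -
        obtain e where e: "ev e B = y" using B(2) by blast
        obtain k where k: "\<forall>i\<in>vars t. \<forall>x. q i (k x) = e i"
          using q(2)[of "\<lambda>i x. e i"] by auto
        obtain k' where k': "\<forall>i\<in>insert 0 (vars B). \<forall>x. q' i (k' x) = e i"
          using q'(2)[of "\<lambda>i x. e i"] by auto
        have "\<theta> (pr (k undefined) (k' undefined)) = ev e B"
          unfolding \<theta>_def by (rule ev_cong) (use k k' in auto)
        with e have "y = \<theta> (pr (k undefined) (k' undefined))" by simp
        then show ?thesis by (rule exI)
      qed
      then show ?thesis unfolding surj_def by (rule allI)
    qed
    moreover have "a (\<theta> z) = h (l z)" for z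
      unfolding \<theta>_def a h_def by (rule ev_cong) simp
    moreover have "\<exists>k\<in>term_fun. \<forall>u. k (h u) = u"
    proof -
      have "\<forall>i\<in>vars t. \<exists>p\<in>term_fun. \<forall>e. p (ev e t) = e i"
        using var_term_fun by blast
      then obtain p where p: "\<forall>i\<in>vars t. p i \<in> term_fun \<and> (\<forall>e. p i (ev e t) = e i)"
        by metis
      then obtain k where k: "k \<in> term_fun" "\<forall>i\<in>vars t. \<forall>x. q i (k x) = p i x"
        using q(2)[of p] by auto
      have "k (h u) = u" for u
        by (rule q(3)) (use k(2) p in \<open>simp add: h_def\<close>)
      with k(1) show ?thesis by blast
    qed
    ultimately show ?thesis by blast
  qed
qed

text \<open>The variables are given values one after the other, keeping each equation refutable by a choice of
the remaining ones. By \<open>two_point\<close> every equation excludes at most one value for the next variable,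
and there are infinitely many values.\<close>

lemma generic_assignment:
  assumes "finite J" and differ: "\<And>j. j \<in> J \<Longrightarrow> \<exists>e. ev e (s j) \<noteq> ev e (t j)"
  shows "\<exists>e. \<forall>j\<in>J. ev e (s j) \<noteq> ev e (t j)"
proof -
  have partial: "\<exists>c. \<forall>j\<in>J. \<exists>e. (\<forall>i<n. e i = c i) \<and> ev e (s j) \<noteq> ev e (t j)" for n :: nat
  proof (induction n)
    case 0
    then show ?case using differ by simp
  next
    case (Suc n)
    then obtain c where "\<forall>j\<in>J. \<exists>e. (\<forall>i<n. e i = c i) \<and> ev e (s j) \<noteq> ev e (t j)" by blast
    then obtain d where d: "\<And>j i. j \<in> J \<Longrightarrow> i < n \<Longrightarrow> d j i = c i"
      "\<And>j. j \<in> J \<Longrightarrow> ev (d j) (s j) \<noteq> ev (d j) (t j)"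
      by metis
    \<comment> \<open>The values for variable \<open>n\<close> that make equation \<open>j\<close> true along \<open>d j\<close>.\<close>
    define bad where "bad j = {v. ev ((d j)(n := v)) (s j) = ev ((d j)(n := v)) (t j)}" for j
    have "finite (bad j)" if "j \<in> J" for j
    proof -
      have "v = w" if "v \<in> bad j" "w \<in> bad j" for v w
      proof (rule ccontr)
        assume "v \<noteq> w"
        then have "ev ((d j)(n := d j n)) (s j) = ev ((d j)(n := d j n)) (t j)"
          by (rule two_point) (use that in \<open>simp_all add: bad_def\<close>)
        with d(2)[OF \<open>j \<in> J\<close>] show False by simp
      qed
      then have "is_singleton (bad j) \<or> bad j = {}"
        by (metis is_singletonI')
      then show ?thesis by (auto simp: is_singleton_def)
    qed
    with \<open>finite J\<close> have "finite (\<Union>j\<in>J. bad j)" by blast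
    then obtain v where v: "v \<notin> (\<Union>j\<in>J. bad j)"
      using ex_new_if_finite[OF infinite_universe] by blast
    have "\<forall>j\<in>J. \<exists>e. (\<forall>i<Suc n. e i = (c(n := v)) i) \<and> ev e (s j) \<noteq> ev e (t j)"
    proof
      fix j assume j: "j \<in> J"
      have "ev ((d j)(n := v)) (s j) \<noteq> ev ((d j)(n := v)) (t j)"
        using v j by (auto simp: bad_def)
      moreover have "\<forall>i<Suc n. ((d j)(n := v)) i = (c(n := v)) i"
        using d(1)[OF j] by (auto simp: less_Suc_eq)
      ultimately show "\<exists>e. (\<forall>i<Suc n. e i = (c(n := v)) i) \<and> ev e (s j) \<noteq> ev e (t j)"
        by (intro exI[of _ "(d j)(n := v)"] conjI)
    qed
    then show ?case by (rule exI[of _ "c(n := v)"])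
  qed
  have "finite (\<Union>j\<in>J. vars (s j) \<union> vars (t j))" using \<open>finite J\<close> by simp
  then obtain n where n: "\<forall>i\<in>(\<Union>j\<in>J. vars (s j) \<union> vars (t j)). i < n"
    unfolding finite_nat_set_iff_bounded by (rule exE)
  obtain c where c: "\<And>j. j \<in> J \<Longrightarrow> \<exists>e. (\<forall>i<n. e i = c i) \<and> ev e (s j) \<noteq> ev e (t j)"
    using partial[of n] by blast
  have "ev c (s j) \<noteq> ev c (t j)" if j: "j \<in> J" for j
  proof -
    obtain e where e: "\<And>i. i < n \<Longrightarrow> e i = c i" "ev e (s j) \<noteq> ev e (t j)"
      using c[OF j] by blast
    have "ev e (s j) = ev c (s j)" "ev e (t j) = ev c (t j)"
      by (rule ev_cong, rule e(1), use n j in blast)+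
    with e(2) show ?thesis by simp
  qed
  then show ?thesis by blast
qed

section \<open>Closed sets\<close>

definition closed_sets :: "'a set set" where
  "closed_sets = {{x. f x = g x} | f g. f \<in> term_fun \<and> g \<in> term_fun}"

lemma closedI: "f \<in> term_fun \<Longrightarrow> g \<in> term_fun \<Longrightarrow> {x. f x = g x} \<in> closed_sets"
  by (auto simp: closed_sets_def)

lemma closedE:
  assumes "E \<in> closed_sets"
  obtains f g where "f \<in> term_fun" "g \<in> term_fun" "E = {x. f x = g x}"
  using assms by (auto simp: closed_sets_def)

lemma closed_UNIV [simp]: "UNIV \<in> closed_sets"
  using closedI[OF tf_id tf_id] by simp

lemma closed_empty [simp]: "{} \<in> closed_sets"
  using closedI[OF tf_l' tf_id] by simp

lemma closed_singleton [simp]: "{c} \<in> closed_sets"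
  using closedI[OF tf_id tf_const] by simp

lemma closed_Int: "E \<in> closed_sets \<Longrightarrow> E' \<in> closed_sets \<Longrightarrow> E \<inter> E' \<in> closed_sets"
proof (elim closedE)
  fix f g f' g'
  assume "f \<in> term_fun" "g \<in> term_fun" "f' \<in> term_fun" "g' \<in> term_fun"
    and E: "E = {x. f x = g x}" "E' = {x. f' x = g' x}"
  then have "{x. pr (f x) (f' x) = pr (g x) (g' x)} \<in> closed_sets"
    by (intro closedI tf_pr)
  then show ?thesis unfolding E by (simp add: Collect_conj_eq)
qed

lemma closed_Inter: "finite \<E> \<Longrightarrow> \<E> \<subseteq> closed_sets \<Longrightarrow> \<Inter>\<E> \<in> closed_sets"
  by (induction rule: finite_induct) (auto intro: closed_Int)

lemma closed_vimage: "E \<in> closed_sets \<Longrightarrow> h \<in> term_fun \<Longrightarrow> h -` E \<in> closed_sets"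
proof (elim closedE)
  fix f g
  assume "f \<in> term_fun" "g \<in> term_fun" "h \<in> term_fun" and E: "E = {x. f x = g x}"
  then have "{x. f (h x) = g (h x)} \<in> closed_sets" by (intro closedI tf_comp[of f h] tf_comp[of g h])
  then show ?thesis unfolding E by (simp add: vimage_def)
qed

lemma closed_empty_or_range:
  "E \<in> closed_sets \<Longrightarrow> E = {} \<or> (\<exists>h\<in>term_fun. E = range h)"
  using solutions_empty_or_range by (metis closedE)

text \<open>The normal form of a parametrisation is either constant or yields a left invertible one with the
same range.\<close>

lemma closed_param:
  assumes "E \<in> closed_sets"
  obtains "E = {}" | c where "E = {c}"
  | h k where "h \<in> term_fun" "k \<in> term_fun" "\<And>x. k (h x) = x" "E = range h"
proof -
  consider "E = {}" | a where "a \<in> term_fun" "E = range a"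
    using closed_empty_or_range[OF assms] by blast
  then show ?thesis
  proof cases
    case (2 a)
    from term_fun_normal_form[OF 2(1)] show ?thesis
    proof
      assume "\<exists>c. \<forall>x. a x = c"
      with 2(2) show ?thesis by (auto intro: that(2))
    next
      assume "\<exists>\<theta>\<in>term_fun. \<exists>h\<in>term_fun. \<exists>k\<in>term_fun.
        surj \<theta> \<and> (\<forall>z. a (\<theta> z) = h (l z)) \<and> (\<forall>u. k (h u) = u)"
      then obtain \<theta> h k where *: "h \<in> term_fun" "k \<in> term_fun" "surj \<theta>"
        "\<And>z. a (\<theta> z) = h (l z)" "\<And>u. k (h u) = u" by blast
      have "range a = range h"
      proof (intro equalityI subsetI)
        fix y assume "y \<in> range a"
        then obtain x where "y = a x" by blast
        moreover obtain z where "x = \<theta> z" using \<open>surj \<theta>\<close> by (rule surjE)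
        ultimately show "y \<in> range h" by (simp add: *(4))
      next
        fix y assume "y \<in> range h"
        then obtain u where "y = h u" by blast
        then have "y = a (\<theta> (pr u u))" by (simp add: *(4))
        then show "y \<in> range a" by simp
      qed
      with * 2(2) show ?thesis by (intro that(3)[of h k]) auto
    qed
  qed (rule that(1))
qed

lemma closed_image_retract:
  assumes "E \<in> closed_sets" "h \<in> term_fun" "k \<in> term_fun" "\<And>x. k (h x) = x"
  shows "h ` E \<in> closed_sets"
proof -
  have "{x. h (k x) = x} \<inter> k -` E \<in> closed_sets"
    using assms by (intro closed_Int closedI tf_comp[of h k] closed_vimage) auto
  moreover have "h ` E = {x. h (k x) = x} \<inter> k -` E"
    using assms(4) by (auto simp: image_iff) (metis)
  ultimately show ?thesis by simp
qed

text \<open>In coordinates the closed sets are given by finitely many equations between trees, and a generic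
assignment violates all that are not identities.\<close>

lemma irreducible:
  assumes "finite \<E>" "\<E> \<subseteq> closed_sets" "\<Union>\<E> = UNIV"
  shows "UNIV \<in> \<E>"
proof (rule ccontr)
  assume notin: "UNIV \<notin> \<E>"
  let ?R = "\<lambda>E p. fst p \<in> term_fun \<and> snd p \<in> term_fun \<and> E = {x. fst p x = snd p x}"
  have "\<forall>E\<in>\<E>. \<exists>p. ?R E p"
  proof
    fix E assume "E \<in> \<E>"
    with assms(2) have "E \<in> closed_sets" by blast
    then obtain f g where "f \<in> term_fun" "g \<in> term_fun" "E = {x. f x = g x}"
      by (rule closedE)
    then show "\<exists>p. ?R E p" by (intro exI[of _ "(f, g)"]) simp
  qed
  then obtain p where p: "\<forall>E\<in>\<E>. ?R E (p E)" by (rule bchoice[THEN exE])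
  define f where "f E = fst (p E)" for E
  define g where "g E = snd (p E)" for E
  have fg: "f E \<in> term_fun" "g E \<in> term_fun" "E = {x. f E x = g E x}" if "E \<in> \<E>" for E
    using p that unfolding f_def g_def by blast+
  have "eventually (\<lambda>k. \<forall>E\<in>\<E>. tree_after k (\<lambda>e. f E (e 0)) \<and> tree_after k (\<lambda>e. g E (e 0))) sequentially"
    using assms(1) fg(1,2) by (intro eventually_ball_finite ballI eventually_conj eventually_tree)
  then obtain k where k: "\<forall>E\<in>\<E>. tree_after k (\<lambda>e. f E (e 0)) \<and> tree_after k (\<lambda>e. g E (e 0))"
    by (rule eventually_happens'[OF sequentially_bot, THEN exE])
  then have "\<forall>E\<in>\<E>. \<exists>s. \<forall>e. f E ((split_env ^^ k) e 0) = ev e s"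
    "\<forall>E\<in>\<E>. \<exists>t. \<forall>e. g E ((split_env ^^ k) e 0) = ev e t"
    unfolding tree_after_def by blast+
  then obtain s t where st: "\<forall>E\<in>\<E>. \<forall>e. f E ((split_env ^^ k) e 0) = ev e (s E)"
    "\<forall>E\<in>\<E>. \<forall>e. g E ((split_env ^^ k) e 0) = ev e (t E)"
    by (elim bchoice[THEN exE])
  have s: "f E ((split_env ^^ k) e 0) = ev e (s E)" and t: "g E ((split_env ^^ k) e 0) = ev e (t E)"
    if "E \<in> \<E>" for E e using st that by blast+
  have "\<exists>e. ev e (s E) \<noteq> ev e (t E)" if "E \<in> \<E>" for E
  proof -
    have "E \<noteq> UNIV" using notin \<open>E \<in> \<E>\<close> by blast
    then obtain y where "y \<notin> E" by blast
    then have "f E y \<noteq> g E y" using fg(3)[OF \<open>E \<in> \<E>\<close>] by blast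
    moreover obtain e where "(split_env ^^ k) e 0 = y"
      using split_env_coordinate by blast
    ultimately have "ev e (s E) \<noteq> ev e (t E)"
      using s[of E e] t[of E e] \<open>E \<in> \<E>\<close> by simp
    then show ?thesis by blast
  qed
  then have "\<exists>e. \<forall>E\<in>\<E>. ev e (s E) \<noteq> ev e (t E)"
    by (rule generic_assignment[OF assms(1)])
  then obtain e where e: "\<And>E. E \<in> \<E> \<Longrightarrow> ev e (s E) \<noteq> ev e (t E)" by blast
  have "(split_env ^^ k) e 0 \<notin> E" if "E \<in> \<E>" for E
  proof
    assume "(split_env ^^ k) e 0 \<in> E"
    then have "f E ((split_env ^^ k) e 0) = g E ((split_env ^^ k) e 0)"
      by (subst (asm) fg(3)[OF that]) simp
    with e[OF that] s[OF that, of e] t[OF that, of e] show False by simp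
  qed
  with assms(3) show False by blast
qed

text \<open>Since \<open>two_point\<close> extends an identity from two values of a variable to all of them, it is enough to
test finitely many assignments.\<close>

lemma two_values:
  assumes "finite W" "a \<noteq> b"
    and "\<And>e'. (\<forall>i. i \<notin> W \<longrightarrow> e' i = e i) \<Longrightarrow> (\<forall>i\<in>W. e' i \<in> {a, b}) \<Longrightarrow> ev e' s = ev e' t"
  shows "ev e s = ev e t"
  using assms(1,3)
proof (induction W arbitrary: e rule: finite_induct)
  case empty
  show ?case by (rule empty(1)) auto
next
  case (insert x W)
  have "ev (e(x := c)) s = ev (e(x := c)) t" if "c \<in> {a, b}" for c
  proof (rule insert.IH)
    fix e' assume *: "\<forall>i. i \<notin> W \<longrightarrow> e' i = (e(x := c)) i" "\<forall>i\<in>W. e' i \<in> {a, b}"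
    show "ev e' s = ev e' t"
      by (rule insert.prems) (use * that insert.hyps in auto)
  qed
  then have "ev (e(x := e x)) s = ev (e(x := e x)) t"
    by (rule two_point[OF assms(2)]; simp)
  then show ?case by simp
qed

text \<open>The elements \<open>v\<close> whose coordinates are taken from two fixed values are finitely many, and by
\<open>two_values\<close> they suffice as tests for all \<open>v\<close>. So the set is an intersection of finitely many
closed sets. The number of coordinates does not depend on \<open>u\<close>.\<close>

lemma closed_forall:
  assumes "E \<in> closed_sets"
  shows "{u. \<forall>v. pr u v \<in> E} \<in> closed_sets"
proof -
  obtain f g where fg: "f \<in> term_fun" "g \<in> term_fun" and E: "E = {x. f x = g x}"
    using assms by (rule closedE)
  have "eventually (\<lambda>k. (\<forall>u. tree_after k (\<lambda>e. f (pr u (e 0)))) \<and>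
      (\<forall>u. tree_after k (\<lambda>e. g (pr u (e 0))))) sequentially"
    using fg by (intro eventually_conj eventually_tree_fibre)
  then obtain k where "(\<forall>u. tree_after k (\<lambda>e. f (pr u (e 0)))) \<and>
      (\<forall>u. tree_after k (\<lambda>e. g (pr u (e 0))))"
    by (rule eventually_happens'[OF sequentially_bot, THEN exE])
  then have "\<forall>u. \<exists>s. \<forall>e. f (pr u ((split_env ^^ k) e 0)) = ev e s"
    "\<forall>u. \<exists>t. \<forall>e. g (pr u ((split_env ^^ k) e 0)) = ev e t"
    unfolding tree_after_def by blast+
  then obtain s t where st: "\<forall>u e. f (pr u ((split_env ^^ k) e 0)) = ev e (s u)"
    "\<forall>u e. g (pr u ((split_env ^^ k) e 0)) = ev e (t u)"
    by (elim choice[THEN exE])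
  have s: "f (pr u ((split_env ^^ k) e 0)) = ev e (s u)"
    and t: "g (pr u ((split_env ^^ k) e 0)) = ev e (t u)" for u e using st by blast+
  obtain B where B: "\<And>e. (split_env ^^ k) e 0 = ev e B" "\<And>y. \<exists>e. ev e B = y"
    using tree_coordinates[of k] by blast
  obtain a b :: 'a where ab: "a \<noteq> b" using l_neq by blast
  define A where "A = {e. \<forall>i. (i \<in> vars B \<longrightarrow> e i \<in> {a, b}) \<and> (i \<notin> vars B \<longrightarrow> e i = a)}"
  have "finite A" unfolding A_def by (rule finite_set_of_finite_funs) auto
  have "pr u v \<in> E" if test: "\<And>e. e \<in> A \<Longrightarrow> pr u (ev e B) \<in> E" for u v
  proof -
    obtain e where e: "ev e B = v" using B(2) by blast
    define e' where "e' = (\<lambda>i. if i \<in> vars B then e i else a)"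
    have "ev e' (s u) = ev e' (t u)"
    proof (rule two_values[OF _ ab])
      fix d assume "\<forall>i. i \<notin> vars B \<longrightarrow> d i = e' i" "\<forall>i\<in>vars B. d i \<in> {a, b}"
      then have "d \<in> A" by (auto simp: A_def e'_def)
      from test[OF this] show "ev d (s u) = ev d (t u)"
        by (simp add: E s[symmetric] t[symmetric] B(1))
    qed simp
    then have "pr u (ev e' B) \<in> E"
      by (simp add: E s[symmetric] t[symmetric] B(1))
    moreover have "ev e' B = ev e B" by (rule ev_cong) (simp add: e'_def)
    ultimately show ?thesis using e by simp
  qed
  then have "{u. \<forall>v. pr u v \<in> E} = \<Inter>((\<lambda>e. (\<lambda>u. pr u (ev e B)) -` E) ` A)"
    by auto
  moreover have "\<dots> \<in> closed_sets"
    using \<open>finite A\<close> assms by (intro closed_Inter) (auto intro!: closed_vimage tf_pr)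
  ultimately show ?thesis by simp
qed

section \<open>Constructible sets\<close>

inductive_set constructible :: "'a set set" where
  constructible_closed: "E \<in> closed_sets \<Longrightarrow> E \<in> constructible"
| constructible_Compl: "S \<in> constructible \<Longrightarrow> - S \<in> constructible"
| constructible_Int: "S \<in> constructible \<Longrightarrow> T \<in> constructible \<Longrightarrow> S \<inter> T \<in> constructible"

lemma constructible_Un: "S \<in> constructible \<Longrightarrow> T \<in> constructible \<Longrightarrow> S \<union> T \<in> constructible"
  using constructible_Compl[OF constructible_Int[OF constructible_Compl constructible_Compl]] by simp

lemma constructible_Diff: "S \<in> constructible \<Longrightarrow> T \<in> constructible \<Longrightarrow> S - T \<in> constructible"
  by (simp add: Diff_eq constructible_Int constructible_Compl)

lemma constructible_simps [simp]: "{} \<in> constructible" "UNIV \<in> constructible" "{c} \<in> constructible"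
  by (simp_all add: constructible_closed)

lemma constructible_Union: "finite \<S> \<Longrightarrow> \<S> \<subseteq> constructible \<Longrightarrow> \<Union>\<S> \<in> constructible"
  by (induction rule: finite_induct) (auto intro: constructible_Un)

lemma constructible_UN: "finite I \<Longrightarrow> (\<And>i. i \<in> I \<Longrightarrow> S i \<in> constructible) \<Longrightarrow> (\<Union>i\<in>I. S i) \<in> constructible"
  by (rule constructible_Union) auto

lemma constructible_vimage: "S \<in> constructible \<Longrightarrow> h \<in> term_fun \<Longrightarrow> h -` S \<in> constructible"
  by (induction rule: constructible.induct)
    (auto simp: vimage_Compl intro: constructible_closed closed_vimage constructible_Compl constructible_Int)

lemma constructible_eq: "f \<in> term_fun \<Longrightarrow> g \<in> term_fun \<Longrightarrow> {x. f x = g x} \<in> constructible"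
  by (intro constructible_closed closedI)

lemma closed_Diff_Union_constructible:
  "E \<in> closed_sets \<Longrightarrow> finite \<G> \<Longrightarrow> \<G> \<subseteq> closed_sets \<Longrightarrow> E - \<Union>\<G> \<in> constructible"
  by (intro constructible_Diff constructible_Union) (auto intro: constructible_closed)

text \<open>The conclusion says that \<open>S\<close> lies in the finite Boolean algebra generated by \<open>\<G>\<close>.\<close>

lemma constructible_determined:
  "S \<in> constructible \<Longrightarrow> \<exists>\<G>. finite \<G> \<and> \<G> \<subseteq> closed_sets \<and>
    (\<forall>x y. (\<forall>G\<in>\<G>. x \<in> G \<longleftrightarrow> y \<in> G) \<longrightarrow> (x \<in> S \<longleftrightarrow> y \<in> S))"
proof (induction rule: constructible.induct)
  case (constructible_closed E)
  then show ?case by (intro exI[of _ "{E}"]) auto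
next
  case (constructible_Compl S)
  then show ?case by simp
next
  case (constructible_Int S T)
  from constructible_Int.IH(1) obtain \<G> where \<G>: "finite \<G>" "\<G> \<subseteq> closed_sets"
    "\<forall>x y. (\<forall>G\<in>\<G>. x \<in> G \<longleftrightarrow> y \<in> G) \<longrightarrow> (x \<in> S \<longleftrightarrow> y \<in> S)" by blast
  from constructible_Int.IH(2) obtain \<H> where \<H>: "finite \<H>" "\<H> \<subseteq> closed_sets"
    "\<forall>x y. (\<forall>G\<in>\<H>. x \<in> G \<longleftrightarrow> y \<in> G) \<longrightarrow> (x \<in> T \<longleftrightarrow> y \<in> T)" by blast
  have "x \<in> S \<inter> T \<longleftrightarrow> y \<in> S \<inter> T" if "\<forall>G\<in>\<G> \<union> \<H>. x \<in> G \<longleftrightarrow> y \<in> G" for x y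
  proof -
    have "x \<in> S \<longleftrightarrow> y \<in> S" by (rule \<G>(3)[rule_format]) (use that in blast)
    moreover have "x \<in> T \<longleftrightarrow> y \<in> T" by (rule \<H>(3)[rule_format]) (use that in blast)
    ultimately show ?thesis by simp
  qed
  with \<G>(1,2) \<H>(1,2) show ?case by (intro exI[of _ "\<G> \<union> \<H>"]) blast
qed

text \<open>The atoms of the Boolean algebra generated by finitely many closed sets are pairwise disjoint and have
the form treated in the first case, and \<open>S\<close> is the union of the atoms that it contains.\<close>

lemma constructible_disjoint_induct [consumes 1, case_names diff Un]:
  assumes "S \<in> constructible"
    and diff: "\<And>E \<G>. E \<in> closed_sets \<Longrightarrow> finite \<G> \<Longrightarrow> \<G> \<subseteq> closed_sets \<Longrightarrow> Q (E - \<Union>\<G>)"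
    and Un: "\<And>S T. S \<in> constructible \<Longrightarrow> T \<in> constructible \<Longrightarrow> S \<inter> T = {} \<Longrightarrow> Q S \<Longrightarrow> Q T \<Longrightarrow> Q (S \<union> T)"
  shows "Q S"
proof -
  obtain \<G> where \<G>: "finite \<G>" "\<G> \<subseteq> closed_sets"
    "\<And>x y. \<forall>G\<in>\<G>. x \<in> G \<longleftrightarrow> y \<in> G \<Longrightarrow> x \<in> S \<longleftrightarrow> y \<in> S"
    using constructible_determined[OF assms(1)] by blast
  define atom where "atom \<P> = \<Inter>\<P> - \<Union>(\<G> - \<P>)" for \<P>
  have mem: "x \<in> atom \<P> \<longleftrightarrow> \<P> = {G \<in> \<G>. x \<in> G}" if "\<P> \<subseteq> \<G>" for x \<P>
    using that unfolding atom_def by blast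
  have constructible: "atom \<P> \<in> constructible" "Q (atom \<P>)" if "\<P> \<subseteq> \<G>" for \<P>
    unfolding atom_def using that \<G>(1,2) finite_subset[OF that \<G>(1)]
    by (intro closed_Diff_Union_constructible diff closed_Inter; blast)+
  have Un_atoms: "finite A \<Longrightarrow> A \<subseteq> Pow \<G> \<Longrightarrow>
      (\<Union>\<P>\<in>A. atom \<P>) \<in> constructible \<and> Q (\<Union>\<P>\<in>A. atom \<P>)" for A
  proof (induction rule: finite_induct)
    case empty
    then show ?case using diff[of "{}" "{}"] by simp
  next
    case (insert \<P> A)
    have "atom \<P> \<inter> (\<Union>\<P>\<in>A. atom \<P>) = {}"
    proof (rule ccontr)
      assume "atom \<P> \<inter> (\<Union>\<P>\<in>A. atom \<P>) \<noteq> {}"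
      then obtain x \<P>' where x: "x \<in> atom \<P>" "\<P>' \<in> A" "x \<in> atom \<P>'" by blast
      have "\<P> \<subseteq> \<G>" "\<P>' \<subseteq> \<G>" using insert.prems x(2) by auto
      with x have "\<P> = \<P>'" using mem[of \<P> x] mem[of \<P>' x] by simp
      with \<open>\<P>' \<in> A\<close> insert.hyps show False by simp
    qed
    then show ?case
      using Un[of "atom \<P>" "\<Union>\<P>\<in>A. atom \<P>"] insert constructible[of \<P>] by (simp add: constructible_Un)
  qed
  have S_eq: "S = (\<Union>\<P>\<in>{\<P>. \<P> \<subseteq> \<G> \<and> atom \<P> \<inter> S \<noteq> {}}. atom \<P>)"
  proof (intro equalityI subsetI)
    fix x assume "x \<in> S"
    moreover have "x \<in> atom {G \<in> \<G>. x \<in> G}" by (subst mem) auto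
    ultimately show "x \<in> (\<Union>\<P>\<in>{\<P>. \<P> \<subseteq> \<G> \<and> atom \<P> \<inter> S \<noteq> {}}. atom \<P>)" by blast
  next
    fix x assume "x \<in> (\<Union>\<P>\<in>{\<P>. \<P> \<subseteq> \<G> \<and> atom \<P> \<inter> S \<noteq> {}}. atom \<P>)"
    then obtain \<P> y where "\<P> \<subseteq> \<G>" "x \<in> atom \<P>" "y \<in> atom \<P>" "y \<in> S" by blast
    then have "{G \<in> \<G>. x \<in> G} = {G \<in> \<G>. y \<in> G}" using mem[of \<P> x] mem[of \<P> y] by simp
    then have "\<forall>G\<in>\<G>. x \<in> G \<longleftrightarrow> y \<in> G" by blast
    with \<G>(3) \<open>y \<in> S\<close> show "x \<in> S" by blast
  qed
  have "finite {\<P>. \<P> \<subseteq> \<G> \<and> atom \<P> \<inter> S \<noteq> {}}"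
    by (rule finite_subset[of _ "Pow \<G>"]) (use \<G>(1) in auto)
  moreover have "{\<P>. \<P> \<subseteq> \<G> \<and> atom \<P> \<inter> S \<noteq> {}} \<subseteq> Pow \<G>" by blast
  ultimately have "Q (\<Union>\<P>\<in>{\<P>. \<P> \<subseteq> \<G> \<and> atom \<P> \<inter> S \<noteq> {}}. atom \<P>)"
    using Un_atoms by blast
  then show ?thesis by (subst S_eq)
qed

text \<open>Inclusion and exclusion: closed sets are stable under intersection, so removing one more closed set
\<open>G\<close> from \<open>E - \<Union>\<G>\<close> is the proper difference with \<open>E \<inter> G - \<Union>\<G>\<close>.\<close>

lemma constructible_dynkin_induct [consumes 1, case_names closed Un Diff]:
  assumes "S \<in> constructible"
    and closed: "\<And>E. E \<in> closed_sets \<Longrightarrow> H E"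
    and Un: "\<And>S T. S \<in> constructible \<Longrightarrow> T \<in> constructible \<Longrightarrow> S \<inter> T = {} \<Longrightarrow> H S \<Longrightarrow> H T \<Longrightarrow> H (S \<union> T)"
    and Diff: "\<And>S T. S \<in> constructible \<Longrightarrow> T \<in> constructible \<Longrightarrow> S \<subseteq> T \<Longrightarrow> H S \<Longrightarrow> H T \<Longrightarrow> H (T - S)"
  shows "H S"
  using assms(1)
proof (induction rule: constructible_disjoint_induct)
  case (diff E \<G>)
  from diff(2,3,1) show ?case
  proof (induction \<G> arbitrary: E rule: finite_induct)
    case empty
    then show ?case using closed by simp
  next
    case (insert G \<G>)
    have "H ((E - \<Union>\<G>) - (E \<inter> G - \<Union>\<G>))"
      using insert by (intro Diff closed_Diff_Union_constructible insert.IH closed_Int) auto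
    moreover have "(E - \<Union>\<G>) - (E \<inter> G - \<Union>\<G>) = E - \<Union>(insert G \<G>)" by blast
    ultimately show ?case by simp
  qed
next
  case (Un S T)
  then show ?case using assms(3) by blast
qed

text \<open>Fibres of \<open>l\<close> are copies of the universe, hence irreducible: a fibre meets the complement unless it
is contained in a single one of the closed sets, and this is a closed condition on the base point
by \<open>closed_forall\<close>.\<close>

lemma image_l_open:
  assumes "finite \<E>" "\<E> \<subseteq> closed_sets"
  shows "l ` (- \<Union>\<E>) \<in> constructible"
proof -
  have "l ` (- \<Union>\<E>) = - \<Union>((\<lambda>E. {u. \<forall>v. pr u v \<in> E}) ` \<E>)"
  proof (intro equalityI subsetI)
    fix u assume "u \<in> l ` (- \<Union>\<E>)"
    then obtain z where z: "u = l z" "z \<notin> \<Union>\<E>" by blast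
    then have "pr u (r z) \<notin> \<Union>\<E>" by simp
    then show "u \<in> - \<Union>((\<lambda>E. {u. \<forall>v. pr u v \<in> E}) ` \<E>)" by blast
  next
    fix u assume u: "u \<in> - \<Union>((\<lambda>E. {u. \<forall>v. pr u v \<in> E}) ` \<E>)"
    have "\<Union>((\<lambda>E. (\<lambda>v. pr u v) -` E) ` \<E>) \<noteq> UNIV"
    proof
      assume "\<Union>((\<lambda>E. (\<lambda>v. pr u v) -` E) ` \<E>) = UNIV"
      then have "UNIV \<in> (\<lambda>E. (\<lambda>v. pr u v) -` E) ` \<E>"
        using assms by (intro irreducible) (auto intro!: closed_vimage tf_pr)
      then obtain E where "E \<in> \<E>" "\<And>v. pr u v \<in> E" by blast
      with u show False by blast
    qed
    then obtain v where "pr u v \<notin> \<Union>\<E>" by blast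
    then show "u \<in> l ` (- \<Union>\<E>)" by (intro image_eqI[of _ _ "pr u v"]) auto
  qed
  also have "\<dots> \<in> constructible"
    using assms by (intro constructible_Compl constructible_Union) (auto intro!: constructible_closed closed_forall)
  finally show ?thesis .
qed

lemma constructible_image_retract:
  assumes "S \<in> constructible" "h \<in> term_fun" "k \<in> term_fun" "\<And>x. k (h x) = x"
  shows "h ` S \<in> constructible"
proof -
  have "{x. h (k x) = x} \<inter> k -` S \<in> constructible"
    using assms by (intro constructible_Int constructible_eq tf_comp[of h k] constructible_vimage) auto
  moreover have "h ` S = {x. h (k x) = x} \<inter> k -` S"
    using assms(4) by (auto simp: image_iff) (metis)
  ultimately show ?thesis by simp
qed

text \<open>The normal form of \<open>a\<close> reduces the image to a projection followed by a left invertible map.\<close>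

lemma image_open:
  assumes a: "a \<in> term_fun" and \<E>: "finite \<E>" "\<E> \<subseteq> closed_sets"
  shows "a ` (- \<Union>\<E>) \<in> constructible"
  using term_fun_normal_form[OF a]
proof
  assume "\<exists>c. \<forall>x. a x = c"
  then obtain c where "\<And>x. a x = c" by blast
  then have "a ` (- \<Union>\<E>) = {} \<or> a ` (- \<Union>\<E>) = {c}" by auto
  then show ?thesis by auto
next
  assume "\<exists>\<theta>\<in>term_fun. \<exists>h\<in>term_fun. \<exists>k\<in>term_fun.
    surj \<theta> \<and> (\<forall>z. a (\<theta> z) = h (l z)) \<and> (\<forall>u. k (h u) = u)"
  then obtain \<theta> h k where *: "\<theta> \<in> term_fun" "h \<in> term_fun" "k \<in> term_fun" "surj \<theta>"
    "\<And>z. a (\<theta> z) = h (l z)" "\<And>u. k (h u) = u" by blast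
  have "a ` (- \<Union>\<E>) = a ` (\<theta> ` (\<theta> -` (- \<Union>\<E>)))"
    using \<open>surj \<theta>\<close> by (simp add: surj_image_vimage_eq)
  also have "\<dots> = h ` (l ` (- \<Union>((-`) \<theta> ` \<E>)))"
    by (simp add: image_image *(5) vimage_Compl vimage_Union)
  also have "\<dots> \<in> constructible"
  proof -
    have "finite ((-`) \<theta> ` \<E>)" "(-`) \<theta> ` \<E> \<subseteq> closed_sets"
      using \<E> *(1) by (auto intro: closed_vimage)
    then show ?thesis by (rule constructible_image_retract[OF image_l_open *(2,3,6)])
  qed
  finally show ?thesis .
qed

text \<open>Elimination of an existential quantifier.\<close>

lemma constructible_image:
  assumes "S \<in> constructible" "f \<in> term_fun"
  shows "f ` S \<in> constructible"
  using assms(1)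
proof (induction rule: constructible_disjoint_induct)
  case (diff E \<G>)
  from closed_empty_or_range[OF diff(1)] show ?case
  proof
    assume "\<exists>h\<in>term_fun. E = range h"
    then obtain h where h: "h \<in> term_fun" "E = range h" by blast
    have "f ` (E - \<Union>\<G>) = (\<lambda>x. f (h x)) ` (- \<Union>((-`) h ` \<G>))"
      unfolding h(2) by auto
    also have "\<dots> \<in> constructible"
      using diff h tf_comp[OF assms(2) h(1)] by (intro image_open) (auto intro: closed_vimage)
    finally show ?thesis .
  qed simp
next
  case (Un S T)
  then show ?case by (simp add: image_Un constructible_Un)
qed

text \<open>In the normal form of \<open>a\<close>, injectivity forces \<open>\<theta> (pr u v) = \<theta> (pr u v')\<close> whenever both points avoid
the exceptional closed sets. By irreducibility this equation then holds throughout, so \<open>\<theta>\<close> factors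
through \<open>l\<close>, and \<open>a\<close> is left invertible because \<open>h\<close> is.\<close>

lemma left_inverse_of_generic_inj:
  assumes a: "a \<in> term_fun" and \<E>: "finite \<E>" "\<E> \<subseteq> closed_sets" "UNIV \<notin> \<E>"
    and inj: "inj_on a (- \<Union>\<E>)"
  shows "\<exists>k\<in>term_fun. \<forall>x. k (a x) = x"
proof -
  have avoid: "\<exists>x. x \<notin> \<Union>\<F>" if "finite \<F>" "\<F> \<subseteq> closed_sets" "UNIV \<notin> \<F>" for \<F>
    using irreducible[OF that(1,2)] that(3) by blast
  from term_fun_normal_form[OF a] show ?thesis
  proof
    assume "\<exists>c. \<forall>x. a x = c"
    then have a_eq: "a x = a y" for x y by metis
    obtain x where x: "x \<notin> \<Union>\<E>" using avoid \<E> by blast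
    \<comment> \<open>Adding \<open>{x}\<close> to the exceptional sets yields a second point where \<open>a\<close> has the same value.\<close>
    have "{x} \<noteq> UNIV" using l_neq[of x] by blast
    then obtain y where "y \<notin> \<Union>(insert {x} \<E>)"
      using avoid[of "insert {x} \<E>"] \<E> by auto
    with inj x a_eq[of x y] show ?thesis by (auto dest: inj_onD)
  next
    assume "\<exists>\<theta>\<in>term_fun. \<exists>h\<in>term_fun. \<exists>k\<in>term_fun.
      surj \<theta> \<and> (\<forall>z. a (\<theta> z) = h (l z)) \<and> (\<forall>u. k (h u) = u)"
    then obtain \<theta> h k where *: "\<theta> \<in> term_fun" "h \<in> term_fun" "k \<in> term_fun" "surj \<theta>"
      "\<And>z. a (\<theta> z) = h (l z)" "\<And>u. k (h u) = u" by blast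
    \<comment> \<open>The element \<open>w\<close> packs a point \<open>u\<close> of the base and two points of the fibre above it.\<close>
    let ?f = "\<lambda>w. \<theta> (pr (l w) (l (r w)))" and ?g = "\<lambda>w. \<theta> (pr (l w) (r (r w)))"
    have fg: "?f \<in> term_fun" "?g \<in> term_fun"
      by (intro tf_comp[OF *(1)] tf_pr tf_l tf_r tf_id)+
    define \<F> where "\<F> = insert {w. ?f w = ?g w} ((\<lambda>E. ?f -` E) ` \<E> \<union> (\<lambda>E. ?g -` E) ` \<E>)"
    have "finite \<F>" "\<F> \<subseteq> closed_sets"
      unfolding \<F>_def using \<E> fg by (auto intro!: closed_vimage closedI)
    moreover have "\<Union>\<F> = UNIV"
    proof -
      have "?f w = ?g w" if "?f w \<notin> \<Union>\<E>" "?g w \<notin> \<Union>\<E>" for w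
        by (rule inj_onD[OF inj]) (use that in \<open>simp_all add: *(5)\<close>)
      then show ?thesis unfolding \<F>_def by auto
    qed
    ultimately have UNIV_in: "UNIV \<in> \<F>" by (rule irreducible)
    have proper: "(\<lambda>w. \<theta> (pr (l w) (p (r w)))) -` E \<noteq> UNIV" if "E \<in> \<E>" "surj p" for E p
    proof
      assume "(\<lambda>w. \<theta> (pr (l w) (p (r w)))) -` E = UNIV"
      then have E: "\<theta> (pr (l w) (p (r w))) \<in> E" for w by blast
      have "y \<in> E" for y
      proof -
        obtain z where z: "y = \<theta> z" using \<open>surj \<theta>\<close> by (rule surjE)
        obtain v where "r z = p v" using \<open>surj p\<close> by (rule surjE)
        then show ?thesis using E[of "pr (l z) v"] z by (metis l_pr r_pr pr_l_r)
      qed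
      then have "E = UNIV" by (rule UNIV_eq_I[symmetric])
      with \<E>(3) that(1) show False by simp
    qed
    have "surj l" "surj r" by (rule surjI[of _ "\<lambda>x. pr x x"], simp)+
    then have "?f -` E \<noteq> UNIV" "?g -` E \<noteq> UNIV" if "E \<in> \<E>" for E
      using proper[OF that, of l] proper[OF that, of r] by simp_all
    with UNIV_in have "UNIV = {w. ?f w = ?g w}" unfolding \<F>_def by blast
    then have eq: "?f w = ?g w" for w by blast
    have \<theta>: "\<theta> (pr u v) = \<theta> (pr u v')" for u v v'
      using eq[of "pr u (pr v v')"] by simp
    let ?k = "\<lambda>x. \<theta> (pr (k x) (k x))"
    have "?k (a x) = x" for x
    proof -
      obtain z where z: "x = \<theta> z" using \<open>surj \<theta>\<close> by (rule surjE)
      then have "k (a x) = l z" by (simp add: *(5,6))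
      then show ?thesis using \<theta>[of "l z" "l z" "r z"] z by simp
    qed
    moreover have "?k \<in> term_fun"
      using * by (intro tf_comp[of \<theta> "\<lambda>x. pr (k x) (k x)"] tf_pr)
    ultimately show ?thesis by (intro bexI[of _ ?k] allI)
  qed
qed

section \<open>Euler characteristics of constructible sets\<close>

definition cells :: "'a set set" where
  "cells = closed_sets - {{}}"

text \<open>Infinite closed sets are copies of the universe; \<open>p\<close> is their common weight.\<close>

definition weight :: "int \<Rightarrow> 'a set \<Rightarrow> int" where
  "weight p E = (if is_singleton E then 1 else p)"

definition combination :: "(int \<times> 'a set) list \<Rightarrow> 'a \<Rightarrow> int" where
  "combination ps x = (\<Sum>q\<leftarrow>ps. fst q * of_bool (x \<in> snd q))"

definition total :: "int \<Rightarrow> (int \<times> 'a set) list \<Rightarrow> int" where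
  "total p ps = (\<Sum>q\<leftarrow>ps. fst q * weight p (snd q))"

lemma not_singleton_UNIV: "\<not> is_singleton (UNIV :: 'a set)"
  by (simp add: is_singleton_altdef infinite_universe)

lemma cell_irreducible:
  assumes "E \<in> cells" "finite \<G>" "\<G> \<subseteq> closed_sets" "E \<subseteq> \<Union>\<G>"
  shows "\<exists>G\<in>\<G>. E \<subseteq> G"
proof -
  have "E \<in> closed_sets" "E \<noteq> {}" using assms(1) by (auto simp: cells_def)
  from this(1) show ?thesis
  proof (rule closed_param)
    fix h k assume h: "h \<in> term_fun" "E = range h"
    have "\<Union>((-`) h ` \<G>) = UNIV" using assms(4) h(2) by auto
    then have "UNIV \<in> (-`) h ` \<G>"
      using assms(2,3) h(1) by (intro irreducible) (auto intro: closed_vimage)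
    then show ?thesis using h(2) by auto
  qed (use assms(4) \<open>E \<noteq> {}\<close> in auto)
qed

lemma combination_split:
  "combination ps x = combination (filter Q ps) x + combination (filter (\<lambda>q. \<not> Q q) ps) x"
  unfolding combination_def by (rule sum_list_filter_split)

lemma total_split:
  "total p ps = total p (filter Q ps) + total p (filter (\<lambda>q. \<not> Q q) ps)"
  unfolding total_def by (rule sum_list_filter_split)

lemma same_cell:
  assumes "\<And>q. q \<in> set ps \<Longrightarrow> snd q = E"
  shows "combination ps x = (\<Sum>q\<leftarrow>ps. fst q) * of_bool (x \<in> E)"
    "total p ps = (\<Sum>q\<leftarrow>ps. fst q) * weight p E"
  using assms by (induction ps) (auto simp: combination_def total_def distrib_right)

lemma combination_outside: "(\<And>q. q \<in> set ps \<Longrightarrow> x \<notin> snd q) \<Longrightarrow> combination ps x = 0"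
  by (induction ps) (auto simp: combination_def)

text \<open>Linear independence of the indicator functions. A maximal cell among those involved has a point
outside all the others, so its coefficients add up to zero, and it can be dropped.\<close>

lemma total_eq_0:
  assumes "snd ` set ps \<subseteq> cells" "\<And>x. combination ps x = 0"
  shows "total p ps = 0"
  using assms
proof (induction "length ps" arbitrary: ps rule: less_induct)
  case less
  show ?case
  proof (cases "ps = []")
    case False
    then obtain E where E: "E \<in> snd ` set ps" "\<forall>E'\<in>snd ` set ps. E \<subseteq> E' \<longrightarrow> E = E'"
      using finite_has_maximal[of "snd ` set ps"] by auto
    define Q where "Q q \<longleftrightarrow> snd q = E" for q :: "int \<times> 'a set"
    let ?s = "\<Sum>q\<leftarrow>filter Q ps. fst q"
    have same: "\<And>q. q \<in> set (filter Q ps) \<Longrightarrow> snd q = E" by (auto simp: Q_def)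
    have "\<not> E \<subseteq> \<Union>(snd ` set ps - {E})"
    proof
      assume "E \<subseteq> \<Union>(snd ` set ps - {E})"
      then have "\<exists>G\<in>snd ` set ps - {E}. E \<subseteq> G"
        using less.prems(1) E(1) by (intro cell_irreducible) (auto simp: cells_def)
      with E(2) show False by blast
    qed
    then obtain x where x: "x \<in> E" "x \<notin> \<Union>(snd ` set ps - {E})" by blast
    have "combination (filter (\<lambda>q. \<not> Q q) ps) x = 0"
      by (rule combination_outside) (use x(2) in \<open>auto simp: Q_def\<close>)
    with less.prems(2)[of x] same_cell(1)[of "filter Q ps" E x, OF same] x(1) combination_split[of ps x Q]
    have s: "?s = 0" by simp
    have "total p (filter (\<lambda>q. \<not> Q q) ps) = 0"
    proof (rule less.hyps)
      have "filter Q ps \<noteq> []" using E(1) by (auto simp: Q_def filter_empty_conv)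
      then show "length (filter (\<lambda>q. \<not> Q q) ps) < length ps"
        by (metis (mono_tags, lifting) add_diff_cancel_right' diff_is_0_eq leI length_0_conv sum_length_filter_compl)
      show "snd ` set (filter (\<lambda>q. \<not> Q q) ps) \<subseteq> cells" using less.prems(1) by auto
      show "combination (filter (\<lambda>q. \<not> Q q) ps) y = 0" for y
        using less.prems(2)[of y] same_cell(1)[of "filter Q ps" E y, OF same] s combination_split[of ps y Q]
        by simp
    qed
    with same_cell(2)[of "filter Q ps" E p, OF same] s total_split[of p ps Q] show ?thesis by simp
  qed (simp add: total_def)
qed

definition represents :: "(int \<times> 'a set) list \<Rightarrow> 'a set \<Rightarrow> bool" where
  "represents ps S \<longleftrightarrow> snd ` set ps \<subseteq> cells \<and> (\<forall>x. combination ps x = of_bool (x \<in> S))"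

definition neg :: "(int \<times> 'a set) list \<Rightarrow> (int \<times> 'a set) list" where
  "neg ps = map (\<lambda>q. (- fst q, snd q)) ps"

lemma combination_append: "combination (ps @ qs) x = combination ps x + combination qs x"
  by (simp add: combination_def)

lemma total_append: "total p (ps @ qs) = total p ps + total p qs"
  by (simp add: total_def)

lemma combination_neg: "combination (neg ps) x = - combination ps x"
  by (induction ps) (simp_all add: combination_def neg_def)

lemma total_neg: "total p (neg ps) = - total p ps"
  by (induction ps) (simp_all add: total_def neg_def)

lemma snd_set_neg [simp]: "snd ` set (neg ps) = snd ` set ps"
  by (simp add: neg_def image_image)

lemma combination_products:
  assumes "\<And>E E'. z \<in> f E E' \<longleftrightarrow> x \<in> E \<and> y \<in> E'"
  shows "combination (products f ps qs) z = combination ps x * combination qs y"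
  unfolding combination_def by (rule sum_list_products) (use assms in auto)

lemma combination_nonempty:
  "combination (filter (\<lambda>q. snd q \<noteq> {}) ps) x = combination ps x"
  by (induction ps) (auto simp: combination_def)

lemma represents_cell: "E \<in> closed_sets \<Longrightarrow> E \<noteq> {} \<Longrightarrow> represents [(1, E)] E"
  by (simp add: represents_def combination_def cells_def)

lemma represents_empty: "represents [] {}"
  by (simp add: represents_def combination_def)

lemma ex_represents: "S \<in> constructible \<Longrightarrow> \<exists>ps. represents ps S"
proof (induction rule: constructible.induct)
  case (constructible_closed E)
  then show ?case using represents_cell represents_empty by (cases "E = {}") blast+
next
  case (constructible_Compl S)
  then obtain ps where "represents ps S" by blast
  then have "represents ((1, UNIV) # neg ps) (- S)"
    using combination_append[of "[(1, UNIV)]" "neg ps"]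
    by (simp add: represents_def combination_neg cells_def) (simp add: combination_def)
  then show ?case by blast
next
  case (constructible_Int S T)
  then obtain ps qs where pq: "represents ps S" "represents qs T" by blast
  then have "represents (filter (\<lambda>q. snd q \<noteq> {}) (products (\<inter>) ps qs)) (S \<inter> T)"
    by (fastforce simp: represents_def combination_nonempty combination_products[where f = "(\<inter>)"]
        set_products cells_def intro!: closed_Int)
  then show ?case by blast
qed

text \<open>By linear independence the value does not depend on the chosen representation.\<close>

definition euler :: "int \<Rightarrow> 'a set \<Rightarrow> int" where
  "euler p S = total p (SOME ps. represents ps S)"

lemma euler_eq: "represents ps S \<Longrightarrow> euler p S = total p ps"
proof -
  assume ps: "represents ps S"
  define qs where "qs = (SOME ps. represents ps S)"
  have qs: "represents qs S" unfolding qs_def using ps by (rule someI)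
  have "total p (ps @ neg qs) = 0"
    using ps qs by (intro total_eq_0)
      (simp_all add: represents_def combination_append combination_neg image_Un)
  then show ?thesis by (simp add: euler_def qs_def[symmetric] total_append total_neg)
qed

lemma euler_cell: "E \<in> closed_sets \<Longrightarrow> E \<noteq> {} \<Longrightarrow> euler p E = weight p E"
  by (simp add: euler_eq[OF represents_cell] total_def)

lemma euler_empty [simp]: "euler p {} = 0"
  by (simp add: euler_eq[OF represents_empty] total_def)

lemma euler_singleton [simp]: "euler p {c} = 1"
  by (simp add: euler_cell weight_def)

lemma euler_UNIV [simp]: "euler p UNIV = p"
  by (simp add: euler_cell weight_def not_singleton_UNIV)

lemma euler_Un:
  assumes "S \<in> constructible" "T \<in> constructible" "S \<inter> T = {}"
  shows "euler p (S \<union> T) = euler p S + euler p T"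
proof -
  obtain ps qs where pq: "represents ps S" "represents qs T"
    using assms ex_represents by blast
  then have "represents (ps @ qs) (S \<union> T)"
    using assms(3) by (auto simp: represents_def combination_append)
  then show ?thesis using pq by (simp add: euler_eq total_append)
qed

lemma is_singleton_image: "inj_on f E \<Longrightarrow> is_singleton (f ` E) \<longleftrightarrow> is_singleton E"
  unfolding is_singleton_altdef by (simp add: card_image)

lemma is_singleton_times:
  assumes "E \<noteq> {}" "E' \<noteq> {}"
  shows "is_singleton {z. l z \<in> E \<and> r z \<in> E'} \<longleftrightarrow> is_singleton E \<and> is_singleton E'"
proof -
  have "{z. l z \<in> E \<and> r z \<in> E'} = (\<lambda>(x, y). pr x y) ` (E \<times> E')"
    by (auto intro!: image_eqI[of _ _ "(l z, r z)" for z])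
  moreover have "inj_on (\<lambda>(x, y). pr x y) (E \<times> E')" by (auto simp: inj_on_def)
  ultimately have "is_singleton {z. l z \<in> E \<and> r z \<in> E'} \<longleftrightarrow> is_singleton (E \<times> E')"
    by (simp add: is_singleton_image)
  then show ?thesis
    using assms by (simp add: is_singleton_altdef card_cartesian_product)
qed

lemma closed_times:
  "E \<in> closed_sets \<Longrightarrow> E' \<in> closed_sets \<Longrightarrow> {z. l z \<in> E \<and> r z \<in> E'} \<in> closed_sets"
  using closed_Int[OF closed_vimage[of E l] closed_vimage[of E' r]]
  by (simp add: vimage_def Collect_conj_eq)

lemma euler_times:
  assumes "S \<in> constructible" "T \<in> constructible" and p: "p * p = p"
  shows "euler p {z. l z \<in> S \<and> r z \<in> T} = euler p S * euler p T"
proof -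
  let ?f = "\<lambda>E E'. {z. l z \<in> E \<and> r z \<in> E'}"
  obtain ps qs where ps: "represents ps S" and qs: "represents qs T"
    using assms ex_represents by blast
  have "snd ` set (products ?f ps qs) \<subseteq> cells"
  proof
    fix E assume "E \<in> snd ` set (products ?f ps qs)"
    then obtain u v where uv: "u \<in> set ps" "v \<in> set qs" "E = ?f (snd u) (snd v)"
      unfolding set_products by force
    then have E12: "snd u \<in> cells" "snd v \<in> cells"
      using ps qs unfolding represents_def by blast+
    then obtain x y where "x \<in> snd u" "y \<in> snd v" unfolding cells_def by blast
    then have "pr x y \<in> E" using uv(3) by simp
    then show "E \<in> cells" using closed_times[of "snd u" "snd v"] E12 uv(3) unfolding cells_def by blast
  qed
  moreover have "combination (products ?f ps qs) z = combination ps (l z) * combination qs (r z)" for z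
    by (rule combination_products) simp
  ultimately have "represents (products ?f ps qs) (?f S T)"
    using ps qs by (simp add: represents_def)
  moreover have "total p (products ?f ps qs) = total p ps * total p qs"
    unfolding total_def
  proof (rule sum_list_products)
    fix x y assume "x \<in> set ps" "y \<in> set qs"
    then have "snd x \<in> cells" "snd y \<in> cells" using ps qs by (auto simp: represents_def)
    then have "snd x \<noteq> {}" "snd y \<noteq> {}" by (auto simp: cells_def)
    then have "weight p (?f (snd x) (snd y)) = weight p (snd x) * weight p (snd y)"
      using p by (simp add: weight_def is_singleton_times)
    then show "fst (fst x * fst y, ?f (snd x) (snd y)) *
        weight p (snd (fst x * fst y, ?f (snd x) (snd y))) =
        fst x * weight p (snd x) * (fst y * weight p (snd y))" by simp
  qed
  ultimately show ?thesis using ps qs by (simp add: euler_eq)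
qed

lemma euler_image_retract:
  assumes S: "S \<in> constructible" and h: "h \<in> term_fun" "k \<in> term_fun" "\<And>x. k (h x) = x"
  shows "euler p (h ` S) = euler p S"
proof -
  obtain ps where ps: "represents ps S" using S ex_represents by blast
  define qs where "qs = map (\<lambda>q. (fst q, h ` snd q)) ps"
  have inj: "inj h" using h(3) by (rule inj_on_inverseI)
  have "combination qs x = of_bool (x \<in> h ` S)" for x
  proof (cases "x \<in> range h")
    case True
    then obtain y where y: "x = h y" by blast
    have "combination qs x = combination ps y"
      by (simp add: combination_def qs_def comp_def y inj_image_mem_iff[OF inj])
    then show ?thesis using ps by (simp add: represents_def y inj_image_mem_iff[OF inj])
  next
    case False
    then have *: "x \<notin> h ` A" for A by blast
    then have "combination qs x = 0" by (simp add: combination_def qs_def comp_def)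
    then show ?thesis using * by simp
  qed
  moreover have "snd ` set qs \<subseteq> cells"
    using ps closed_image_retract[OF _ h] by (auto simp: represents_def cells_def qs_def)
  ultimately have "represents qs (h ` S)" by (simp add: represents_def)
  moreover have "total p qs = total p ps"
    by (simp add: total_def qs_def comp_def weight_def is_singleton_image inj_on_subset[OF inj])
  ultimately show ?thesis using ps by (simp add: euler_eq)
qed

text \<open>A piece \<open>E - \<Union>\<G>\<close> with more than one point is parametrised by a left invertible \<open>h\<close>, and then \<open>f\<close>
composed with \<open>h\<close> is left invertible as well. Such maps send cells to cells of the same weight, so the
piece and its image have the same characteristic as their common preimage under \<open>h\<close>.\<close>

lemma euler_image:
  assumes "S \<in> constructible" "f \<in> term_fun" "inj_on f S"
  shows "euler p (f ` S) = euler p S"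
  using assms(1,3)
proof (induction rule: constructible_disjoint_induct)
  case (Un S T)
  have "f ` S \<inter> f ` T = {}"
    using Un.prems Un.hyps(3) by (auto simp: inj_on_def)
  then show ?case
    using Un assms(2) by (simp add: image_Un euler_Un constructible_image inj_on_Un)
next
  case (diff E \<G>)
  from diff.hyps(1) show ?case
  proof (rule closed_param)
    fix c assume "E = {c}"
    then have "E - \<Union>\<G> = {} \<or> E - \<Union>\<G> = {c}" by auto
    then show ?thesis
      by (elim disjE) (simp_all only: image_empty image_insert euler_empty euler_singleton)
  next
    fix h k assume h: "h \<in> term_fun" "k \<in> term_fun" "\<And>x. k (h x) = x" "E = range h"
    let ?\<E> = "(-`) h ` \<G>"
    have \<E>: "finite ?\<E>" "?\<E> \<subseteq> closed_sets"
      using diff.hyps h(1) by (auto intro: closed_vimage)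
    have im: "E - \<Union>\<G> = h ` (- \<Union>?\<E>)" using h(4) by auto
    show ?thesis
    proof (cases "UNIV \<in> ?\<E>")
      case True
      then have "- \<Union>?\<E> = {}" by blast
      then show ?thesis unfolding im by simp
    next
      case False
      have U: "- \<Union>?\<E> \<in> constructible"
        using closed_Diff_Union_constructible[OF closed_UNIV \<E>] by (simp add: Compl_eq_Diff_UNIV)
      have "inj_on (\<lambda>x. f (h x)) (- \<Union>?\<E>)"
      proof (rule inj_onI)
        fix x y assume "x \<in> - \<Union>?\<E>" "y \<in> - \<Union>?\<E>" "f (h x) = f (h y)"
        with diff.prems have "h x = h y" unfolding im by (auto dest: inj_onD)
        then show "x = y" using h(3) by metis
      qed
      then obtain k' where k': "k' \<in> term_fun" "\<And>x. k' (f (h x)) = x"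
        using left_inverse_of_generic_inj[OF tf_comp[OF assms(2) h(1)] \<E> False] by blast
      have "euler p ((\<lambda>x. f (h x)) ` (- \<Union>?\<E>)) = euler p (h ` (- \<Union>?\<E>))"
        using euler_image_retract[OF U tf_comp[OF assms(2) h(1)] k'] euler_image_retract[OF U h(1-3)]
        by simp
      then show ?thesis unfolding im by (simp add: image_image)
    qed
  qed simp
qed

section \<open>Constructible bijections\<close>

text \<open>The graph of a constructible bijection, taken as a constructible set of pairs. This form is
symmetric in \<open>S\<close> and \<open>T\<close>.\<close>

definition eqp :: "'a set \<Rightarrow> 'a set \<Rightarrow> bool" where
  "eqp S T \<longleftrightarrow> (\<exists>G\<in>constructible. bij_betw l G S \<and> bij_betw r G T)"

definition times :: "'a set \<Rightarrow> 'a set \<Rightarrow> 'a set" where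
  "times S T = {z. l z \<in> S \<and> r z \<in> T}"

lemma bij_betw_image_iff: "bij_betw (\<lambda>x. f (h x)) G S \<Longrightarrow> bij_betw f (h ` G) S"
  unfolding bij_betw_def by (auto simp: inj_on_def image_image)

lemma eqpI:
  assumes "G \<in> constructible" "f \<in> term_fun" "g \<in> term_fun" "bij_betw f G S" "bij_betw g G T"
  shows "eqp S T"
  unfolding eqp_def
proof (intro bexI conjI)
  let ?h = "\<lambda>x. pr (f x) (g x)"
  show "?h ` G \<in> constructible" using assms by (intro constructible_image tf_pr)
  show "bij_betw l (?h ` G) S" "bij_betw r (?h ` G) T"
    by (rule bij_betw_image_iff, simp add: assms)+
qed

lemma eqp_constructible: "eqp S T \<Longrightarrow> S \<in> constructible \<and> T \<in> constructible"
  unfolding eqp_def bij_betw_def using constructible_image by blast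

lemma eqp_image: "S \<in> constructible \<Longrightarrow> f \<in> term_fun \<Longrightarrow> inj_on f S \<Longrightarrow> eqp S (f ` S)"
  by (rule eqpI[of S "\<lambda>x. x" f]) (auto simp: bij_betw_def)

lemma eqp_sym: "eqp S T \<Longrightarrow> eqp T S"
  unfolding eqp_def[of S] using eqpI[OF _ tf_r' tf_l'] by blast

lemma eqp_trans:
  assumes "eqp S T" "eqp T U"
  shows "eqp S U"
proof -
  obtain G H where G: "G \<in> constructible" "bij_betw l G S" "bij_betw r G T"
    and H: "H \<in> constructible" "bij_betw l H T" "bij_betw r H U"
    using assms unfolding eqp_def by blast
  \<comment> \<open>The elements of \<open>J\<close> are pairs of composable elements of the two graphs.\<close>
  define J where "J = l -` G \<inter> r -` H \<inter> {z. r (l z) = l (r z)}"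
  have "J \<in> constructible" unfolding J_def
    using G H by (intro constructible_Int constructible_vimage constructible_eq) auto
  moreover have "bij_betw l J G"
    unfolding bij_betw_def
  proof
    show "inj_on l J"
    proof (rule inj_onI)
      fix x y assume *: "x \<in> J" "y \<in> J" "l x = l y"
      then have "l (r x) = l (r y)" "r x \<in> H" "r y \<in> H" unfolding J_def by auto
      then have "r x = r y" using H(2) by (auto simp: bij_betw_def dest: inj_onD)
      with *(3) show "x = y" by (rule pair_eqI)
    qed
    show "l ` J = G"
    proof (intro equalityI subsetI)
      fix g assume g: "g \<in> G"
      then have "r g \<in> l ` H" using G(3) H(2) by (auto simp: bij_betw_def)
      then obtain h where "h \<in> H" "r g = l h" by blast
      with g have "pr g h \<in> J" by (simp add: J_def)
      then show "g \<in> l ` J" by (rule image_eqI[rotated]) simp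
    qed (auto simp: J_def)
  qed
  then have "bij_betw (\<lambda>z. l (l z)) J S"
    using bij_betw_trans[OF _ G(2)] by (simp add: comp_def)
  moreover have "bij_betw r J H"
    unfolding bij_betw_def
  proof
    show "inj_on r J"
    proof (rule inj_onI)
      fix x y assume *: "x \<in> J" "y \<in> J" "r x = r y"
      then have "r (l x) = r (l y)" "l x \<in> G" "l y \<in> G" unfolding J_def by auto
      then have "l x = l y" using G(3) by (auto simp: bij_betw_def dest: inj_onD)
      from this *(3) show "x = y" by (rule pair_eqI)
    qed
    show "r ` J = H"
    proof (intro equalityI subsetI)
      fix h assume h: "h \<in> H"
      then have "l h \<in> r ` G" using G(3) H(2) by (auto simp: bij_betw_def)
      then obtain g where "g \<in> G" "l h = r g" by blast
      with h have "pr g h \<in> J" by (simp add: J_def)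
      then show "h \<in> r ` J" by (rule image_eqI[rotated]) simp
    qed (auto simp: J_def)
  qed
  then have "bij_betw (\<lambda>z. r (r z)) J U"
    using bij_betw_trans[OF _ H(3)] by (simp add: comp_def)
  ultimately show ?thesis by (intro eqpI[of J "\<lambda>z. l (l z)" "\<lambda>z. r (r z)"] tf_l tf_r tf_id)
qed

lemma eqp_Un:
  assumes "eqp S S'" "eqp T T'" "S \<inter> T = {}" "S' \<inter> T' = {}"
  shows "eqp (S \<union> T) (S' \<union> T')"
proof -
  obtain G H where G: "G \<in> constructible" "bij_betw l G S" "bij_betw r G S'"
    and H: "H \<in> constructible" "bij_betw l H T" "bij_betw r H T'"
    using assms unfolding eqp_def by blast
  show ?thesis unfolding eqp_def
    by (intro bexI[of _ "G \<union> H"] conjI bij_betw_combine G H assms constructible_Un)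
qed

lemma constructible_times: "S \<in> constructible \<Longrightarrow> T \<in> constructible \<Longrightarrow> times S T \<in> constructible"
  using constructible_Int[OF constructible_vimage[of S l] constructible_vimage[of T r]]
  by (simp add: times_def vimage_def Collect_conj_eq)

lemma bij_betw_times:
  assumes "bij_betw f G S" "bij_betw g H T"
  shows "bij_betw (\<lambda>z. pr (f (l z)) (g (r z))) (times G H) (times S T)"
  unfolding bij_betw_def
proof
  show "inj_on (\<lambda>z. pr (f (l z)) (g (r z))) (times G H)"
  proof (rule inj_onI)
    fix x y assume "x \<in> times G H" "y \<in> times G H"
      "pr (f (l x)) (g (r x)) = pr (f (l y)) (g (r y))"
    then have *: "l x \<in> G" "l y \<in> G" "f (l x) = f (l y)"
      "r x \<in> H" "r y \<in> H" "g (r x) = g (r y)" by (simp_all add: times_def)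
    have "l x = l y" using bij_betw_imp_inj_on[OF assms(1)] *(1-3) by (auto dest: inj_onD)
    moreover have "r x = r y" using bij_betw_imp_inj_on[OF assms(2)] *(4-6) by (auto dest: inj_onD)
    ultimately show "x = y" by (rule pair_eqI)
  qed
  show "(\<lambda>z. pr (f (l z)) (g (r z))) ` times G H = times S T"
  proof (intro equalityI subsetI)
    fix z assume "z \<in> times S T"
    then obtain x y where "x \<in> G" "f x = l z" "y \<in> H" "g y = r z"
      using assms by (force simp: times_def bij_betw_def)
    then show "z \<in> (\<lambda>z. pr (f (l z)) (g (r z))) ` times G H"
      by (intro image_eqI[of _ _ "pr x y"]) (simp_all add: times_def)
  qed (use assms in \<open>auto simp: times_def bij_betw_def\<close>)
qed

lemma eqp_times:
  assumes "eqp S S'" "eqp T T'"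
  shows "eqp (times S T) (times S' T')"
proof -
  obtain G H where G: "G \<in> constructible" "bij_betw l G S" "bij_betw r G S'"
    and H: "H \<in> constructible" "bij_betw l H T" "bij_betw r H T'"
    using assms unfolding eqp_def by blast
  show ?thesis
    by (rule eqpI[OF constructible_times[OF G(1) H(1)] _ _ bij_betw_times[OF G(2) H(2)]
      bij_betw_times[OF G(3) H(3)]]) (intro tf_pr tf_l tf_r tf_id)+
qed

lemma eqp_euler: "eqp S T \<Longrightarrow> euler p S = euler p T"
  unfolding eqp_def bij_betw_def using euler_image[OF _ tf_l'] euler_image[OF _ tf_r'] by metis

lemma closed_eqp_cases:
  assumes "E \<in> closed_sets"
  obtains "E = {}" | c where "E = {c}" | "eqp UNIV E"
  using assms
proof (rule closed_param)
  fix h k assume h: "h \<in> term_fun" "k \<in> term_fun" "\<And>x. k (h x) = x" "E = range h"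
  then have "eqp UNIV E"
    using eqp_image[OF constructible_simps(2) h(1)] inj_on_inverseI[of UNIV k h] by simp
  then show thesis by (rule that(3))
qed (use that in blast)+

section \<open>Quantifier elimination\<close>

text \<open>An arbitrary end marker for codes of lists.\<close>

definition base :: 'a where
  "base = undefined"

text \<open>Pairwise distinct elements that mark the length of a list.\<close>

definition tag :: "nat \<Rightarrow> 'a" where
  "tag n = (l ^^ n) base"

primrec code :: "'a list \<Rightarrow> 'a" where
  "code [] = base"
| "code (x # xs) = pr x (code xs)"

text \<open>The code alone is injective only on lists of one length; with the tag it becomes injective on all
lists, so that the disjoint union of the powers embeds into the universe.\<close>

definition enc :: "'a list \<Rightarrow> 'a" where
  "enc xs = pr (tag (length xs)) (code xs)"

lemma tag_inject [simp]: "tag m = tag n \<longleftrightarrow> m = n"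
  unfolding tag_def using inj_l_funpow[of base] by (auto dest: injD)

lemma code_inject: "length xs = length ys \<Longrightarrow> code xs = code ys \<Longrightarrow> xs = ys"
  by (induction xs ys rule: list_induct2) simp_all

lemma enc_inject [simp]: "enc xs = enc ys \<longleftrightarrow> xs = ys"
  by (auto simp: enc_def dest: code_inject)

lemma inj_enc: "inj_on enc A"
  by (simp add: inj_on_def)

lemma l_enc [simp]: "l (enc xs) = tag (length xs)" and r_enc [simp]: "r (enc xs) = code xs"
  by (simp_all add: enc_def)

lemma tf_r_funpow: "f \<in> term_fun \<Longrightarrow> (\<lambda>x. (r ^^ n) (f x)) \<in> term_fun"
  by (induction n) auto

lemma r_funpow_code_append: "(r ^^ length xs) (code (xs @ ys)) = code ys"
  by (induction xs) (simp_all add: funpow_swap1)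

lemma l_funpow_code: "i < length xs \<Longrightarrow> l ((r ^^ i) (code xs)) = xs ! i"
proof (induction xs arbitrary: i)
  case (Cons x xs)
  then show ?case by (cases i) (simp_all add: funpow_swap1)
qed simp

lemma ex_code: "(r ^^ n) x = base \<Longrightarrow> \<exists>xs. length xs = n \<and> code xs = x"
proof (induction n arbitrary: x)
  case (Suc n)
  then have "(r ^^ n) (r x) = base" by (simp add: funpow_swap1)
  then obtain xs where "length xs = n" "code xs = r x" using Suc.IH by blast
  then show ?case by (intro exI[of _ "l x # xs"]) simp
qed simp

lemma code_lists: "code ` {xs. length xs = n \<and> code xs \<in> S} = {x \<in> S. (r ^^ n) x = base}"
proof (intro equalityI subsetI)
  fix x assume "x \<in> {x \<in> S. (r ^^ n) x = base}"
  with ex_code[of n x] show "x \<in> code ` {xs. length xs = n \<and> code xs \<in> S}" by blast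
next
  fix x assume "x \<in> code ` {xs. length xs = n \<and> code xs \<in> S}"
  then show "x \<in> {x \<in> S. (r ^^ n) x = base}"
    using r_funpow_code_append[of _ "[]"] by auto
qed

lemma tf_pterm_val: "(\<And>i. f i \<in> term_fun) \<Longrightarrow> (\<lambda>x. pterm_val l r (\<lambda>i. f i x) t) \<in> term_fun"
  by (induction t) auto

text \<open>The values of the variables are term functions of one element \<open>x\<close>. To add the witness of
a quantifier one passes to pairs of \<open>x\<close> and the witness, and the quantifier becomes the projection
\<open>l\<close>.\<close>

lemma sat_constructible: "(\<And>i. f i \<in> term_fun) \<Longrightarrow> {x. sat l r (\<lambda>i. f i x) \<phi>} \<in> constructible"
proof (induction \<phi> arbitrary: f)
  case (Eq s t)
  then show ?case by (simp add: constructible_eq tf_pterm_val)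
next
  case (Neg \<phi>)
  then show ?case using constructible_Compl[OF Neg.IH[of f]] by (simp add: Collect_neg_eq)
next
  case (Conj \<phi> \<psi>)
  then show ?case using constructible_Int[OF Conj.IH(1)[of f] Conj.IH(2)[of f]] by (simp add: Collect_conj_eq)
next
  case (Ex i \<phi>)
  define g where "g j = (if j = i then r else (\<lambda>z. f j (l z)))" for j
  have "g j \<in> term_fun" for j
    using tf_comp[OF Ex.prems tf_l'] by (simp add: g_def)
  then have "l ` {z. sat l r (\<lambda>j. g j z) \<phi>} \<in> constructible"
    by (intro constructible_image Ex.IH) auto
  moreover have "l ` {z. sat l r (\<lambda>j. g j z) \<phi>} = {x. sat l r (\<lambda>j. f j x) (Ex i \<phi>)}"
  proof (intro equalityI subsetI)
    fix x assume "x \<in> l ` {z. sat l r (\<lambda>j. g j z) \<phi>}"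
    then obtain z where z: "x = l z" "sat l r (\<lambda>j. g j z) \<phi>" by blast
    have "(\<lambda>j. g j z) = (\<lambda>j. f j x)(i := r z)" by (auto simp: g_def z)
    with z(2) show "x \<in> {x. sat l r (\<lambda>j. f j x) (Ex i \<phi>)}" by auto
  next
    fix x assume "x \<in> {x. sat l r (\<lambda>j. f j x) (Ex i \<phi>)}"
    then obtain y where y: "sat l r ((\<lambda>j. f j x)(i := y)) \<phi>" by auto
    have "(\<lambda>j. g j (pr x y)) = (\<lambda>j. f j x)(i := y)" by (auto simp: g_def)
    with y have "pr x y \<in> {z. sat l r (\<lambda>j. g j z) \<phi>}" by simp
    then show "x \<in> l ` {z. sat l r (\<lambda>j. g j z) \<phi>}" by (rule image_eqI[rotated]) simp
  qed
  ultimately show ?case by simp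
qed

lemma definable_imp_constructible:
  assumes "definable l r n S"
  shows "code ` S \<in> constructible"
proof -
  obtain \<phi> p where S: "S = {xs. length xs = n \<and> sat l r (\<lambda>i. if i < n then xs ! i else p i) \<phi>}"
    using assms unfolding definable_def by blast
  define f where "f i = (if i < n then (\<lambda>x. l ((r ^^ i) x)) else (\<lambda>x. p i))" for i
  have "f i \<in> term_fun" for i
    using tf_l[OF tf_r_funpow[OF tf_id]] by (simp add: f_def)
  then have "{x. sat l r (\<lambda>i. f i x) \<phi>} \<inter> {x. (r ^^ n) x = base} \<in> constructible"
    by (intro constructible_Int sat_constructible constructible_eq tf_r_funpow) auto
  moreover have "(\<lambda>i. f i (code xs)) = (\<lambda>i. if i < n then xs ! i else p i)" if "length xs = n" for xs
    using that by (auto simp: f_def l_funpow_code)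
  then have "S = {xs. length xs = n \<and> code xs \<in> {x. sat l r (\<lambda>i. f i x) \<phi>}}"
    unfolding S by auto
  then have "code ` S = {x. sat l r (\<lambda>i. f i x) \<phi>} \<inter> {x. (r ^^ n) x = base}"
    using code_lists[of n "{x. sat l r (\<lambda>i. f i x) \<phi>}"] by auto
  ultimately show ?thesis by simp
qed

primrec rename_term :: "(nat \<Rightarrow> nat) \<Rightarrow> pterm \<Rightarrow> pterm" where
  "rename_term \<rho> (Var i) = Var (\<rho> i)"
| "rename_term \<rho> (L t) = L (rename_term \<rho> t)"
| "rename_term \<rho> (R t) = R (rename_term \<rho> t)"

primrec rename_form :: "(nat \<Rightarrow> nat) \<Rightarrow> pform \<Rightarrow> pform" where
  "rename_form \<rho> (Eq s t) = Eq (rename_term \<rho> s) (rename_term \<rho> t)"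
| "rename_form \<rho> (Neg \<phi>) = Neg (rename_form \<rho> \<phi>)"
| "rename_form \<rho> (Conj \<phi> \<psi>) = Conj (rename_form \<rho> \<phi>) (rename_form \<rho> \<psi>)"
| "rename_form \<rho> (Ex i \<phi>) = Ex (\<rho> i) (rename_form \<rho> \<phi>)"

lemma pterm_val_rename: "pterm_val l r e (rename_term \<rho> t) = pterm_val l r (\<lambda>i. e (\<rho> i)) t"
  by (induction t) simp_all

lemma sat_rename:
  assumes "inj \<rho>"
  shows "sat l r e (rename_form \<rho> \<phi>) = sat l r (\<lambda>i. e (\<rho> i)) \<phi>"
proof (induction \<phi> arbitrary: e)
  case (Ex i \<phi>)
  have "(\<lambda>j. (e(\<rho> i := x)) (\<rho> j)) = (\<lambda>j. e (\<rho> j))(i := x)" for x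
    using assms by (auto simp: fun_eq_iff dest: injD)
  then show ?case by (simp add: Ex.IH)
qed (simp_all add: pterm_val_rename)

text \<open>Two formulas may use different parameters for the same variable. The coordinates below \<open>n\<close> are kept,
and the parameter variables of the first formula are moved to even distance from \<open>n\<close>, those of the
second to odd distance, where the merged assignment provides both.\<close>

definition left_var :: "nat \<Rightarrow> nat \<Rightarrow> nat" where
  "left_var n i = (if i < n then i else n + 2 * (i - n))"

definition right_var :: "nat \<Rightarrow> nat \<Rightarrow> nat" where
  "right_var n i = (if i < n then i else Suc (n + 2 * (i - n)))"

definition merge :: "nat \<Rightarrow> (nat \<Rightarrow> 'a) \<Rightarrow> (nat \<Rightarrow> 'a) \<Rightarrow> nat \<Rightarrow> 'a" where
  "merge n p q j = (if even (j - n) then p else q) (n + (j - n) div 2)"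

lemma inj_left_var: "inj (left_var n)" and inj_right_var: "inj (right_var n)"
  by (auto simp: inj_on_def left_var_def right_var_def split: if_splits)

lemma merge_left:
  "(if left_var n i < n then v (left_var n i) else merge n p q (left_var n i)) =
    (if i < n then v i else p i)"
  by (simp add: left_var_def merge_def)

lemma merge_right:
  "(if right_var n i < n then v (right_var n i) else merge n p q (right_var n i)) =
    (if i < n then v i else q i)"
  by (simp add: right_var_def merge_def)

lemma definable_Int:
  assumes "definable l r n S" "definable l r n T"
  shows "definable l r n (S \<inter> T)"
proof -
  obtain \<phi> p where S: "S = {xs. length xs = n \<and> sat l r (\<lambda>i. if i < n then xs ! i else p i) \<phi>}"
    using assms(1) unfolding definable_def by blast
  obtain \<psi> q where T: "T = {xs. length xs = n \<and> sat l r (\<lambda>i. if i < n then xs ! i else q i) \<psi>}"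
    using assms(2) unfolding definable_def by blast
  have "S \<inter> T = {xs. length xs = n \<and>
      sat l r (\<lambda>i. if i < n then xs ! i else merge n p q i)
        (Conj (rename_form (left_var n) \<phi>) (rename_form (right_var n) \<psi>))}"
    unfolding S T
    by (auto simp: sat_rename[OF inj_left_var] sat_rename[OF inj_right_var] merge_left merge_right)
  then show ?thesis unfolding definable_def by blast
qed

lemma definable_Compl:
  assumes "definable l r n S"
  shows "definable l r n ({xs. length xs = n} - S)"
proof -
  obtain \<phi> p where S: "S = {xs. length xs = n \<and> sat l r (\<lambda>i. if i < n then xs ! i else p i) \<phi>}"
    using assms unfolding definable_def by blast
  have "{xs. length xs = n} - S =
      {xs. length xs = n \<and> sat l r (\<lambda>i. if i < n then xs ! i else p i) (Neg \<phi>)}"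
    unfolding S by auto
  then show ?thesis unfolding definable_def by blast
qed

text \<open>Pairing is not part of the language. A term function on coded lists is a tree whose leaves are terms
of the language, and an equation between such trees is equivalent to finitely many equations between
leaves.\<close>

inductive_set tree_fun :: "nat \<Rightarrow> ('a list \<Rightarrow> 'a) set" for n where
  leaf: "(\<lambda>xs. pterm_val l r (\<lambda>i. if i < n then xs ! i else p i) t) \<in> tree_fun n"
| node: "f \<in> tree_fun n \<Longrightarrow> g \<in> tree_fun n \<Longrightarrow> (\<lambda>xs. pr (f xs) (g xs)) \<in> tree_fun n"

lemma tree_fun_const: "(\<lambda>xs. c) \<in> tree_fun n"
  using leaf[of n "\<lambda>i. c" "Var n"] by simp

lemma tree_fun_nth: "i < n \<Longrightarrow> (\<lambda>xs. xs ! i) \<in> tree_fun n"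
  using leaf[of n undefined "Var i"] by simp

lemma tree_fun_proj: "f \<in> tree_fun n \<Longrightarrow> (\<lambda>xs. l (f xs)) \<in> tree_fun n \<and> (\<lambda>xs. r (f xs)) \<in> tree_fun n"
proof (induction rule: tree_fun.induct)
  case (leaf p t)
  show ?case using tree_fun.leaf[of n p "L t"] tree_fun.leaf[of n p "R t"] by simp
qed simp

lemma tree_fun_code:
  "k \<le> n \<Longrightarrow> \<exists>c\<in>tree_fun n. \<forall>xs. length xs = n \<longrightarrow> c xs = code (drop k xs)"
proof (induction k rule: inc_induct)
  case base
  show ?case by (rule bexI[OF _ tree_fun_const[of base]]) simp
next
  case (step k)
  then obtain c where c: "c \<in> tree_fun n" "\<forall>xs. length xs = n \<longrightarrow> c xs = code (drop (Suc k) xs)"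
    by blast
  have "(\<lambda>xs. pr (xs ! k) (c xs)) \<in> tree_fun n"
    using step.hyps c(1) by (intro node tree_fun_nth)
  moreover have "pr (xs ! k) (c xs) = code (drop k xs)" if "length xs = n" for xs
    using that step.hyps c(2) by (simp flip: Cons_nth_drop_Suc)
  ultimately show ?case by (intro bexI[of _ "\<lambda>xs. pr (xs ! k) (c xs)"] allI impI)
qed

lemma term_fun_tree_fun:
  "f \<in> term_fun \<Longrightarrow> \<exists>c\<in>tree_fun n. \<forall>xs. length xs = n \<longrightarrow> c xs = f (code xs)"
proof (induction rule: term_fun.induct)
  case tf_id
  show ?case using tree_fun_code[of 0 n] by simp
next
  case (tf_const c)
  show ?case by (rule bexI[OF _ tree_fun_const[of c]]) simp
next
  case (tf_l f)
  then obtain c where "c \<in> tree_fun n" "\<forall>xs. length xs = n \<longrightarrow> c xs = f (code xs)" by blast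
  then show ?case using tree_fun_proj by (intro bexI[of _ "\<lambda>xs. l (c xs)"]) auto
next
  case (tf_r f)
  then obtain c where "c \<in> tree_fun n" "\<forall>xs. length xs = n \<longrightarrow> c xs = f (code xs)" by blast
  then show ?case using tree_fun_proj by (intro bexI[of _ "\<lambda>xs. r (c xs)"]) auto
next
  case (tf_pr f g)
  then obtain c d where "c \<in> tree_fun n" "\<forall>xs. length xs = n \<longrightarrow> c xs = f (code xs)"
    "d \<in> tree_fun n" "\<forall>xs. length xs = n \<longrightarrow> d xs = g (code xs)" by blast
  then show ?case by (intro bexI[of _ "\<lambda>xs. pr (c xs) (d xs)"] node) auto
qed

lemma definable_leaf_eq:
  "definable l r n {xs. length xs = n \<and>
    pterm_val l r (\<lambda>i. if i < n then xs ! i else p i) t =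
    pterm_val l r (\<lambda>i. if i < n then xs ! i else q i) u}"
proof -
  show ?thesis
    unfolding definable_def
    by (intro exI[of _ "Eq (rename_term (left_var n) t) (rename_term (right_var n) u)"]
        exI[of _ "merge n p q"])
      (simp add: pterm_val_rename merge_left merge_right)
qed

lemma definable_pair_eq:
  assumes "definable l r n {xs. length xs = n \<and> f1 xs = l (g xs)}"
    "definable l r n {xs. length xs = n \<and> f2 xs = r (g xs)}"
  shows "definable l r n {xs. length xs = n \<and> pr (f1 xs) (f2 xs) = g xs}"
proof -
  have "{xs. length xs = n \<and> pr (f1 xs) (f2 xs) = g xs} =
    {xs. length xs = n \<and> f1 xs = l (g xs)} \<inter> {xs. length xs = n \<and> f2 xs = r (g xs)}"
    by (auto simp: pair_eq_iff[of "pr _ _"])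
  then show ?thesis using definable_Int[OF assms] by simp
qed

lemma definable_tree_eq:
  assumes "f \<in> tree_fun n" "g \<in> tree_fun n"
  shows "definable l r n {xs. length xs = n \<and> f xs = g xs}"
  using assms
proof (induction arbitrary: g rule: tree_fun.induct)
  case (leaf p t)
  have "definable l r n {xs. length xs = n \<and>
      g xs = pterm_val l r (\<lambda>i. if i < n then xs ! i else p i) t}"
    using leaf
  proof (induction arbitrary: p t rule: tree_fun.induct)
    case (leaf q u)
    show ?case by (rule definable_leaf_eq)
  next
    case (node f g)
    show ?case
      using node.IH(1)[of p "L t"] node.IH(2)[of p "R t"] by (intro definable_pair_eq) simp_all
  qed
  then show ?case by (simp add: eq_commute)
next
  case (node f1 f2)
  show ?case
    by (intro definable_pair_eq node.IH) (use tree_fun_proj[OF node.prems] in auto)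
qed

text \<open>An equation between term functions unfolds to equations between terms of the language.\<close>

lemma constructible_imp_definable: "S \<in> constructible \<Longrightarrow> definable l r n {xs. length xs = n \<and> code xs \<in> S}"
proof (induction rule: constructible.induct)
  case (constructible_closed E)
  then obtain f g where fg: "f \<in> term_fun" "g \<in> term_fun" "E = {x. f x = g x}" by (rule closedE)
  obtain c where c: "c \<in> tree_fun n" "\<forall>xs. length xs = n \<longrightarrow> c xs = f (code xs)"
    using term_fun_tree_fun[OF fg(1)] by blast
  obtain d where d: "d \<in> tree_fun n" "\<forall>xs. length xs = n \<longrightarrow> d xs = g (code xs)"
    using term_fun_tree_fun[OF fg(2)] by blast
  have "{xs. length xs = n \<and> code xs \<in> E} = {xs. length xs = n \<and> c xs = d xs}"
    using c d fg(3) by auto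
  then show ?case using definable_tree_eq[OF c(1) d(1)] by simp
next
  case (constructible_Compl S)
  have "{xs. length xs = n \<and> code xs \<in> - S} =
      {xs. length xs = n} - {xs. length xs = n \<and> code xs \<in> S}" by auto
  then show ?case using definable_Compl[OF constructible_Compl.IH] by simp
next
  case (constructible_Int S T)
  have "{xs. length xs = n \<and> code xs \<in> S \<inter> T} =
      {xs. length xs = n \<and> code xs \<in> S} \<inter> {xs. length xs = n \<and> code xs \<in> T}" by auto
  then show ?case using definable_Int[OF constructible_Int.IH] by simp
qed

lemma definable_iff_constructible:
  assumes "\<And>xs. xs \<in> S \<Longrightarrow> length xs = n"
  shows "definable l r n S \<longleftrightarrow> code ` S \<in> constructible"
proof
  assume "code ` S \<in> constructible"
  then have "definable l r n {xs. length xs = n \<and> code xs \<in> code ` S}"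
    by (rule constructible_imp_definable)
  moreover have "{xs. length xs = n \<and> code xs \<in> code ` S} = S"
    using assms by (auto, metis code_inject)
  ultimately show "definable l r n S" by simp
qed (rule definable_imp_constructible)

section \<open>Definable sets and bijections through codes\<close>

lemma Def_iff: "A \<in> Def l r \<longleftrightarrow> finite (length ` A) \<and> enc ` A \<in> constructible"
proof -
  have slice: "code ` {xs \<in> A. length xs = n} = r ` (enc ` A \<inter> {z. l z = tag n})" for n
  proof -
    have "enc ` A \<inter> {z. l z = tag n} = enc ` {xs \<in> A. length xs = n}" by auto
    then show ?thesis by (simp add: image_image)
  qed
  have "enc ` A \<in> constructible \<longleftrightarrow> (\<forall>n. code ` {xs \<in> A. length xs = n} \<in> constructible)"
    if fin: "finite (length ` A)"
  proof
    assume "enc ` A \<in> constructible"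
    then show "\<forall>n. code ` {xs \<in> A. length xs = n} \<in> constructible"
      unfolding slice by (intro allI constructible_image constructible_Int constructible_eq) auto
  next
    assume *: "\<forall>n. code ` {xs \<in> A. length xs = n} \<in> constructible"
    have "enc ` A = (\<Union>n\<in>length ` A. (\<lambda>x. pr (tag n) x) ` code ` {xs \<in> A. length xs = n})"
    proof -
      have "pr (tag n) ` code ` {xs \<in> A. length xs = n} = enc ` {xs \<in> A. length xs = n}" for n
        by (auto simp: image_image enc_def)
      then show ?thesis by auto
    qed
    also have "\<dots> \<in> constructible"
      using fin * by (intro constructible_Union) (auto intro!: constructible_image tf_pr)
    finally show "enc ` A \<in> constructible" .
  qed
  moreover have "definable l r n {xs \<in> A. length xs = n} \<longleftrightarrow>
      code ` {xs \<in> A. length xs = n} \<in> constructible" for n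
    by (rule definable_iff_constructible) simp
  ultimately show ?thesis by (auto simp: Def_def)
qed

primrec code_append :: "nat \<Rightarrow> 'a \<Rightarrow> 'a \<Rightarrow> 'a" where
  "code_append 0 x y = y"
| "code_append (Suc n) x y = pr (l x) (code_append n (r x) y)"

primrec code_take :: "nat \<Rightarrow> 'a \<Rightarrow> 'a" where
  "code_take 0 x = base"
| "code_take (Suc n) x = pr (l x) (code_take n (r x))"

lemma code_append: "code_append (length xs) (code xs) (code ys) = code (xs @ ys)"
  by (induction xs) simp_all

lemma code_take: "code_take (length xs) (code (xs @ ys)) = code xs"
  by (induction xs) simp_all

lemma tf_code_append:
  "f \<in> term_fun \<Longrightarrow> g \<in> term_fun \<Longrightarrow> (\<lambda>x. code_append n (f x) (g x)) \<in> term_fun"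
  by (induction n arbitrary: f) (simp_all add: tf_pr tf_l tf_r)

lemma tf_code_take: "f \<in> term_fun \<Longrightarrow> (\<lambda>x. code_take n (f x)) \<in> term_fun"
  by (induction n arbitrary: f) (simp_all add: tf_pr tf_l tf_r)

definition enc3 :: "'a list \<Rightarrow> 'a list \<Rightarrow> 'a list \<Rightarrow> 'a" where
  "enc3 xs ys zs = pr (pr (enc xs) (enc ys)) (enc zs)"

text \<open>Between the code of a concatenation and the encodings of its parts there are term functions in both
directions, depending only on the lengths; the finitely many triples of lengths are treated
separately.\<close>

lemma definable_concat3:
  assumes fin: "finite (length ` u ` T)" "finite (length ` v ` T)" "finite (length ` w ` T)"
  shows "(\<forall>n m k. definable l r (n + m + k)
      {u t @ v t @ w t |t. t \<in> T \<and> length (u t) = n \<and> length (v t) = m \<and> length (w t) = k}) \<longleftrightarrow>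
    (\<lambda>t. enc3 (u t) (v t) (w t)) ` T \<in> constructible"
proof -
  define part where "part n m k = {t \<in> T. length (u t) = n \<and> length (v t) = m \<and> length (w t) = k}"
    for n m k
  have "definable l r (n + m + k)
      {u t @ v t @ w t |t. t \<in> T \<and> length (u t) = n \<and> length (v t) = m \<and> length (w t) = k} \<longleftrightarrow>
    (\<lambda>t. code (u t @ v t @ w t)) ` part n m k \<in> constructible" for n m k
  proof -
    have "{u t @ v t @ w t |t. t \<in> T \<and> length (u t) = n \<and> length (v t) = m \<and> length (w t) = k} =
      (\<lambda>t. u t @ v t @ w t) ` part n m k" by (auto simp: part_def)
    then show ?thesis
      by (subst definable_iff_constructible) (auto simp: image_image part_def)
  qed
  moreover have "(\<lambda>t. code (u t @ v t @ w t)) ` part n m k \<in> constructible"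
    if "(\<lambda>t. enc3 (u t) (v t) (w t)) ` T \<in> constructible" for n m k
  proof -
    let ?j = "\<lambda>z. code_append n (r (l (l z))) (code_append m (r (r (l z))) (r (r z)))"
    \<comment> \<open>The part of the encoded graph with the given lengths is cut out by the tags.\<close>
    let ?P = "(\<lambda>t. enc3 (u t) (v t) (w t)) ` T \<inter>
      ({z. l (l (l z)) = tag n} \<inter> {z. l (r (l z)) = tag m} \<inter> {z. l (r z) = tag k})"
    have "?P = (\<lambda>t. enc3 (u t) (v t) (w t)) ` part n m k"
      by (auto simp: enc3_def part_def)
    moreover have "?P \<in> constructible"
      using that by (intro constructible_Int constructible_eq tf_l tf_r tf_id tf_const)
    moreover have "?j \<in> term_fun" by (intro tf_code_append tf_l tf_r tf_id)
    ultimately have "?j ` (\<lambda>t. enc3 (u t) (v t) (w t)) ` part n m k \<in> constructible"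
      using constructible_image by metis
    moreover have "?j (enc3 (u t) (v t) (w t)) = code (u t @ v t @ w t)" if "t \<in> part n m k" for t
      using that by (auto simp: enc3_def part_def code_append)
    ultimately show ?thesis by (simp add: image_image cong: image_cong)
  qed
  moreover have "(\<lambda>t. enc3 (u t) (v t) (w t)) ` T \<in> constructible"
    if c: "\<forall>n m k. (\<lambda>t. code (u t @ v t @ w t)) ` part n m k \<in> constructible"
  proof -
    have part: "(\<lambda>t. enc3 (u t) (v t) (w t)) ` part n m k \<in> constructible" for n m k
    proof -
      let ?j = "\<lambda>y. pr (pr (pr (tag n) (code_take n y)) (pr (tag m) (code_take m ((r ^^ n) y))))
        (pr (tag k) ((r ^^ m) ((r ^^ n) y)))"
      have j: "?j \<in> term_fun" by (intro tf_pr tf_const tf_code_take tf_r_funpow tf_id)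
      have "?j ` (\<lambda>t. code (u t @ v t @ w t)) ` part n m k \<in> constructible"
        by (rule constructible_image[OF c[rule_format] j])
      moreover have "?j (code (u t @ v t @ w t)) = enc3 (u t) (v t) (w t)" if "t \<in> part n m k" for t
        using that by (auto simp: enc3_def enc_def part_def code_take r_funpow_code_append)
      ultimately show ?thesis by (simp add: image_image cong: image_cong)
    qed
    have "(\<lambda>t. enc3 (u t) (v t) (w t)) ` T =
      (\<Union>n\<in>length ` u ` T. \<Union>m\<in>length ` v ` T. \<Union>k\<in>length ` w ` T.
        (\<lambda>t. enc3 (u t) (v t) (w t)) ` part n m k)"
      by (auto simp: part_def)
    also have "\<dots> \<in> constructible"
      by (intro constructible_UN fin part)
    finally show ?thesis .
  qed
  ultimately show ?thesis by blast
qed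

text \<open>The ternary case with the empty list as first part.\<close>

lemma definable_concat2:
  assumes fin: "finite (length ` v ` T)" "finite (length ` w ` T)"
  shows "(\<forall>n m. definable l r (n + m)
      {v t @ w t |t. t \<in> T \<and> length (v t) = n \<and> length (w t) = m}) \<longleftrightarrow>
    (\<lambda>t. pr (enc (v t)) (enc (w t))) ` T \<in> constructible"
proof -
  have empty: "definable l r n {}" for n
    by (subst definable_iff_constructible) auto
  have "(\<forall>n m. definable l r (n + m)
      {v t @ w t |t. t \<in> T \<and> length (v t) = n \<and> length (w t) = m}) \<longleftrightarrow>
    (\<forall>i n m. definable l r (i + n + m)
      {[] @ v t @ w t |t. t \<in> T \<and> length ([] :: 'a list) = i \<and> length (v t) = n \<and> length (w t) = m})"
    (is "?A \<longleftrightarrow> ?B")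
  proof
    assume A: ?A
    show ?B
    proof (intro allI)
      fix i n m
      show "definable l r (i + n + m)
        {[] @ v t @ w t |t. t \<in> T \<and> length ([] :: 'a list) = i \<and> length (v t) = n \<and> length (w t) = m}"
        using A empty by (cases i) simp_all
    qed
  next
    assume B: ?B
    show ?A
    proof (intro allI)
      fix n m
      show "definable l r (n + m) {v t @ w t |t. t \<in> T \<and> length (v t) = n \<and> length (w t) = m}"
        using B[rule_format, of 0 n m] by simp
    qed
  qed
  also have "\<dots> \<longleftrightarrow> (\<lambda>t. enc3 [] (v t) (w t)) ` T \<in> constructible"
    by (rule definable_concat3) (use fin in \<open>auto intro: finite_subset[of _ "{0}"]\<close>)
  also have "\<dots> \<longleftrightarrow> (\<lambda>t. pr (enc (v t)) (enc (w t))) ` T \<in> constructible"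
  proof
    assume "(\<lambda>t. enc3 [] (v t) (w t)) ` T \<in> constructible"
    then have "(\<lambda>z. pr (r (l z)) (r z)) ` (\<lambda>t. enc3 [] (v t) (w t)) ` T \<in> constructible"
      by (rule constructible_image) (intro tf_pr tf_l tf_r tf_id)
    then show "(\<lambda>t. pr (enc (v t)) (enc (w t))) ` T \<in> constructible"
      by (simp add: image_image enc3_def)
  next
    assume "(\<lambda>t. pr (enc (v t)) (enc (w t))) ` T \<in> constructible"
    then have "(\<lambda>z. pr (pr (enc []) (l z)) (r z)) ` (\<lambda>t. pr (enc (v t)) (enc (w t))) ` T \<in> constructible"
      by (rule constructible_image) (intro tf_pr tf_l tf_r tf_id tf_const)
    then show "(\<lambda>t. enc3 [] (v t) (w t)) ` T \<in> constructible"
      by (simp add: image_image enc3_def)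
  qed
  finally show ?thesis .
qed

text \<open>A map into lists and its graph determine each other. The domain may be any set with an injective
encoding \<open>e\<close>, so that bijections from sets of lists and from products are treated alike.\<close>

lemma ex_bij_iff_eqp:
  assumes "inj_on e T"
  shows "(\<exists>f. bij_betw f T B \<and> (\<lambda>t. pr (e t) (enc (f t))) ` T \<in> constructible) \<longleftrightarrow>
    eqp (e ` T) (enc ` B)"
proof
  assume "\<exists>f. bij_betw f T B \<and> (\<lambda>t. pr (e t) (enc (f t))) ` T \<in> constructible"
  then obtain f where f: "bij_betw f T B" "(\<lambda>t. pr (e t) (enc (f t))) ` T \<in> constructible" by blast
  have "bij_betw l ((\<lambda>t. pr (e t) (enc (f t))) ` T) (e ` T)"
    by (rule bij_betw_image_iff) (use assms in \<open>simp add: bij_betw_def\<close>)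
  moreover have "bij_betw r ((\<lambda>t. pr (e t) (enc (f t))) ` T) (enc ` B)"
  proof (rule bij_betw_image_iff)
    have "bij_betw (\<lambda>t. enc (f t)) T (enc ` B)"
      using f(1) by (auto simp: bij_betw_def inj_on_def)
    then show "bij_betw (\<lambda>t. r (pr (e t) (enc (f t)))) T (enc ` B)" by simp
  qed
  ultimately show "eqp (e ` T) (enc ` B)" using f(2) unfolding eqp_def by blast
next
  assume "eqp (e ` T) (enc ` B)"
  then obtain G where G: "G \<in> constructible" "bij_betw l G (e ` T)" "bij_betw r G (enc ` B)"
    unfolding eqp_def by blast
  define g where "g t = inv_into G l (e t)" for t
  have "bij_betw (inv_into G l \<circ> e) T G"
    by (rule bij_betw_trans[OF _ bij_betw_inv_into[OF G(2)]]) (use assms in \<open>simp add: bij_betw_def\<close>)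
  then have g: "bij_betw g T G" by (simp add: g_def[abs_def] comp_def)
  have lg: "l (g t) = e t" if "t \<in> T" for t
    using that G(2) unfolding g_def by (intro bij_betw_inv_into_right) auto
  define f where "f t = inv_into B enc (r (g t))" for t
  have "bij_betw enc B (enc ` B)" by (simp add: bij_betw_def inj_enc)
  note enc_inv = bij_betw_inv_into[OF this]
  have "bij_betw (inv_into B enc \<circ> (r \<circ> g)) T B"
    by (rule bij_betw_trans[OF bij_betw_trans[OF g G(3)] enc_inv])
  then have "bij_betw f T B" by (simp add: f_def[abs_def] comp_def)
  moreover have "pr (e t) (enc (f t)) = g t" if "t \<in> T" for t
  proof -
    have "r (g t) \<in> enc ` B" using that g G(3) by (auto simp: bij_betw_def)
    then have "enc (f t) = r (g t)" unfolding f_def by (rule f_inv_into_f)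
    with lg[OF that, symmetric] show ?thesis by simp
  qed
  then have "(\<lambda>t. pr (e t) (enc (f t))) ` T = G"
    using g by (simp add: bij_betw_def cong: image_cong)
  ultimately show "\<exists>f. bij_betw f T B \<and> (\<lambda>t. pr (e t) (enc (f t))) ` T \<in> constructible"
    using G(1) by (intro exI[of _ f]) simp
qed

lemma finite_lengths: "A \<in> Def l r \<Longrightarrow> finite (length ` A)"
  by (simp add: Def_def)

lemma def_equiv_iff:
  "(A, B) \<in> def_equiv l r \<longleftrightarrow> A \<in> Def l r \<and> B \<in> Def l r \<and> eqp (enc ` A) (enc ` B)"
proof -
  have "definable_bij l r f A B \<longleftrightarrow>
      bij_betw f A B \<and> (\<lambda>t. pr (enc t) (enc (f t))) ` A \<in> constructible"
    if "A \<in> Def l r" "B \<in> Def l r" for f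
  proof (cases "bij_betw f A B")
    case True
    then have "finite (length ` f ` A)" using finite_lengths[OF that(2)] by (simp add: bij_betw_def)
    with finite_lengths[OF that(1)] show ?thesis
      unfolding definable_bij_def
      using definable_concat2[of "\<lambda>t. t" A f] by simp
  qed (simp add: definable_bij_def)
  then show ?thesis
    using ex_bij_iff_eqp[OF inj_enc, of A B] by (auto simp: def_equiv_def)
qed

lemma prod_bij_iff:
  assumes "A \<in> Def l r" "B \<in> Def l r" "C \<in> Def l r"
  shows "(\<exists>f. definable_prod_bij l r f A B C) \<longleftrightarrow> eqp (times (enc ` A) (enc ` B)) (enc ` C)"
proof -
  let ?e = "\<lambda>t. pr (enc (fst t)) (enc (snd t))"
  have "definable_prod_bij l r f A B C \<longleftrightarrow>
      bij_betw f (A \<times> B) C \<and> (\<lambda>t. pr (?e t) (enc (f t))) ` (A \<times> B) \<in> constructible" for f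
  proof (cases "bij_betw f (A \<times> B) C")
    case True
    then have fin: "finite (length ` f ` (A \<times> B))"
      using finite_lengths[OF assms(3)] by (simp add: bij_betw_def)
    have "{xs @ ys @ f (xs, ys) |xs ys. xs \<in> A \<and> ys \<in> B \<and> length xs = n \<and> length ys = m \<and>
        length (f (xs, ys)) = k} =
      {fst t @ snd t @ f t |t. t \<in> A \<times> B \<and> length (fst t) = n \<and> length (snd t) = m \<and>
        length (f t) = k}" for n m k by auto
    moreover have "finite (length ` fst ` (A \<times> B))" "finite (length ` snd ` (A \<times> B))"
      using finite_lengths[OF assms(1)] finite_lengths[OF assms(2)]
      by (auto intro: finite_subset)
    ultimately show ?thesis
      unfolding definable_prod_bij_def
      using definable_concat3[of fst "A \<times> B" snd f] fin True by (simp add: enc3_def)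
  qed (simp add: definable_prod_bij_def)
  moreover have "inj_on ?e (A \<times> B)" by (auto simp: inj_on_def)
  moreover have "?e ` (A \<times> B) = times (enc ` A) (enc ` B)"
  proof (intro equalityI subsetI)
    fix z assume "z \<in> times (enc ` A) (enc ` B)"
    then obtain xs ys where "xs \<in> A" "ys \<in> B" "l z = enc xs" "r z = enc ys"
      by (auto simp: times_def)
    then show "z \<in> ?e ` (A \<times> B)"
      by (intro image_eqI[of _ _ "(xs, ys)"]) (auto simp: pair_eq_iff[of z])
  qed (auto simp: times_def)
  ultimately show ?thesis using ex_bij_iff_eqp[of ?e "A \<times> B" C] by simp
qed

section \<open>The semiring of definable sets\<close>

text \<open>A copy of \<open>S\<close> inside the power with exponent \<open>k + 1\<close>; different \<open>k\<close> give disjoint copies.\<close>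

definition lift :: "nat \<Rightarrow> 'a set \<Rightarrow> 'a list set" where
  "lift k S = (\<lambda>x. x # replicate k base) ` S"

text \<open>Classes are indexed by constructible subsets of the universe, which need not be encodings of sets of
lists. So sums and products of classes can be formed inside the universe.\<close>

definition cl :: "'a set \<Rightarrow> 'a list set set" where
  "cl S = {B \<in> Def l r. eqp S (enc ` B)}"

abbreviation "DS \<equiv> Def_semiring l r"

lemma enc_constructible: "A \<in> Def l r \<Longrightarrow> enc ` A \<in> constructible"
  by (simp add: Def_iff)

lemma eqp_lift:
  assumes "S \<in> constructible"
  shows "eqp S (enc ` lift k S)"
proof -
  let ?f = "\<lambda>x. pr (tag (Suc k)) (pr x (code (replicate k base)))"
  have "eqp S (?f ` S)"
    using assms by (intro eqp_image tf_pr tf_const tf_id) (auto simp: inj_on_def)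
  moreover have "enc ` lift k S = ?f ` S"
    by (simp add: lift_def image_image enc_def)
  ultimately show ?thesis by simp
qed

lemma lift_Def: "S \<in> constructible \<Longrightarrow> lift k S \<in> Def l r"
  unfolding Def_iff
proof
  show "finite (length ` lift k S)"
    by (rule finite_subset[of _ "{Suc k}"]) (auto simp: lift_def)
qed (use eqp_constructible[OF eqp_lift] in blast)

lemma lift_in_cl: "S \<in> constructible \<Longrightarrow> lift k S \<in> cl S"
  by (simp add: cl_def lift_Def eqp_lift)

lemma cl_eq_iff:
  assumes "S \<in> constructible" "T \<in> constructible"
  shows "cl S = cl T \<longleftrightarrow> eqp S T"
proof
  assume "cl S = cl T"
  then have "lift 0 S \<in> cl T" using lift_in_cl[OF assms(1)] by blast
  then have "eqp T (enc ` lift 0 S)" by (simp add: cl_def)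
  from eqp_trans[OF eqp_lift[OF assms(1)] eqp_sym[OF this]] show "eqp S T" .
next
  assume "eqp S T"
  then show "cl S = cl T" unfolding cl_def using eqp_trans eqp_sym by blast
qed

lemma def_class_cl: "A \<in> Def l r \<Longrightarrow> def_class l r A = cl (enc ` A)"
  by (auto simp: def_class_def def_equiv_iff cl_def)

lemma carrier_DS: "carrier DS = cl ` constructible"
proof -
  have "carrier DS = (\<lambda>A. def_class l r A) ` Def l r"
    by (auto simp: Def_semiring_def quotient_def def_class_def)
  also have "\<dots> = cl ` constructible"
  proof (intro equalityI subsetI)
    fix a assume "a \<in> def_class l r ` Def l r"
    then show "a \<in> cl ` constructible" using def_class_cl enc_constructible by blast
  next
    fix a assume "a \<in> cl ` constructible"
    then obtain S where S: "S \<in> constructible" "a = cl S" by blast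
    then have "a = def_class l r (lift 0 S)"
      by (simp add: def_class_cl lift_Def enc_constructible cl_eq_iff eqp_lift)
    then show "a \<in> def_class l r ` Def l r" using lift_Def[OF S(1)] by blast
  qed
  finally show ?thesis .
qed

lemma Def_Un: "A \<in> Def l r \<Longrightarrow> B \<in> Def l r \<Longrightarrow> A \<union> B \<in> Def l r"
  by (simp add: Def_iff image_Un constructible_Un)

lemma cl_closed: "S \<in> constructible \<Longrightarrow> cl S \<in> carrier DS"
  by (simp add: carrier_DS)

lemma add_cl:
  assumes "S \<in> constructible" "T \<in> constructible" "S \<inter> T = {}"
  shows "cl S \<oplus>\<^bsub>DS\<^esub> cl T = cl (S \<union> T)"
proof -
  have *: "def_class l r (A \<union> B) = cl (S \<union> T)" if "A \<in> cl S" "B \<in> cl T" "A \<inter> B = {}" for A B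
  proof -
    have AB: "A \<in> Def l r" "B \<in> Def l r" "eqp S (enc ` A)" "eqp T (enc ` B)"
      using that by (auto simp: cl_def)
    have "enc ` A \<inter> enc ` B = {}" using that(3) by auto
    then have "eqp (S \<union> T) (enc ` (A \<union> B))"
      unfolding image_Un by (rule eqp_Un[OF AB(3,4) assms(3)])
    then have "cl (S \<union> T) = cl (enc ` (A \<union> B))"
      using cl_eq_iff eqp_constructible by blast
    with def_class_cl[OF Def_Un[OF AB(1,2)]] show ?thesis by simp
  qed
  have disj: "lift 0 S \<inter> lift 1 T = {}" by (auto simp: lift_def)
  have "cl S \<oplus>\<^bsub>DS\<^esub> cl T =
      {C. \<exists>A\<in>cl S. \<exists>B\<in>cl T. A \<inter> B = {} \<and> C \<in> def_class l r (A \<union> B)}"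
    by (simp add: Def_semiring_def)
  also have "\<dots> = cl (S \<union> T)"
  proof (intro equalityI subsetI)
    fix C assume "C \<in> cl (S \<union> T)"
    then have "C \<in> def_class l r (lift 0 S \<union> lift 1 T)"
      using *[OF lift_in_cl lift_in_cl disj] assms by simp
    then show "C \<in> {C. \<exists>A\<in>cl S. \<exists>B\<in>cl T. A \<inter> B = {} \<and> C \<in> def_class l r (A \<union> B)}"
      using lift_in_cl assms disj by blast
  qed (use * in blast)
  finally show ?thesis .
qed

lemma mult_cl:
  assumes "S \<in> constructible" "T \<in> constructible"
  shows "cl S \<otimes>\<^bsub>DS\<^esub> cl T = cl (times S T)"
proof -
  have "cl S \<otimes>\<^bsub>DS\<^esub> cl T =
      {C \<in> Def l r. \<exists>A\<in>cl S. \<exists>B\<in>cl T. \<exists>f. definable_prod_bij l r f A B C}"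
    by (simp add: Def_semiring_def)
  also have "\<dots> = cl (times S T)"
  proof (intro equalityI subsetI)
    fix C assume "C \<in> {C \<in> Def l r. \<exists>A\<in>cl S. \<exists>B\<in>cl T. \<exists>f. definable_prod_bij l r f A B C}"
    then obtain A B where *: "C \<in> Def l r" "A \<in> cl S" "B \<in> cl T" "\<exists>f. definable_prod_bij l r f A B C"
      by blast
    then have AB: "A \<in> Def l r" "B \<in> Def l r" "eqp S (enc ` A)" "eqp T (enc ` B)"
      by (auto simp: cl_def)
    have "eqp (times (enc ` A) (enc ` B)) (enc ` C)"
      using * AB prod_bij_iff by blast
    with eqp_times[OF AB(3,4)] * show "C \<in> cl (times S T)"
      unfolding cl_def using eqp_trans by blast
  next
    fix C assume "C \<in> cl (times S T)"
    then have C: "C \<in> Def l r" "eqp (times S T) (enc ` C)" by (auto simp: cl_def)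
    have "eqp (times (enc ` lift 0 S) (enc ` lift 0 T)) (enc ` C)"
      using eqp_trans[OF eqp_sym[OF eqp_times[OF eqp_lift eqp_lift]] C(2)] assms by blast
    then have "\<exists>f. definable_prod_bij l r f (lift 0 S) (lift 0 T) C"
      using prod_bij_iff[OF lift_Def lift_Def C(1)] assms by blast
    then show "C \<in> {C \<in> Def l r. \<exists>A\<in>cl S. \<exists>B\<in>cl T. \<exists>f. definable_prod_bij l r f A B C}"
      using C(1) lift_in_cl[OF assms(1)] lift_in_cl[OF assms(2)] by blast
  qed
  finally show ?thesis .
qed

lemma zero_cl: "\<zero>\<^bsub>DS\<^esub> = cl {}"
  using def_class_cl[of "{}"] by (simp add: Def_semiring_def Def_iff)

lemma eqp_singletons: "eqp {c} {d}"
  using eqp_image[OF constructible_simps(3) tf_const, of d c] by simp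

lemma one_cl: "\<one>\<^bsub>DS\<^esub> = cl {c}"
proof -
  have "\<one>\<^bsub>DS\<^esub> = cl {enc []}"
    using def_class_cl[of "{[]}"] by (simp add: Def_semiring_def Def_iff)
  also have "\<dots> = cl {c}" by (simp add: cl_eq_iff eqp_singletons)
  finally show ?thesis .
qed

text \<open>Copies with different tags are disjoint, which provides the representatives that addition asks for.\<close>

definition copy :: "nat \<Rightarrow> 'a set \<Rightarrow> 'a set" where
  "copy i S = pr (tag i) ` S"

lemma copy_constructible: "S \<in> constructible \<Longrightarrow> copy i S \<in> constructible"
  unfolding copy_def by (intro constructible_image tf_pr tf_const tf_id)

lemma cl_copy: "S \<in> constructible \<Longrightarrow> cl (copy i S) = cl S"
proof -
  assume S: "S \<in> constructible"
  then have "eqp S (copy i S)"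
    unfolding copy_def by (intro eqp_image tf_pr tf_const tf_id) (auto simp: inj_on_def)
  with S show ?thesis by (simp add: cl_eq_iff copy_constructible eqp_sym)
qed

lemma copy_disjoint: "i \<noteq> j \<Longrightarrow> copy i S \<inter> copy j T = {}"
  by (auto simp: copy_def)

lemma cl_add: "S \<in> constructible \<Longrightarrow> T \<in> constructible \<Longrightarrow> cl S \<oplus>\<^bsub>DS\<^esub> cl T = cl (copy 0 S \<union> copy 1 T)"
  using add_cl[of "copy 0 S" "copy 1 T"] by (simp add: copy_constructible cl_copy copy_disjoint)

lemma abelian_monoid_DS: "abelian_monoid DS"
proof (rule abelian_monoidI)
  fix a b assume "a \<in> carrier DS" "b \<in> carrier DS"
  then obtain S T where ab: "S \<in> constructible" "a = cl S" "T \<in> constructible" "b = cl T"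
    by (auto simp: carrier_DS)
  then show "a \<oplus>\<^bsub>DS\<^esub> b \<in> carrier DS"
    by (simp add: cl_add cl_closed constructible_Un copy_constructible)
  have "a = cl (copy 0 S)" "b = cl (copy 1 T)" using ab by (simp_all add: cl_copy)
  then show "a \<oplus>\<^bsub>DS\<^esub> b = b \<oplus>\<^bsub>DS\<^esub> a"
    using ab by (simp add: add_cl copy_constructible copy_disjoint Un_commute)
next
  fix a b c assume "a \<in> carrier DS" "b \<in> carrier DS" "c \<in> carrier DS"
  then obtain S T U where abc: "S \<in> constructible" "a = cl S" "T \<in> constructible" "b = cl T"
    "U \<in> constructible" "c = cl U"
    by (auto simp: carrier_DS)
  then have eq: "a = cl (copy 0 S)" "b = cl (copy 1 T)" "c = cl (copy 2 U)" by (simp_all add: cl_copy)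
  have d: "copy 0 S \<inter> copy 1 T = {}" "copy 1 T \<inter> copy 2 U = {}" "copy 0 S \<inter> copy 2 U = {}"
    by (simp_all add: copy_disjoint)
  then have "(copy 0 S \<union> copy 1 T) \<inter> copy 2 U = {}" "copy 0 S \<inter> (copy 1 T \<union> copy 2 U) = {}"
    by blast+
  with d show "a \<oplus>\<^bsub>DS\<^esub> b \<oplus>\<^bsub>DS\<^esub> c = a \<oplus>\<^bsub>DS\<^esub> (b \<oplus>\<^bsub>DS\<^esub> c)"
    unfolding eq using abc by (simp add: add_cl copy_constructible constructible_Un Un_assoc)
next
  show "\<zero>\<^bsub>DS\<^esub> \<in> carrier DS" by (simp add: zero_cl cl_closed)
next
  fix a assume "a \<in> carrier DS"
  then obtain S where "S \<in> constructible" "a = cl S" by (auto simp: carrier_DS)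
  then show "\<zero>\<^bsub>DS\<^esub> \<oplus>\<^bsub>DS\<^esub> a = a" by (simp add: zero_cl add_cl)
qed

definition chi :: "'a list set set \<Rightarrow> int \<times> int" where
  "chi a = (let S = SOME S. S \<in> constructible \<and> a = cl S in (euler 0 S, euler 1 S))"

lemma chi_cl: "S \<in> constructible \<Longrightarrow> chi (cl S) = (euler 0 S, euler 1 S)"
proof -
  assume S: "S \<in> constructible"
  define T where "T = (SOME T. T \<in> constructible \<and> cl S = cl T)"
  have "T \<in> constructible \<and> cl S = cl T" unfolding T_def by (rule someI[of _ S]) (use S in simp)
  then have "eqp S T" using S cl_eq_iff[of S T] by blast
  from eqp_euler[OF this] show ?thesis unfolding chi_def T_def[symmetric] Let_def by simp
qed

lemma chi_add:
  assumes "a \<in> carrier DS" "b \<in> carrier DS"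
  shows "chi (a \<oplus>\<^bsub>DS\<^esub> b) = chi a \<oplus>\<^bsub>Z2\<^esub> chi b"
proof -
  obtain S T where ab: "S \<in> constructible" "a = cl S" "T \<in> constructible" "b = cl T"
    using assms by (auto simp: carrier_DS)
  then have eq: "a = cl (copy 0 S)" "b = cl (copy 1 T)" by (simp_all add: cl_copy)
  show ?thesis
    unfolding eq using ab
    by (simp add: add_cl copy_constructible copy_disjoint chi_cl constructible_Un euler_Un)
qed

lemma chi_mult:
  assumes "a \<in> carrier DS" "b \<in> carrier DS"
  shows "chi (a \<otimes>\<^bsub>DS\<^esub> b) = chi a \<otimes>\<^bsub>Z2\<^esub> chi b"
proof -
  obtain S T where ab: "S \<in> constructible" "a = cl S" "T \<in> constructible" "b = cl T"
    using assms by (auto simp: carrier_DS)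
  have "euler p (times S T) = euler p S * euler p T" if "p * p = p" for p
    unfolding times_def by (rule euler_times[OF ab(1,3) that])
  then show ?thesis using ab by (simp add: mult_cl chi_cl constructible_times)
qed

definition standard :: "nat \<Rightarrow> nat \<Rightarrow> 'a list set set" where
  "standard m n = add_pow DS m \<one>\<^bsub>DS\<^esub> \<oplus>\<^bsub>DS\<^esub> add_pow DS n (cl UNIV)"

lemma one_DS_closed: "\<one>\<^bsub>DS\<^esub> \<in> carrier DS"
  by (simp add: one_cl[of base] cl_closed)

lemma standard_closed: "standard m n \<in> carrier DS"
proof -
  interpret abelian_monoid DS by (rule abelian_monoid_DS)
  show ?thesis unfolding standard_def
    by (intro add.m_closed add.nat_pow_closed one_DS_closed cl_closed) simp
qed

lemma standard_add: "standard m n \<oplus>\<^bsub>DS\<^esub> standard m' n' = standard (m + m') (n + n')"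
proof -
  interpret abelian_monoid DS by (rule abelian_monoid_DS)
  have c: "add_pow DS k \<one>\<^bsub>DS\<^esub> \<in> carrier DS" "add_pow DS k (cl UNIV) \<in> carrier DS" for k :: nat
    by (simp_all add: one_DS_closed cl_closed)
  have p: "add_pow DS (m + m') \<one>\<^bsub>DS\<^esub> = add_pow DS m \<one>\<^bsub>DS\<^esub> \<oplus>\<^bsub>DS\<^esub> add_pow DS m' \<one>\<^bsub>DS\<^esub>"
    "add_pow DS (n + n') (cl UNIV) = add_pow DS n (cl UNIV) \<oplus>\<^bsub>DS\<^esub> add_pow DS n' (cl UNIV)"
    using add.nat_pow_mult[OF one_DS_closed, of m m'] add.nat_pow_mult[OF cl_closed, of UNIV n n']
    by simp_all
  show ?thesis unfolding standard_def p using c by (simp add: a_ac)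
qed

lemma chi_standard: "chi (standard m n) = (int m, int m + int n)"
proof -
  interpret abelian_monoid DS by (rule abelian_monoid_DS)
  have chi_mult: "chi (add_pow DS k a) = (int k * fst (chi a), int k * snd (chi a))"
    if a: "a \<in> carrier DS" for k :: nat and a
  proof (induction k)
    case 0
    show ?case by (simp add: zero_cl chi_cl)
  next
    case (Suc k)
    then show ?case
      using a by (simp add: chi_add algebra_simps)
  qed
  show ?thesis
    unfolding standard_def
    by (simp add: chi_add chi_mult one_DS_closed cl_closed chi_cl one_cl[of base])
qed

text \<open>Closed sets are empty, a point or a copy of the universe, and the property passes to disjoint unions
and proper differences.\<close>

lemma stably_standard:
  assumes "S \<in> constructible"
  shows "\<exists>m n m' n'. cl S \<oplus>\<^bsub>DS\<^esub> standard m n = standard m' n'"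
  using assms
proof (induction rule: constructible_dynkin_induct)
  interpret abelian_monoid DS by (rule abelian_monoid_DS)
  {
    case (closed E)
    have "\<exists>m' n'. cl E = standard m' n'"
    proof (cases rule: closed_eqp_cases[OF closed])
      case 1
      have "cl E = standard 0 0" by (simp add: 1 standard_def zero_cl[symmetric])
      then show ?thesis by blast
    next
      case (2 c)
      have "cl E = standard 1 0" by (simp add: 2 standard_def one_cl[symmetric] one_DS_closed)
      then show ?thesis by blast
    next
      case 3
      then have "cl E = cl UNIV" using cl_eq_iff eqp_constructible eqp_sym by blast
      also have "\<dots> = standard 0 1" by (simp add: standard_def cl_closed)
      finally show ?thesis by blast
    qed
    then obtain m n where "cl E = standard m n" by blast
    then have "cl E \<oplus>\<^bsub>DS\<^esub> standard 0 0 = standard m n" by (simp add: standard_add)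
    then show ?case by blast
  next
    case (Un S T)
    obtain m n m' n' where S: "cl S \<oplus>\<^bsub>DS\<^esub> standard m n = standard m' n'" using Un by blast
    obtain i j i' j' where T: "cl T \<oplus>\<^bsub>DS\<^esub> standard i j = standard i' j'" using Un by blast
    have "cl (S \<union> T) \<oplus>\<^bsub>DS\<^esub> standard (m + i) (n + j) =
        (cl S \<oplus>\<^bsub>DS\<^esub> cl T) \<oplus>\<^bsub>DS\<^esub> (standard m n \<oplus>\<^bsub>DS\<^esub> standard i j)"
      using Un by (simp add: add_cl standard_add)
    also have "\<dots> = (cl S \<oplus>\<^bsub>DS\<^esub> standard m n) \<oplus>\<^bsub>DS\<^esub> (cl T \<oplus>\<^bsub>DS\<^esub> standard i j)"
      using Un by (simp add: a_ac cl_closed standard_closed)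
    also have "\<dots> = standard (m' + i') (n' + j')" by (simp add: S T standard_add)
    finally show ?case by blast
  next
    case (Diff S T)
    obtain m n m' n' where S: "cl S \<oplus>\<^bsub>DS\<^esub> standard m n = standard m' n'" using Diff by blast
    obtain i j i' j' where T: "cl T \<oplus>\<^bsub>DS\<^esub> standard i j = standard i' j'" using Diff by blast
    have D: "T - S \<in> constructible" using Diff by (simp add: constructible_Diff)
    have split: "cl (T - S) \<oplus>\<^bsub>DS\<^esub> cl S = cl T"
      using Diff D by (subst add_cl) (auto simp: Un_absorb2)
    have "cl (T - S) \<oplus>\<^bsub>DS\<^esub> (standard m' n' \<oplus>\<^bsub>DS\<^esub> standard i j) =
        cl (T - S) \<oplus>\<^bsub>DS\<^esub> (cl S \<oplus>\<^bsub>DS\<^esub> standard m n) \<oplus>\<^bsub>DS\<^esub> standard i j"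
      using Diff D by (simp add: S a_assoc cl_closed standard_closed)
    also have "\<dots> = (cl (T - S) \<oplus>\<^bsub>DS\<^esub> cl S) \<oplus>\<^bsub>DS\<^esub> standard i j \<oplus>\<^bsub>DS\<^esub> standard m n"
      using Diff D by (simp add: a_ac cl_closed standard_closed)
    also have "\<dots> = standard i' j' \<oplus>\<^bsub>DS\<^esub> standard m n"
      by (simp only: split T)
    finally have "cl (T - S) \<oplus>\<^bsub>DS\<^esub> (standard m' n' \<oplus>\<^bsub>DS\<^esub> standard i j) = standard i' j' \<oplus>\<^bsub>DS\<^esub> standard m n" .
    then show ?case unfolding standard_add by blast
  }
qed

text \<open>After adding a suitable standard class both sides are standard, and a standard class is determined
by its invariants \<open>(m, m + n)\<close>.\<close>

lemma chi_complete:
  assumes "a \<in> carrier DS" "b \<in> carrier DS" "chi a = chi b"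
  shows "\<exists>c\<in>carrier DS. a \<oplus>\<^bsub>DS\<^esub> c = b \<oplus>\<^bsub>DS\<^esub> c"
proof -
  interpret abelian_monoid DS by (rule abelian_monoid_DS)
  obtain m n m' n' where a: "a \<oplus>\<^bsub>DS\<^esub> standard m n = standard m' n'"
    using assms(1) stably_standard unfolding carrier_DS by blast
  obtain i j i' j' where b: "b \<oplus>\<^bsub>DS\<^esub> standard i j = standard i' j'"
    using assms(2) stably_standard unfolding carrier_DS by blast
  have "chi a \<oplus>\<^bsub>Z2\<^esub> chi (standard m n) = chi (standard m' n')"
    "chi b \<oplus>\<^bsub>Z2\<^esub> chi (standard i j) = chi (standard i' j')"
    using a b assms(1,2) chi_add standard_closed by metis+
  then have eq: "m' + i = i' + m" "n' + j = j' + n"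
    using assms(3) by (simp_all add: chi_standard)
  have "a \<oplus>\<^bsub>DS\<^esub> standard (m + i) (n + j) = (a \<oplus>\<^bsub>DS\<^esub> standard m n) \<oplus>\<^bsub>DS\<^esub> standard i j"
    using assms by (simp add: standard_add[symmetric] a_assoc standard_closed)
  also have "\<dots> = (b \<oplus>\<^bsub>DS\<^esub> standard i j) \<oplus>\<^bsub>DS\<^esub> standard m n"
    by (simp add: a b standard_add eq)
  also have "\<dots> = b \<oplus>\<^bsub>DS\<^esub> standard (m + i) (n + j)"
    using assms by (simp add: standard_add[symmetric] a_ac standard_closed)
  finally show ?thesis using standard_closed by blast
qed

text \<open>The invariants generate all pairs of integers: \<open>(s, t)\<close> is the value of \<open>s\<close> points and \<open>t - s\<close> copies
of the universe, where negative multiplicities are moved to the other side.\<close>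

lemma additive_invariant_chi: "additive_invariant Z2 DS chi"
proof (intro additive_invariant.intro additive_invariant_axioms.intro cring_Z2)
  interpret abelian_monoid DS by (rule abelian_monoid_DS)
  show "\<zero>\<^bsub>DS\<^esub> \<in> carrier DS" by simp
  show "\<one>\<^bsub>DS\<^esub> \<in> carrier DS" by (rule one_DS_closed)
  show "chi \<zero>\<^bsub>DS\<^esub> = \<zero>\<^bsub>Z2\<^esub>" by (simp add: zero_cl chi_cl)
  show "chi \<one>\<^bsub>DS\<^esub> = \<one>\<^bsub>Z2\<^esub>" by (simp add: one_cl[of base] chi_cl)
  show "chi a \<in> carrier Z2" for a by simp
  fix a b assume ab: "a \<in> carrier DS" "b \<in> carrier DS"
  show "a \<oplus>\<^bsub>DS\<^esub> b \<in> carrier DS" using ab by simp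
  show "a \<otimes>\<^bsub>DS\<^esub> b \<in> carrier DS"
    using ab by (auto simp: carrier_DS mult_cl intro!: imageI constructible_times)
  show "chi (a \<oplus>\<^bsub>DS\<^esub> b) = chi a \<oplus>\<^bsub>Z2\<^esub> chi b" by (rule chi_add[OF ab])
  show "chi (a \<otimes>\<^bsub>DS\<^esub> b) = chi a \<otimes>\<^bsub>Z2\<^esub> chi b" by (rule chi_mult[OF ab])
  show "\<exists>c\<in>carrier DS. a \<oplus>\<^bsub>DS\<^esub> c = b \<oplus>\<^bsub>DS\<^esub> c" if "chi a = chi b"
    by (rule chi_complete[OF ab that])
next
  fix x :: "int \<times> int" assume "x \<in> carrier Z2"
  obtain s t where x: "x = (s, t)" by (cases x)
  let ?a = "standard (nat s) (nat (t - s))" and ?b = "standard (nat (- s)) (nat (s - t))"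
  have "x \<oplus>\<^bsub>Z2\<^esub> chi ?b = chi ?a" by (simp add: x chi_standard)
  then show "\<exists>a\<in>carrier DS. \<exists>b\<in>carrier DS. x \<oplus>\<^bsub>Z2\<^esub> chi b = chi a"
    using standard_closed by blast
qed

lemma K0_class_line:
  "K0_class l r {[x] |x. True} = additive_invariant.difference Z2 DS chi (0, 1)"
proof -
  interpret additive_invariant Z2 DS chi by (rule additive_invariant_chi)
  have "{[x] |x. True} = lift 0 UNIV" by (auto simp: lift_def)
  moreover have "def_class l r (lift 0 UNIV) = cl UNIV"
    using eqp_lift[of UNIV 0] lift_Def[of UNIV 0]
    by (simp add: def_class_cl cl_eq_iff enc_constructible eqp_sym)
  ultimately show ?thesis
    using difference_class[OF cl_closed, of UNIV]
    by (simp add: K0_class_def Let_def chi_cl)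
qed

end

section \<open>The Grothendieck ring\<close>

theorem theorem10p3:
  fixes l r :: "'a \<Rightarrow> 'a"
  assumes "pairing_without_cycles l r"
  shows "cring (K0 l r) \<and>
    (\<exists>h \<in> ring_hom ZX (K0 l r).
       h X_ZX = K0_class l r {[x] |x. True} \<and>
       (\<forall>g \<in> ring_hom ZX (K0 l r).
          g X_ZX = K0_class l r {[x] |x. True} \<longrightarrow> (\<forall>p \<in> carrier ZX. g p = h p)) \<and>
       (\<exists>\<phi> \<in> ring_iso (ZX Quot ideal_ZX) (K0 l r).
          \<forall>p \<in> carrier ZX. \<phi> (ideal_ZX +>\<^bsub>ZX\<^esub> p) = h p)) \<and>
    ZX Quot ideal_ZX \<simeq> RDirProd INTEG INTEG \<and>
    K0 l r \<simeq> RDirProd INTEG INTEG"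
proof -
  interpret acyclic_pairing l r using assms by unfold_locales
  interpret inv: additive_invariant Z2 DS chi by (rule additive_invariant_chi)
  define \<psi> where "\<psi> = inv.difference"
  have \<psi>: "\<psi> \<in> ring_iso Z2 (K0 l r)"
    unfolding \<psi>_def K0_def by (rule inv.difference_iso)
  then have \<psi>_hom: "\<psi> \<in> ring_hom Z2 (K0 l r)" by (simp add: ring_iso_def)
  have K0: "cring (K0 l r)" unfolding K0_def by (rule inv.difference_ring_cring)
  define \<phi> where "\<phi> = \<psi> \<circ> (\<lambda>c. the_elem (eval01 ` c))"
  interpret e: ring_hom_ring ZX Z2 eval01
    by (rule ring_hom_ringI2[OF INTEG.UP_ring cring.axioms(1)[OF cring_Z2] eval01_hom])
  have quot: "(\<lambda>c. the_elem (eval01 ` c)) \<in> ring_iso (ZX Quot ideal_ZX) Z2"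
    using e.FactRing_iso_set surj_eval01 by (simp add: kernel_eval01)
  have h: "\<psi> \<circ> eval01 \<in> ring_hom ZX (K0 l r)"
    by (rule ring_hom_trans[OF eval01_hom \<psi>_hom])
  have hX: "(\<psi> \<circ> eval01) X_ZX = K0_class l r {[x] |x. True}"
    unfolding comp_apply eval01_X K0_class_line \<psi>_def ..
  have \<phi>: "\<phi> \<in> ring_iso (ZX Quot ideal_ZX) (K0 l r)"
    unfolding \<phi>_def by (rule ring_iso_set_trans[OF quot \<psi>])
  have \<phi>h: "\<phi> (ideal_ZX +>\<^bsub>ZX\<^esub> p) = (\<psi> \<circ> eval01) p" if "p \<in> carrier ZX" for p
  proof -
    have "the_elem (eval01 ` (ideal_ZX +>\<^bsub>ZX\<^esub> p)) = eval01 p"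
      using e.the_elem_simp[OF that] unfolding kernel_eval01 .
    then show ?thesis by (simp only: \<phi>_def comp_apply)
  qed
  have unique: "\<forall>g \<in> ring_hom ZX (K0 l r).
      g X_ZX = K0_class l r {[x] |x. True} \<longrightarrow> (\<forall>p \<in> carrier ZX. g p = (\<psi> \<circ> eval01) p)"
    using ZX_hom_unique[OF K0 _ h] hX by simp
  have iso1: "ZX Quot ideal_ZX \<simeq> Z2" using quot unfolding is_ring_iso_def by blast
  have iso2: "K0 l r \<simeq> Z2"
    using ring_iso_set_sym[OF cring.axioms(1)[OF cring_Z2] \<psi>] unfolding is_ring_iso_def by blast
  show ?thesis
    by (intro conjI bexI[of _ "\<psi> \<circ> eval01"] bexI[of _ \<phi>] ballI K0 hX unique \<phi>h iso1 iso2 h \<phi>)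
qed

end
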